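(* There is an absolute constant $C>0$ such that the following holds. Let, for every prime power $p^v$ ($p$ prime, $v\ge 1$), a subset $A_{p^v}\subset \mathbf{Z}/p^v\mathbf{Z}$ be given (possibly empty, and with no relation required between the sets for different powers of the same prime). Suppose there are constants $\alpha>0$ and $x_0\ge 2$ such that $\sum_{p\le y,\ \rho(p)\ge 1}\log p\ge \alpha y$ for all $y\ge x_0$. Then for all $x$ sufficiently large in terms of $\alpha$ and $x_0$, $$\frac{1}{|\mathcal{Q}(x)|}\sum_{q\in\mathcal{Q}(x)}\operatorname{disc}(\Delta_q)\le \frac{C}{\alpha}\exp\Big(-\frac16\sum_{\substack{p\le x\\ \rho(p)\ge 2}}\frac1p\Big).$$
   Context: For an integer $q\ge1$, $A_q\subset\mathbf{Z}/q\mathbf{Z}$ is the set of residue classes $a\bmod q$ such that $a\bmod p^v\in A_{p^v}$ for every prime power $p^v$ exactly dividing $q$ (i.e. $p^v\mid q$, $p^{v+1}\nmid q$); $\rho(q)=|A_q|$ (so $\rho(1)=1$ and $\rho$ is multiplicative). $\mathcal{Q}$ is the set of $q\ge1$ with $\rho(q)\ge1$, and $\mathcal{Q}(x)=\{q\in\mathcal{Q}: q\le x\}$. For $q\in\mathcal{Q}$, $\Delta_q=\frac1{\rho(q)}\sum_{a\in A_q}\delta_{\{a/q\}}$ is a probability measure on $\mathbf{R}/\mathbf{Z}$, where $\{\cdot\}$ is the fractional part and $\delta_t$ the Dirac mass at $t$. The discrepancy is $\operatorname{disc}(\Delta_q)=\sup_I|\Delta_q(I)-|I||$, the supremum over all closed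 intervals $I$ of $\mathbf{R}/\mathbf{Z}$ (images of closed intervals of $\mathbf{R}$ of length at most $1$), $|I|$ the length. *)

theory Defs
  imports "HOL-Probability.Probability" "HOL-Computational_Algebra.Primes"
begin

(* A residue class modulo q is represented by its representative in {0..<q}, and
   a point of R/Z by its representative in [0,1), so that frac is the projection R -> R/Z.
   A family (A_{p^v}) indexed by prime powers is a function A :: nat => nat set; only its values
   at prime powers are ever used. *)

definition residue_family :: "(nat \<Rightarrow> nat set) \<Rightarrow> bool" where
  "residue_family A \<longleftrightarrow> (\<forall>p v. prime p \<and> v \<ge> 1 \<longrightarrow> A (p ^ v) \<subseteq> {..<p ^ v})"

definition crt_set :: "(nat \<Rightarrow> nat set) \<Rightarrow> nat \<Rightarrow> nat set" where
  "crt_set A q = {a. a < q \<and>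
     (\<forall>p v. prime p \<and> v \<ge> 1 \<and> p ^ v dvd q \<and> \<not> p ^ (v + 1) dvd q \<longrightarrow> a mod p ^ v \<in> A (p ^ v))}"

definition rho :: "(nat \<Rightarrow> nat set) \<Rightarrow> nat \<Rightarrow> nat" where
  "rho A q = card (crt_set A q)"

definition Q_set :: "(nat \<Rightarrow> nat set) \<Rightarrow> nat set" where
  "Q_set A = {q. q \<ge> 1 \<and> rho A q \<ge> 1}"

definition Q_upto :: "(nat \<Rightarrow> nat set) \<Rightarrow> real \<Rightarrow> nat set" where
  "Q_upto A x = {q \<in> Q_set A. real q \<le> x}"

(* Meaningful only for q in Q_set A, where crt_set A q is finite and nonempty;
   see measure_Delta below for the explicit formula. *)
definition Delta :: "(nat \<Rightarrow> nat set) \<Rightarrow> nat \<Rightarrow> real pmf" where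
  "Delta A q = map_pmf (\<lambda>a. frac (real a / real q)) (pmf_of_set (crt_set A q))"

(* The closed intervals of R/Z are the sets frac ` {s..t} with s \<le> t \<le> s + 1, of length t - s. *)
definition disc :: "real pmf \<Rightarrow> real" where
  "disc \<mu> = Sup {\<bar>measure_pmf.prob \<mu> (frac ` {s..t}) - (t - s)\<bar> | s t. s \<le> t \<and> t \<le> s + 1}"

lemma finite_crt_set: "finite (crt_set A q)"
  by (rule finite_subset[of _ "{..<q}"]) (auto simp: crt_set_def)

lemma crt_set_1: "crt_set A 1 = {0}"
  by (auto simp: crt_set_def)

lemma crt_set_prime_power:
  assumes "residue_family A" "prime p" "v \<ge> 1"
  shows "crt_set A (p ^ v) = A (p ^ v)"
proof -
  have gt1: "p > 1" using assms(2) prime_gt_1_nat by blast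
  have not_dvd: "\<not> p ^ (v + 1) dvd p ^ v"
    using power_dvd_imp_le[of p "v + 1" v] gt1 by linarith
  have unique: "r = p \<and> w = v"
    if rw: "prime r" "w \<ge> 1" "r ^ w dvd p ^ v" "\<not> r ^ (w + 1) dvd p ^ v" for r w
  proof -
    have "r dvd r ^ w" using rw(2) by (intro dvd_power) simp
    with rw(3) have "r dvd p ^ v" by (rule dvd_trans[rotated])
    then have r: "r = p"
      using rw(1) assms(2) by (meson prime_dvd_power primes_dvd_imp_eq)
    have "w \<le> v" using power_dvd_imp_le[of p w v] rw(3) gt1 r by simp
    moreover have "\<not> w + 1 \<le> v" using rw(4) r le_imp_power_dvd by blast
    ultimately show ?thesis using r by simp
  qed
  show ?thesis
  proof (rule set_eqI)
    fix a
    have "a \<in> crt_set A (p ^ v) \<longleftrightarrow> a < p ^ v \<and> a mod p ^ v \<in> A (p ^ v)"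
      unfolding crt_set_def mem_Collect_eq
      using unique not_dvd assms(2,3) dvd_refl[of "p ^ v"] by metis
    also have "\<dots> \<longleftrightarrow> a \<in> A (p ^ v)"
    proof -
      have "A (p ^ v) \<subseteq> {..<p ^ v}"
        using assms unfolding residue_family_def by blast
      then show ?thesis by (metis lessThan_iff mod_less subsetD)
    qed
    finally show "a \<in> crt_set A (p ^ v) \<longleftrightarrow> a \<in> A (p ^ v)" .
  qed
qed

lemma measure_Delta:
  assumes "q \<in> Q_set A"
  shows "measure_pmf.prob (Delta A q) S =
    (1 / real (rho A q)) * (\<Sum>a\<in>crt_set A q. indicator S (frac (real a / real q)))"
proof -
  have ne: "crt_set A q \<noteq> {}"
    using assms by (auto simp: Q_set_def rho_def)
  show ?thesis
    unfolding Delta_def rho_def measure_map_pmf measure_pmf_of_set[OF ne finite_crt_set]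
    using finite_crt_set[of A q]
    by (simp add: indicator_def sum.If_cases) (simp add: Int_def vimage_def)
qed

end

theory Submission
  imports Defs "HOL-Number_Theory.Number_Theory" "HOL-Real_Asymp.Real_Asymp"
begin

text \<open>
  By a finite Erdos--Turan inequality on \<open>\<int>/q\<int>\<close>, the discrepancy is controlled by the Weyl sums
  \<open>W(h; q)\<close>, and the Chinese remainder theorem gives \<open>\<bar>W(h; u n)\<bar> \<le> \<bar>W(h c; u)\<bar>\<close> with
  \<open>c\<close> the inverse of \<open>n\<close> modulo \<open>u\<close>. Apart from a negligible set of exceptions, every \<open>q \<le> x\<close> is a
  product \<open>u n\<close> of a smooth part \<open>u \<le> x powr (1 / 3)\<close> with primes at most \<open>x powr (1 / k)\<close> and a part \<open>n\<close> free of primes up to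
  \<open>x powr (1 / (k + 1))\<close>. For fixed \<open>u\<close>, a Selberg sieve bounds the number of \<open>n\<close> in each reduced class
  modulo \<open>u\<close> by a constant times the expected number, so that only the mean of \<open>\<bar>W(h c; u)\<bar>\<close> over units \<open>c\<close>
  matters. This mean is multiplicative in \<open>u\<close>, and by Parseval it is at most \<open>3/4\<close> at each prime with
  \<open>\<rho>(p) \<ge> 2\<close> not dividing \<open>h\<close>. Rankin's trick gives a factor \<open>exp (- k)\<close>, which makes the sum over \<open>k\<close>
  converge. The resulting bound carries the same Euler product as the lower bound for the number of moduli. Only
  the estimate \<open>(\<Sum>p\<le>x. ln p / p) \<le> 2 ln x\<close> is needed about primes. The slack between the
  exponents \<open>1/4\<close> (from \<open>3/4\<close>) and \<open>1/6\<close> absorbs the sum over the frequencies \<open>h\<close>.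
\<close>

section \<open>Smooth numbers and sums over primes\<close>

text \<open>The argument is a budget of exponentials in \<open>k\<close>. Sifting \<open>n\<close>
  only up to primes near x^(1/(k+1)) costs a factor of order k + 1. Cutting the Euler product of
  \<open>weyl_mean\<close> at x^(1/k) discards primes whose reciprocals sum to at most 2k, and at a
  saving of 1/4 per prime this costs exp(k/2). Rankin's shift by beta = 6k / ln x on u > x^(1/6)
  wins exp(-k). What is left, (k + 1) exp(-k/2), is summable. The linear 2k, where Mertens would
  give ln k, is the price of the elementary prime estimate. The cut of \<open>u\<close> at x^(1/3)
  keeps the sieve remainder R^4 below the main term, of order x / (u phi(u) ln x), because u phi(u)
  is at most x^(2/3). Prime powers p^v with v >= 2 are uncontrolled. In the upper bound they enter
  only through \<open>weyl_mean\<close> <= 1 and contribute O(p^(-3/2)) each; the lower bound counts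
  squarefree moduli only. So both sides carry exp of the same sum of 1/p over \<open>rho\<close> >=
  1, and the ratio isolates the primes with \<open>rho\<close> >= 2.\<close>

definition smooth_set :: "nat set \<Rightarrow> nat \<Rightarrow> nat set" where
  "smooth_set P V = {n. n > 0 \<and> (\<forall>p. prime p \<and> p dvd n \<longrightarrow> p \<in> P) \<and> (\<forall>p. prime p \<longrightarrow> multiplicity p n \<le> V)}"

definition coprime_multiplicative :: "(nat \<Rightarrow> real) \<Rightarrow> bool" where
  "coprime_multiplicative f \<longleftrightarrow> f 1 = 1 \<and> (\<forall>m n. m > 0 \<longrightarrow> n > 0 \<longrightarrow> coprime m n \<longrightarrow> f (m * n) = f m * f n)"

lemma smooth_set_empty: "smooth_set {} V = {1}"
proof -
  have "n = 1" if "n > 0" "\<forall>p. \<not> (prime p \<and> p dvd n)" for n :: nat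
    using that prime_factor_nat by blast
  then show ?thesis by (auto simp: smooth_set_def)
qed

lemma smooth_set_coprime:
  assumes "m \<in> smooth_set P V" "prime p" "p \<notin> P"
  shows "coprime m (p ^ v)"
proof -
  have "\<not> p dvd m" using assms by (auto simp: smooth_set_def)
  then show ?thesis
    using assms(2) by (metis coprime_commute coprime_power_left_iff prime_imp_coprime)
qed

lemma multiplicity_mult_prime_power:
  fixes m p r v :: nat
  assumes "m > 0" "prime r" "prime p"
  shows "multiplicity r (m * p ^ v) = multiplicity r m + (if r = p then v else 0)"
proof -
  have p0: "p \<noteq> 0" using assms(3) by auto
  have "multiplicity r (m * p ^ v) = multiplicity r m + multiplicity r (p ^ v)"
    using assms p0 by (intro prime_elem_multiplicity_mult_distrib) auto
  moreover have "multiplicity r (p ^ v) = v * multiplicity r p"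
    using assms p0 by (intro prime_elem_multiplicity_power_distrib) auto
  moreover have "multiplicity r p = (if r = p then 1 else 0)"
    using assms prime_multiplicity_other[of r p] multiplicity_prime[of p] by auto
  ultimately show ?thesis by simp
qed

text \<open>Unique factorisation, peeling off the full power of one new prime. This is the induction
  step of the Euler product.\<close>

lemma smooth_set_insert:
  assumes p: "prime p" "p \<notin> P"
  shows "bij_betw (\<lambda>(m, v). m * p ^ v) (smooth_set P V \<times> {..V}) (smooth_set (insert p P) V)"
proof (rule bij_betw_imageI)
  have p1: "p > 1" using p(1) by (rule prime_gt_1_nat)
  have mp: "multiplicity p (m * p ^ v) = v" if "m \<in> smooth_set P V" for m v
  proof -
    have "multiplicity p m = 0" "m > 0"
      using that p by (auto simp: smooth_set_def intro: not_dvd_imp_multiplicity_0)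
    then show ?thesis using multiplicity_mult_prime_power[of m p p v] p(1) by simp
  qed
  show "inj_on (\<lambda>(m, v). m * p ^ v) (smooth_set P V \<times> {..V})"
  proof (rule inj_onI)
    fix a b assume ab: "a \<in> smooth_set P V \<times> {..V}" "b \<in> smooth_set P V \<times> {..V}"
      "(\<lambda>(m, v). m * p ^ v) a = (\<lambda>(m, v). m * p ^ v) b"
    obtain m v m' v' where eq: "a = (m, v)" "b = (m', v')" by fastforce
    then have "v = v'" using ab mp[of m v] mp[of m' v'] by auto
    then show "a = b" using ab eq p1 by simp
  qed
  show "(\<lambda>(m, v). m * p ^ v) ` (smooth_set P V \<times> {..V}) = smooth_set (insert p P) V"
  proof (rule equalityI; rule subsetI)
    fix n assume "n \<in> (\<lambda>(m, v). m * p ^ v) ` (smooth_set P V \<times> {..V})"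
    then obtain m v where n: "n = m * p ^ v" and m: "m \<in> smooth_set P V" and v: "v \<le> V" by auto
    have "r \<in> insert p P" if "prime r" "r dvd m * p ^ v" for r
    proof -
      have "r dvd m \<or> r dvd p" using that by (metis prime_dvd_mult_iff prime_dvd_power)
      then show ?thesis using that m p(1) primes_dvd_imp_eq by (auto simp: smooth_set_def)
    qed
    moreover have "multiplicity r (m * p ^ v) \<le> V" if "prime r" for r
      using multiplicity_mult_prime_power[of m r p v] mp[OF m, of v] m v that p(1)
      by (cases "r = p") (auto simp: smooth_set_def)
    ultimately show "n \<in> smooth_set (insert p P) V"
      using m p1 by (auto simp: smooth_set_def n)
  next
    fix n assume n: "n \<in> smooth_set (insert p P) V"
    define m where "m = n div p ^ multiplicity p n"
    have nm: "n = m * p ^ multiplicity p n" by (simp add: m_def multiplicity_dvd)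
    have n0: "n > 0" using n by (auto simp: smooth_set_def)
    then have m0: "m > 0" using nm by (metis gr0I mult_zero_left less_numeral_extra(3))
    have "\<not> p dvd m" using multiplicity_decompose[of n p] n0 p1 by (simp add: m_def)
    moreover have mn: "m dvd n" using nm by (metis dvd_triv_left)
    ultimately have "r \<in> P" if "prime r" "r dvd m" for r
      using that n by (auto simp: smooth_set_def dest: dvd_trans)
    moreover have "multiplicity r m \<le> V" if "prime r" for r
    proof -
      have "multiplicity r m \<le> multiplicity r n" using mn n0 by (intro dvd_imp_multiplicity_le) auto
      moreover have "multiplicity r n \<le> V" using n that unfolding smooth_set_def by blast
      ultimately show ?thesis by simp
    qed
    ultimately have "(m, multiplicity p n) \<in> smooth_set P V \<times> {..V}"
      using m0 n p(1) by (auto simp: smooth_set_def)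
    then show "n \<in> (\<lambda>(m, v). m * p ^ v) ` (smooth_set P V \<times> {..V})"
      using nm by force
  qed
qed

text \<open>The cap \<open>V\<close> on the exponents makes the Euler product an identity between
  finite sums. The case V = 1 describes squarefree numbers. Finiteness of the index set travels
  through the same induction.\<close>

lemma smooth_set_finite_and_sum:
  assumes f: "coprime_multiplicative f" and "finite P" and "\<And>p. p \<in> P \<Longrightarrow> prime p"
  shows "finite (smooth_set P V) \<and> (\<Sum>n\<in>smooth_set P V. f n) = (\<Prod>p\<in>P. \<Sum>v\<le>V. f (p ^ v))"
  using assms(2,3)
proof (induction P rule: finite_induct)
  case empty
  then show ?case using f by (simp add: smooth_set_empty coprime_multiplicative_def)
next
  case (insert p P)
  have p: "prime p" "p \<notin> P" using insert by auto
  have p0: "p > 0" using p(1) prime_gt_0_nat by blast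
  note bij = smooth_set_insert[OF p, of V]
  have fin: "finite (smooth_set P V)" using insert by auto
  then have fin': "finite (smooth_set (insert p P) V)"
    using bij bij_betw_finite by (metis finite_SigmaI finite_atMost)
  have "(\<Sum>n\<in>smooth_set (insert p P) V. f n) = (\<Sum>(m, v)\<in>smooth_set P V \<times> {..V}. f m * f (p ^ v))"
    unfolding sum.reindex_bij_betw[OF bij, symmetric]
    using smooth_set_coprime[OF _ p] f p0
    by (intro sum.cong) (auto simp: coprime_multiplicative_def smooth_set_def)
  also have "\<dots> = (\<Sum>n\<in>smooth_set P V. f n) * (\<Sum>v\<le>V. f (p ^ v))"
    by (simp add: sum_product sum.cartesian_product)
  finally show ?case using insert using fin' by (simp add: mult.commute)
qed

lemmas finite_smooth_set = smooth_set_finite_and_sum[THEN conjunct1]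
lemmas sum_smooth_set = smooth_set_finite_and_sum[THEN conjunct2]

lemma multiplicity_le_self:
  fixes p n :: nat
  assumes "prime p" "n > 0"
  shows "multiplicity p n \<le> n"
proof -
  have "multiplicity p n < 2 ^ multiplicity p n" by (rule less_exp)
  also have "\<dots> \<le> p ^ multiplicity p n" using assms prime_ge_2_nat by (intro power_mono) auto
  also have "\<dots> \<le> n" using assms by (intro dvd_imp_le multiplicity_dvd)
  finally show ?thesis by simp
qed

text \<open>An exponent v in n satisfies 2^v <= n <= V, so capping the exponents at \<open>V\<close>
  loses no element of \<open>S\<close>.\<close>

lemma sum_le_euler_product:
  assumes f: "coprime_multiplicative f" "\<And>n. f n \<ge> 0" and P: "finite P" "\<And>p. p \<in> P \<Longrightarrow> prime p"
    and S: "S \<subseteq> {1..V}" "\<And>n p. n \<in> S \<Longrightarrow> prime p \<Longrightarrow> p dvd n \<Longrightarrow> p \<in> P"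
  shows "(\<Sum>n\<in>S. f n) \<le> (\<Prod>p\<in>P. \<Sum>v\<le>V. f (p ^ v))"
proof -
  have "multiplicity p n \<le> V" if "n \<in> S" "prime p" for n p
  proof -
    have "n \<in> {1..V}" using S(1) that by blast
    then show ?thesis using multiplicity_le_self[of p n] that by simp
  qed
  moreover have "n > 0" if "n \<in> S" for n using S(1) that by fastforce
  ultimately have "S \<subseteq> smooth_set P V" using S(2) unfolding smooth_set_def by blast
  then have "(\<Sum>n\<in>S. f n) \<le> (\<Sum>n\<in>smooth_set P V. f n)"
    using finite_smooth_set[OF f(1) P] f(2) by (intro sum_mono2) auto
  then show ?thesis using sum_smooth_set[OF f(1) P] by simp
qed

section \<open>Elementary bounds for sums over primes\<close>

lemma prod_primes_dvd:
  fixes n :: nat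
  assumes "finite P" "\<And>p. p \<in> P \<Longrightarrow> prime p" "\<And>p. p \<in> P \<Longrightarrow> p dvd n"
  shows "\<Prod>P dvd n"
  using assms
proof (induction P rule: finite_induct)
  case (insert p P)
  have "coprime p (\<Prod>P)"
    using insert by (intro prod_coprime_right) (metis insertCI primes_coprime)
  then show ?case using insert by (simp add: divides_mult)
qed simp

lemma sum_ln_prime_divisors_le:
  assumes "n > 0" "finite P" "\<And>p. p \<in> P \<Longrightarrow> prime p" "\<And>p. p \<in> P \<Longrightarrow> p dvd n"
  shows "(\<Sum>p\<in>P. ln (real p)) \<le> ln (real n)"
proof -
  have pos: "\<forall>p\<in>P. real p > 0" using assms(3) prime_gt_0_nat by simp
  then have "(\<Sum>p\<in>P. ln (real p)) = ln (\<Prod>p\<in>P. real p)" using assms(2) by (simp add: ln_prod)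
  also have "(\<Prod>p\<in>P. real p) = real (\<Prod>P)" by simp
  also have "ln (real (\<Prod>P)) \<le> ln (real n)"
  proof (rule ln_mono)
    show "real (\<Prod>P) \<le> real n"
      using prod_primes_dvd[of P n] assms by (simp only: of_nat_le_iff) (simp add: dvd_imp_le)
    show "0 < real (\<Prod>P)" using pos by (simp add: prod_pos)
  qed
  finally show ?thesis .
qed

definition primes_upto_real :: "real \<Rightarrow> nat set" where
  "primes_upto_real x = {p. prime p \<and> real p \<le> x}"

lemma finite_nat_real_le: "finite {n::nat. P n \<and> real n \<le> x}"
  by (rule finite_subset[of _ "{..nat \<lfloor>x\<rfloor>}"]) (auto simp: le_nat_floor)

lemma finite_primes_upto_real: "finite (primes_upto_real x)"
  unfolding primes_upto_real_def by (rule finite_nat_real_le)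

lemma card_multiples:
  assumes "d > 0" shows "card {n\<in>{1..N}. d dvd n} = N div (d::nat)"
proof -
  have "{n\<in>{1..N}. d dvd n} = (\<lambda>k. d * k) ` {1..N div d}"
    using assms by (auto simp: less_eq_div_iff_mult_less_eq mult.commute elim!: dvdE)
  moreover have "inj_on (\<lambda>k. d * k) {1..N div d}" using assms by (auto simp: inj_on_def)
  ultimately show ?thesis by (simp add: card_image)
qed

text \<open>Double counting of ln p over pairs p dvd n with n <= N. For fixed n the primes
  contribute at most ln n; for fixed p there are \<open>N div p\<close> values of n, at least N /
  (2p) since p <= N. This rounding is the source of the factor 2.\<close>

lemma sum_ln_prime_div_le_nat:
  assumes "N \<ge> 1"
  shows "(\<Sum>p | prime p \<and> p \<le> N. ln (real p) / real p) \<le> 2 * ln (real N)"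
proof -
  let ?P = "{p. prime p \<and> p \<le> N}"
  have fin: "finite ?P" by simp
  have "(\<Sum>p\<in>?P. ln (real p) * (real N / (2 * real p))) \<le> (\<Sum>p\<in>?P. ln (real p) * real (N div p))"
  proof (intro sum_mono mult_left_mono)
    fix p assume p: "p \<in> ?P"
    then have p0: "p > 0" and "p \<le> N" using prime_gt_0_nat by auto
    have "N div p \<ge> 1" using p0 \<open>p \<le> N\<close> by (simp add: Suc_leI div_greater_zero_iff)
    moreover have "N < p * (N div p) + p" using p0 by (metis add_less_cancel_left mod_less_divisor mult_div_mod_eq)
    moreover from this have "real N < real p * real (N div p) + real p"
      by (metis of_nat_add of_nat_less_iff of_nat_mult)
    moreover have "real p \<le> real p * real (N div p)" using calculation(1) by (simp add: mult_le_cancel_left1)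
    ultimately have "real N \<le> real (N div p) * (2 * real p)" by (simp add: algebra_simps)
    then show "real N / (2 * real p) \<le> real (N div p)" using p0 by (simp add: divide_le_eq)
    show "0 \<le> ln (real p)" using p0 by simp
  qed
  also have "\<dots> = (\<Sum>p\<in>?P. \<Sum>n | n \<in> {1..N} \<and> p dvd n. ln (real p))"
    using card_multiples[of _ N] prime_gt_0_nat by (intro sum.cong) auto
  also have "\<dots> = (\<Sum>n\<in>{1..N}. \<Sum>p | p \<in> ?P \<and> p dvd n. ln (real p))"
    by (rule sum.swap_restrict) auto
  also have "\<dots> \<le> (\<Sum>n\<in>{1..N}. ln (real N))"
  proof (rule sum_mono)
    fix n assume n: "n \<in> {1..N}"
    have "(\<Sum>p | p \<in> ?P \<and> p dvd n. ln (real p)) \<le> ln (real n)"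
      using n by (intro sum_ln_prime_divisors_le) auto
    also have "\<dots> \<le> ln (real N)" using n by simp
    finally show "(\<Sum>p | p \<in> ?P \<and> p dvd n. ln (real p)) \<le> ln (real N)" .
  qed
  finally have "(real N / 2) * (\<Sum>p\<in>?P. ln (real p) / real p) \<le> (real N / 2) * (2 * ln (real N))"
    by (simp add: sum_distrib_left mult_ac)
  then show ?thesis using assms by simp
qed

lemma sum_ln_prime_div_le:
  assumes "x \<ge> 1"
  shows "(\<Sum>p\<in>primes_upto_real x. ln (real p) / real p) \<le> 2 * ln x"
proof -
  have N: "nat \<lfloor>x\<rfloor> \<ge> 1" using assms by (simp add: le_nat_floor)
  have "primes_upto_real x = {p. prime p \<and> p \<le> nat \<lfloor>x\<rfloor>}"
    using assms by (auto simp: primes_upto_real_def le_nat_iff le_floor_iff)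
  then have "(\<Sum>p\<in>primes_upto_real x. ln (real p) / real p) \<le> 2 * ln (real (nat \<lfloor>x\<rfloor>))"
    using sum_ln_prime_div_le_nat[OF N] by simp
  also have "\<dots> \<le> 2 * ln x" using assms N by simp
  finally show ?thesis .
qed

text \<open>Stands in for Mertens' second theorem: ln w <= ln p on \<open>P\<close>, so the weighted
  sum may be divided by ln w. For w = x powr (1 / k) it gives 2k.\<close>

lemma sum_inverse_primes_interval:
  assumes "w > 1" "x \<ge> 1" "P \<subseteq> primes_upto_real x" "\<And>p. p \<in> P \<Longrightarrow> real p \<ge> w"
  shows "(\<Sum>p\<in>P. 1 / real p) \<le> 2 * ln x / ln w"
proof -
  have fin: "finite P" using assms(3) finite_primes_upto_real finite_subset by blast
  have lw: "ln w > 0" using assms(1) by simp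
  have "(\<Sum>p\<in>P. 1 / real p) * ln w = (\<Sum>p\<in>P. ln w / real p)" by (simp add: sum_distrib_right)
  also have "\<dots> \<le> (\<Sum>p\<in>P. ln (real p) / real p)"
    using assms by (intro sum_mono divide_right_mono) force+
  also have "\<dots> \<le> (\<Sum>p\<in>primes_upto_real x. ln (real p) / real p)"
    using assms(3) finite_primes_upto_real prime_ge_1_nat
    by (intro sum_mono2) (auto simp: primes_upto_real_def intro!: divide_nonneg_nonneg ln_ge_zero)
  also have "\<dots> \<le> 2 * ln x" by (rule sum_ln_prime_div_le) fact
  finally show ?thesis using lw by (simp add: pos_le_divide_eq)
qed

section \<open>A Selberg sieve in residue classes\<close>

lemma card_residue_class:
  fixes M Y c :: nat
  assumes "M \<ge> 1"
  shows "\<bar>real (card {n \<in> {1..Y}. [n = c] (mod M)}) - real Y / real M\<bar> \<le> 1"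
proof -
  \<comment> \<open>The representative lies in {1..M}, not {0..<M}, because the counting range
    starts at 1. Then c' <= M also keeps the subtraction in Y + M - c' exact.\<close>
  define c' where "c' = (if c mod M = 0 then M else c mod M)"
  have c': "1 \<le> c'" "c' \<le> M" "[c' = c] (mod M)"
    using assms by (auto simp: c'_def cong_def less_imp_le Suc_leI)
  define K where "K = (Y + M - c') div M"
  have lt: "j < K \<longleftrightarrow> c' + M * j \<le> Y" for j
  proof -
    have "j < K \<longleftrightarrow> (j + 1) * M \<le> Y + M - c'"
      using assms by (simp add: K_def less_eq_div_iff_mult_less_eq flip: Suc_le_eq)
    also have "\<dots> \<longleftrightarrow> c' + M * j \<le> Y" using c' by (auto simp: algebra_simps)
    finally show ?thesis .
  qed
  have "{n \<in> {1..Y}. [n = c] (mod M)} = (\<lambda>j. c' + M * j) ` {..<K}"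
  proof (rule equalityI; rule subsetI)
    fix n assume n: "n \<in> {n \<in> {1..Y}. [n = c] (mod M)}"
    then have cong: "[n = c'] (mod M)" using c'(3) cong_sym cong_trans by blast
    have "c' \<le> n"
    proof (rule ccontr)
      assume less: "\<not> c' \<le> n"
      show False
      proof (cases "n < M \<and> c' < M")
        case True
        then show False using cong less by (simp add: cong_def)
      next
        case False
        then have "c' = M" "n < M" using less c' by auto
        then show False using cong n by (simp add: cong_def)
      qed
    qed
    then have "M dvd n - c'" using cong cong_altdef_nat by blast
    then obtain j where "n - c' = M * j" by (elim dvdE)
    then have "n = c' + M * j" using \<open>c' \<le> n\<close> by simp
    then show "n \<in> (\<lambda>j. c' + M * j) ` {..<K}" using n lt by auto
  next
    fix n assume "n \<in> (\<lambda>j. c' + M * j) ` {..<K}"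
    then obtain j where "j < K" "n = c' + M * j" by auto
    then show "n \<in> {n \<in> {1..Y}. [n = c] (mod M)}"
      using lt c' by (auto simp: cong_def)
  qed
  moreover have "inj_on (\<lambda>j. c' + M * j) {..<K}" using assms by (auto simp: inj_on_def)
  ultimately have card: "card {n \<in> {1..Y}. [n = c] (mod M)} = K" by (simp add: card_image)
  have "real (K * M) \<le> real (Y + M - c')" unfolding K_def of_nat_le_iff by simp
  then have up: "real K * real M \<le> real Y + real M - real c'" using c' by (simp add: of_nat_diff)
  have "Y + M - c' < K * M + M"
    unfolding K_def using assms by (metis One_nat_def Suc_le_lessD add.commute div_mult_mod_eq mod_less_divisor nat_add_left_cancel_less)
  then have "real (Y + M - c') < real (K * M + M)" by (simp only: of_nat_less_iff)
  then have lo: "real Y - real c' < real K * real M" using c' by (simp add: of_nat_diff)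
  have M0: "real M > 0" using assms by simp
  have "real K - real Y / real M \<le> 1"
    using up c' M0 by (simp add: field_simps)
  moreover have "real Y / real M - real K \<le> 1"
  proof -
    have "real Y \<le> real K * real M + real M" using lo c' by simp
    then have "real Y / real M \<le> (real K * real M + real M) / real M" using M0 by (intro divide_right_mono) auto
    then show ?thesis using M0 by (simp add: add_divide_distrib)
  qed
  ultimately show ?thesis unfolding card by simp
qed

lemma card_residue_class_multiples:
  fixes q d b Y :: nat
  assumes "q \<ge> 1" "d \<ge> 1" "coprime q d"
  shows "\<bar>real (card {n \<in> {1..Y}. [n = b] (mod q) \<and> d dvd n}) - real Y / (real q * real d)\<bar> \<le> 1"
proof -
  obtain z where z: "[z = b] (mod q)" "[z = 0] (mod d)"
    using binary_chinese_remainder_nat[OF assms(3)] by blast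
  have "[n = b] (mod q) \<and> d dvd n \<longleftrightarrow> [n = z] (mod (q * d))" for n
  proof
    assume n: "[n = b] (mod q) \<and> d dvd n"
    then have "[n = z] (mod q)" "[n = z] (mod d)"
      using z by (auto simp: cong_def)
    then show "[n = z] (mod (q * d))" using assms(3) by (simp add: coprime_cong_mult_nat)
  next
    assume "[n = z] (mod (q * d))"
    then have "[n = z] (mod q)" "[n = z] (mod d)"
      using cong_dvd_modulus_nat by (blast intro: dvd_triv_left dvd_triv_right)+
    then show "[n = b] (mod q) \<and> d dvd n"
      using z by (auto simp: cong_def)
  qed
  then have "{n \<in> {1..Y}. [n = b] (mod q) \<and> d dvd n} = {n \<in> {1..Y}. [n = z] (mod (q * d))}" by auto
  then show ?thesis using card_residue_class[of "q * d" Y z] assms(1,2)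
    by (metis mult_le_mono nat_mult_1 of_nat_mult)
qed

text \<open>Up to the sign \<open>\<mu>(\<Prod>D)\<close> this is the Ramanujan sum to the modulus \<open>\<Prod>D\<close>. Distinct \<open>D\<close> are
  nearly orthogonal on a residue class, and all factors are \<open>1\<close> at the integers to be counted.\<close>

definition sieve_factor :: "nat set \<Rightarrow> nat \<Rightarrow> real" where
  "sieve_factor D n = (\<Prod>p\<in>D. if p dvd n then 1 - real p else 1)"

lemma prod_nat_ge_1:
  assumes "\<And>p. p \<in> E \<Longrightarrow> prime (p::nat)" shows "\<Prod>E \<ge> 1"
  using assms by (metis One_nat_def Suc_leI prime_gt_0_nat prod_pos)

text \<open>Each local factor has the form 1 + c p * [p dvd n]: a prime in both sets gives (1 - p)^2
  = 1 + (p^2 - 2p), a prime in only one gives 1 - p. Multiplying out sums over subsets of the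
  union.\<close>

lemma sieve_factor_mult_expand:
  fixes D D' :: "nat set"
  assumes "finite D" "finite D'" and D: "\<And>p. p \<in> D \<union> D' \<Longrightarrow> prime p"
  defines "c \<equiv> (\<lambda>p. if p \<in> D \<inter> D' then real p ^ 2 - 2 * real p else - real p)"
  shows "sieve_factor D n * sieve_factor D' n = (\<Sum>E\<in>Pow (D \<union> D'). (\<Prod>p\<in>E. c p) * of_bool (\<Prod>E dvd n))"
proof -
  let ?U = "D \<union> D'"
  have fin: "finite ?U" using assms by auto
  have "sieve_factor D n = (\<Prod>p\<in>?U. if p \<in> D \<and> p dvd n then 1 - real p else 1)"
    unfolding sieve_factor_def using fin by (intro prod.mono_neutral_cong_left) auto
  moreover have "sieve_factor D' n = (\<Prod>p\<in>?U. if p \<in> D' \<and> p dvd n then 1 - real p else 1)"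
    unfolding sieve_factor_def using fin by (intro prod.mono_neutral_cong_left) auto
  ultimately have "sieve_factor D n * sieve_factor D' n = (\<Prod>p\<in>?U. c p * of_bool (p dvd n) + 1)"
    by (simp only: prod.distrib[symmetric], intro prod.cong) (auto simp: c_def power2_eq_square algebra_simps)
  also have "\<dots> = (\<Sum>E\<in>Pow ?U. (\<Prod>p\<in>E. c p * of_bool (p dvd n)))"
    using prod_add[OF fin, of "\<lambda>p. c p * of_bool (p dvd n)" "\<lambda>_. 1"] by simp
  also have "\<dots> = (\<Sum>E\<in>Pow ?U. (\<Prod>p\<in>E. c p) * of_bool (\<Prod>E dvd n))"
  proof (rule sum.cong)
    fix E assume E: "E \<in> Pow ?U"
    then have finE: "finite E" using fin finite_subset by auto
    have "(\<Prod>p\<in>E. of_bool (p dvd n) :: real) = of_bool (\<Prod>E dvd n)"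
    proof (cases "\<forall>p\<in>E. p dvd n")
      case True
      then have "\<Prod>E dvd n" using E D finE by (intro prod_primes_dvd) auto
      then show ?thesis using True by simp
    next
      case False
      then obtain p where p: "p \<in> E" "\<not> p dvd n" by auto
      then have "\<not> \<Prod>E dvd n" using finE by (meson dvd_prod_eqI dvd_trans)
      moreover have "(\<Prod>p\<in>E. of_bool (p dvd n) :: real) = 0" using p finE by (intro prod_zero) auto
      ultimately show ?thesis by simp
    qed
    then show "(\<Prod>p\<in>E. c p * of_bool (p dvd n)) = (\<Prod>p\<in>E. c p) * of_bool (\<Prod>E dvd n)"
      by (simp add: prod.distrib)
  qed simp
  finally show ?thesis .
qed

text \<open>The density of the multiples of p in the progression is 1/p, so the main term is Y/q
  times the product of 1 + c p / p. A prime in exactly one of the sets makes this 1 - 1 = 0, which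
  is the orthogonality; a common prime gives p - 1. The errors, at most 1 per subset, add up to the
  product of 1 + |c p|, and this is at most p^2 for a prime in one set and p^4 for a prime in
  both.\<close>

lemma sieve_factor_correlation:
  fixes D D' :: "nat set" and q b Y :: nat
  assumes fin: "finite D" "finite D'" and D: "\<And>p. p \<in> D \<union> D' \<Longrightarrow> prime p \<and> \<not> p dvd q" and q: "q \<ge> 1"
  shows "(\<Sum>n | n \<in> {1..Y} \<and> [n = b] (mod q). sieve_factor D n * sieve_factor D' n)
    \<le> (if D = D' then real Y / real q * (\<Prod>p\<in>D. real p - 1) else 0) + (real (\<Prod>D) * real (\<Prod>D')) ^ 2"
proof -
  define c where "c = (\<lambda>p. if p \<in> D \<inter> D' then real p ^ 2 - 2 * real p else - real p)"
  let ?U = "D \<union> D'" and ?AP = "{n. n \<in> {1..Y} \<and> [n = b] (mod q)}"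
  have finU: "finite ?U" using fin by auto
  have p2: "real p \<ge> 2" if "p \<in> ?U" for p using D[OF that] prime_ge_2_nat by auto
  define N where "N = (\<lambda>E. card {n \<in> {1..Y}. [n = b] (mod q) \<and> \<Prod>E dvd n})"
  define \<theta> where "\<theta> = (\<lambda>E. real (N E) - real Y / (real q * real (\<Prod>E)))"
  have theta: "\<bar>\<theta> E\<bar> \<le> 1" if "E \<in> Pow ?U" for E
  proof -
    have "coprime q (\<Prod>E)" using that D
      by (intro prod_coprime_right) (auto simp: coprime_commute intro!: prime_imp_coprime)
    moreover have "\<Prod>E \<ge> 1" using that D by (intro prod_nat_ge_1) auto
    ultimately show ?thesis unfolding \<theta>_def N_def using q by (intro card_residue_class_multiples) auto
  qed
  have "(\<Sum>n\<in>?AP. sieve_factor D n * sieve_factor D' n)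
      = (\<Sum>n\<in>?AP. \<Sum>E\<in>Pow ?U. (\<Prod>p\<in>E. c p) * of_bool (\<Prod>E dvd n))"
    using sieve_factor_mult_expand[OF fin, folded c_def] D by (intro sum.cong) auto
  also have "\<dots> = (\<Sum>E\<in>Pow ?U. \<Sum>n\<in>?AP. (\<Prod>p\<in>E. c p) * of_bool (\<Prod>E dvd n))"
    by (rule sum.swap)
  also have "\<dots> = (\<Sum>E\<in>Pow ?U. (\<Prod>p\<in>E. c p) * real (N E))"
  proof (rule sum.cong)
    fix E
    have "(\<Sum>n\<in>?AP. of_bool (\<Prod>E dvd n)) = real (card (?AP \<inter> {n. \<Prod>E dvd n}))"
      by (subst sum_of_bool_eq) auto
    also have "?AP \<inter> {n. \<Prod>E dvd n} = {n \<in> {1..Y}. [n = b] (mod q) \<and> \<Prod>E dvd n}" by auto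
    finally show "(\<Sum>n\<in>?AP. (\<Prod>p\<in>E. c p) * of_bool (\<Prod>E dvd n)) = (\<Prod>p\<in>E. c p) * real (N E)"
      by (simp add: N_def flip: sum_distrib_left)
  qed simp
  also have "\<dots> = (\<Sum>E\<in>Pow ?U. real Y / real q * (\<Prod>p\<in>E. c p / real p)) + (\<Sum>E\<in>Pow ?U. (\<Prod>p\<in>E. c p) * \<theta> E)"
    unfolding sum.distrib[symmetric]
    by (intro sum.cong) (auto simp: \<theta>_def prod_dividef algebra_simps)
  also have "(\<Sum>E\<in>Pow ?U. real Y / real q * (\<Prod>p\<in>E. c p / real p)) = real Y / real q * (\<Prod>p\<in>?U. c p / real p + 1)"
    using prod_add[OF finU, of "\<lambda>p. c p / real p" "\<lambda>_. 1"] by (simp only: sum_distrib_left) simp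
  also have "(\<Prod>p\<in>?U. c p / real p + 1) = (if D = D' then (\<Prod>p\<in>D. real p - 1) else 0)"
  proof (cases "D = D'")
    case True
    have "c p / real p + 1 = real p - 1" if "p \<in> D" for p
    proof -
      have "real p > 0" using p2[of p] that by auto
      then show ?thesis using that True by (simp add: c_def power2_eq_square field_simps)
    qed
    then have "(\<Prod>p\<in>D. c p / real p + 1) = (\<Prod>p\<in>D. real p - 1)" by (intro prod.cong) auto
    then show ?thesis using True by simp
  next
    case False
    then obtain p where p: "p \<in> ?U" "p \<notin> D \<inter> D'" by blast
    then have "c p / real p + 1 = 0" using p2[of p] by (auto simp: c_def)
    then have "(\<Prod>p\<in>?U. c p / real p + 1) = 0" using p finU by (intro prod_zero) auto
    then show ?thesis using False by simp
  qed
  also have "(\<Sum>E\<in>Pow ?U. (\<Prod>p\<in>E. c p) * \<theta> E) \<le> (\<Sum>E\<in>Pow ?U. (\<Prod>p\<in>E. \<bar>c p\<bar>))"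
  proof (rule sum_mono)
    fix E assume "E \<in> Pow ?U"
    then have "\<bar>(\<Prod>p\<in>E. c p) * \<theta> E\<bar> \<le> \<bar>\<Prod>p\<in>E. c p\<bar> * 1"
      using theta unfolding abs_mult by (intro mult_left_mono) auto
    then show "(\<Prod>p\<in>E. c p) * \<theta> E \<le> (\<Prod>p\<in>E. \<bar>c p\<bar>)" by (simp add: abs_prod)
  qed
  also have "\<dots> = (\<Prod>p\<in>?U. \<bar>c p\<bar> + 1)"
    using prod_add[OF finU, of "\<lambda>p. \<bar>c p\<bar>" "\<lambda>_. 1"] by simp
  also have "\<dots> \<le> (\<Prod>p\<in>?U. (if p \<in> D then real p ^ 2 else 1) * (if p \<in> D' then real p ^ 2 else 1))"
  proof (rule prod_mono, intro conjI)
    fix p assume p: "p \<in> ?U"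
    then have r: "real p \<ge> 2" by (rule p2)
    have "2 * real p \<le> real p * real p" using r by (intro mult_right_mono) auto
    then have a: "1 + real p \<le> real p ^ 2" unfolding power2_eq_square using r by linarith
    have "\<bar>real p ^ 2 - 2 * real p\<bar> + 1 = (real p - 1) ^ 2"
      using mult_mono[of 2 "real p" "real p" "real p"] r by (simp add: power2_eq_square algebra_simps)
    also have "\<dots> \<le> real p ^ 2" using r by (intro power_mono) auto
    also have "\<dots> = real p ^ 2 * 1" by simp
    also have "\<dots> \<le> real p ^ 2 * real p ^ 2" using r a by (intro mult_left_mono) auto
    finally show "\<bar>c p\<bar> + 1 \<le> (if p \<in> D then real p ^ 2 else 1) * (if p \<in> D' then real p ^ 2 else 1)"
      using p a by (auto simp: c_def)
  qed simp
  also have "\<dots> = (\<Prod>p\<in>D. real p ^ 2) * (\<Prod>p\<in>D'. real p ^ 2)"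
  proof -
    have "(\<Prod>p\<in>?U. if p \<in> D then real p ^ 2 else 1) = (\<Prod>p\<in>D. real p ^ 2)"
      using finU by (intro prod.mono_neutral_cong_right) auto
    moreover have "(\<Prod>p\<in>?U. if p \<in> D' then real p ^ 2 else 1) = (\<Prod>p\<in>D'. real p ^ 2)"
      using finU by (intro prod.mono_neutral_cong_right) auto
    ultimately show ?thesis by (simp add: prod.distrib)
  qed
  also have "\<dots> = (real (\<Prod>D) * real (\<Prod>D')) ^ 2"
    by (simp add: power_mult_distrib prod_power_distrib)
  finally show ?thesis by (simp add: if_distrib cong: if_cong)
qed

text \<open>Squarefree d <= R coprime to q, each encoded by its set of prime divisors.\<close>

definition sieve_sets :: "real \<Rightarrow> nat \<Rightarrow> nat set set" where
  "sieve_sets R q = {D. D \<subseteq> primes_upto_real R \<and> (\<forall>p\<in>D. \<not> p dvd q) \<and> real (\<Prod>D) \<le> R}"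

text \<open>Selberg's sum of mu(d)^2 / phi(d) over d <= R coprime to q.\<close>

definition sieve_mass :: "real \<Rightarrow> nat \<Rightarrow> real" where
  "sieve_mass R q = (\<Sum>D\<in>sieve_sets R q. \<Prod>p\<in>D. 1 / (real p - 1))"

lemma finite_sieve_sets: "finite (sieve_sets R q)"
  by (rule finite_subset[of _ "Pow (primes_upto_real R)"]) (auto simp: sieve_sets_def finite_primes_upto_real)

lemma sieve_mass_pos:
  assumes "R \<ge> 1" shows "sieve_mass R q > 0"
proof -
  have "{} \<in> sieve_sets R q" using assms by (simp add: sieve_sets_def)
  moreover have "(\<Prod>p\<in>D. 1 / (real p - 1)) > 0" if "D \<in> sieve_sets R q" for D
    using that by (intro prod_pos) (auto simp: sieve_sets_def primes_upto_real_def dest!: subsetD prime_gt_1_nat)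
  ultimately show ?thesis unfolding sieve_mass_def
    using finite_sieve_sets by (intro sum_pos) auto
qed

text \<open>Dual form of Selberg's sieve: a second moment replaces the minimisation of a quadratic
  form. The test function \<open>\<nu>\<close> equals G = \<open>sieve_mass R q\<close> at every
  sifted integer. By near orthogonality its second moment over the progression is at most (Y/q) G +
  R^4 G^2; the weight w = 1/phi makes each diagonal term w^2 * phi = w. Dividing by G^2 gives the
  bound.\<close>

lemma selberg_sieve:
  assumes R: "R \<ge> 1" and q: "q \<ge> 1"
  shows "real (card {n \<in> {1..Y}. [n = b] (mod q) \<and> (\<forall>p. prime p \<and> real p \<le> R \<longrightarrow> \<not> p dvd n)})
     \<le> real Y / real q / sieve_mass R q + R ^ 4"
proof -
  let ?X = "{n \<in> {1..Y}. [n = b] (mod q) \<and> (\<forall>p. prime p \<and> real p \<le> R \<longrightarrow> \<not> p dvd n)}"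
  let ?AP = "{n. n \<in> {1..Y} \<and> [n = b] (mod q)}"
  define G where "G = sieve_mass R q"
  define w where "w = (\<lambda>D::nat set. \<Prod>p\<in>D. 1 / (real p - 1))"
  define \<nu> where "\<nu> = (\<lambda>n. \<Sum>D\<in>sieve_sets R q. w D * sieve_factor D n)"
  have G0: "G > 0" unfolding G_def using R by (rule sieve_mass_pos)
  have Gw: "G = (\<Sum>D\<in>sieve_sets R q. w D)" by (simp add: G_def sieve_mass_def w_def)
  have D: "finite D" "\<And>p. p \<in> D \<Longrightarrow> prime p \<and> \<not> p dvd q" "\<And>p. p \<in> D \<Longrightarrow> real p \<le> R" "real (\<Prod>D) \<le> R"
    if "D \<in> sieve_sets R q" for D
    using that finite_primes_upto_real finite_subset by (auto simp: sieve_sets_def primes_upto_real_def)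
  have p1: "real p - 1 > 0" if "D \<in> sieve_sets R q" "p \<in> D" for D p
    using D(2)[OF that] prime_gt_1_nat by auto
  have w0: "w D > 0" if "D \<in> sieve_sets R q" for D
    unfolding w_def using p1[OF that] by (intro prod_pos) auto
  have "\<nu> n = G" if "n \<in> ?X" for n
    unfolding \<nu>_def Gw
  proof (rule sum.cong)
    fix E assume E: "E \<in> sieve_sets R q"
    have "sieve_factor E n = (\<Prod>p\<in>E. 1)"
      unfolding sieve_factor_def using D[OF E] that by (intro prod.cong) auto
    then show "w E * sieve_factor E n = w E" by simp
  qed simp
  then have "real (card ?X) * G ^ 2 = (\<Sum>n\<in>?X. \<nu> n ^ 2)" by simp
  also have "\<dots> \<le> (\<Sum>n\<in>?AP. \<nu> n ^ 2)" by (intro sum_mono2) auto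
  also have "\<dots> = (\<Sum>n\<in>?AP. \<Sum>D\<in>sieve_sets R q. \<Sum>D'\<in>sieve_sets R q. w D * w D' * (sieve_factor D n * sieve_factor D' n))"
    by (simp add: \<nu>_def power2_eq_square sum_product mult_ac)
  also have "\<dots> = (\<Sum>D\<in>sieve_sets R q. \<Sum>D'\<in>sieve_sets R q. w D * w D' * (\<Sum>n\<in>?AP. sieve_factor D n * sieve_factor D' n))"
    unfolding sum_distrib_left by (subst sum.swap, rule sum.cong[OF refl], rule sum.swap)
  also have "\<dots> \<le> (\<Sum>D\<in>sieve_sets R q. \<Sum>D'\<in>sieve_sets R q. w D * w D' *
     ((if D = D' then real Y / real q * (\<Prod>p\<in>D. real p - 1) else 0) + R ^ 4))"
  proof (intro sum_mono mult_left_mono)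
    fix E F assume E: "E \<in> sieve_sets R q" and F: "F \<in> sieve_sets R q"
    have "(real (\<Prod>E) * real (\<Prod>F)) ^ 2 \<le> (R * R) ^ 2"
      using D(4)[OF E] D(4)[OF F] R by (intro power_mono mult_mono mult_nonneg_nonneg of_nat_0_le_iff) auto
    then have "(real (\<Prod>E) * real (\<Prod>F)) ^ 2 \<le> R ^ 4" by (simp add: power_mult_distrib flip: power_add)
    moreover have "(\<Sum>n\<in>?AP. sieve_factor E n * sieve_factor F n)
      \<le> (if E = F then real Y / real q * (\<Prod>p\<in>E. real p - 1) else 0) + (real (\<Prod>E) * real (\<Prod>F)) ^ 2"
      using D(1,2)[OF E] D(1,2)[OF F] q by (intro sieve_factor_correlation) auto
    ultimately show "(\<Sum>n\<in>?AP. sieve_factor E n * sieve_factor F n)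
      \<le> (if E = F then real Y / real q * (\<Prod>p\<in>E. real p - 1) else 0) + R ^ 4" by linarith
    show "0 \<le> w E * w F" using w0[OF E] w0[OF F] by simp
  qed
  also have "\<dots> = (\<Sum>D\<in>sieve_sets R q. w D * w D * (real Y / real q * (\<Prod>p\<in>D. real p - 1))) + R ^ 4 * G ^ 2"
  proof -
    have "(\<Sum>D'\<in>sieve_sets R q. w D * w D' *
       ((if D = D' then real Y / real q * (\<Prod>p\<in>D. real p - 1) else 0) + R ^ 4))
       = w D * w D * (real Y / real q * (\<Prod>p\<in>D. real p - 1)) + R ^ 4 * w D * G" if "D \<in> sieve_sets R q" for D
    proof -
      have "(\<Sum>D'\<in>sieve_sets R q. w D * w D' *
         ((if D = D' then real Y / real q * (\<Prod>p\<in>D. real p - 1) else 0) + R ^ 4))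
        = (\<Sum>D'\<in>sieve_sets R q. if D = D' then w D * w D' * (real Y / real q * (\<Prod>p\<in>D. real p - 1)) else 0)
          + (\<Sum>D'\<in>sieve_sets R q. R ^ 4 * w D * w D')"
        unfolding sum.distrib[symmetric] by (intro sum.cong) (auto simp: algebra_simps)
      also have "(\<Sum>D'\<in>sieve_sets R q. R ^ 4 * w D * w D') = R ^ 4 * w D * G"
        by (simp only: Gw sum_distrib_left)
      finally show ?thesis using that finite_sieve_sets by simp
    qed
    then show ?thesis
      by (simp add: sum.distrib power2_eq_square Gw flip: sum_distrib_left sum_distrib_right mult.assoc)
  qed
  also have "(\<Sum>D\<in>sieve_sets R q. w D * w D * (real Y / real q * (\<Prod>p\<in>D. real p - 1))) = real Y / real q * G"
    unfolding Gw sum_distrib_left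
  proof (rule sum.cong)
    fix E assume E: "E \<in> sieve_sets R q"
    have "w E * (\<Prod>p\<in>E. real p - 1) = (\<Prod>p\<in>E. 1)"
      unfolding w_def prod.distrib[symmetric] using p1[OF E] by (intro prod.cong) (auto simp: less_imp_neq[symmetric])
    then have "w E * (\<Prod>p\<in>E. real p - 1) = 1" by simp
    then show "w E * w E * (real Y / real q * (\<Prod>p\<in>E. real p - 1)) = real Y / real q * w E"
      by (metis mult.assoc mult.commute mult.right_neutral)
  qed simp
  finally have "real (card ?X) * G ^ 2 \<le> (real Y / real q / G + R ^ 4) * G ^ 2"
    using G0 by (simp add: distrib_right power2_eq_square)
  then show ?thesis using G0 by (simp add: G_def)
qed

section \<open>Lower bound for the Selberg mass\<close>

lemma geometric_sum_inverse_prime_le: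
  assumes "prime (p::nat)"
  shows "(\<Sum>v\<le>V. 1 / real (p ^ v)) \<le> real p / (real p - 1)"
proof -
  have p: "real p > 1" using assms prime_gt_1_nat by simp
  have "(\<Sum>v\<le>V. 1 / real (p ^ v)) = (\<Sum>v<Suc V. (1 / real p) ^ v)"
    by (simp add: power_one_over lessThan_Suc_atMost)
  also have "\<dots> = (1 - (1 / real p) ^ Suc V) / (1 - 1 / real p)"
    using p by (subst sum_gp_strict) auto
  also have "\<dots> \<le> 1 / (1 - 1 / real p)" using p by (intro divide_right_mono) auto
  also have "\<dots> = real p / (real p - 1)" using p by (simp add: field_simps)
  finally show ?thesis .
qed

text \<open>Sort the integers n <= R by the set D of their primes not dividing q. The reciprocals in
  one fibre sum to at most q / phi(q) times the term of D in \<open>sieve_mass\<close>, and all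
  fibres together make a harmonic sum, at least ln R.\<close>

lemma sieve_mass_ge:
  assumes R: "R \<ge> 1" and q: "q \<ge> 1"
  shows "real (totient q) * ln R \<le> real q * sieve_mass R q"
proof -
  define N where "N = nat \<lfloor>R\<rfloor>"
  define supp where "supp = (\<lambda>n. prime_factors n - prime_factors q)"
  have NR: "real N \<le> R" "R < real N + 1" using R unfolding N_def by linarith+
  have euler: "(\<Prod>p\<in>prime_factors q. real p / (real p - 1)) = real q / real (totient q)"
  proof -
    have "real (totient q) = real q * (\<Prod>p\<in>prime_factors q. 1 - 1 / real p)" by (rule totient_formula2)
    also have "(\<Prod>p\<in>prime_factors q. 1 - 1 / real p) = (\<Prod>p\<in>prime_factors q. inverse (real p / (real p - 1)))"
      by (intro prod.cong) (auto simp: field_simps dest: in_prime_factors_imp_prime)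
    also have "\<dots> = inverse (\<Prod>p\<in>prime_factors q. real p / (real p - 1))" by (simp add: prod_inversef[symmetric] comp_def)
    finally show ?thesis using q by (simp add: field_simps)
  qed
  have fib: "(\<Sum>n | n \<in> {1..N} \<and> supp n = D. 1 / real n) \<le> (\<Prod>p\<in>D. 1 / (real p - 1)) * (real q / real (totient q))"
    if D: "D \<in> supp ` {1..N}" for D
  proof -
    have finD: "finite D" and Dp: "\<And>p. p \<in> D \<Longrightarrow> prime p" and Dq: "D \<inter> prime_factors q = {}"
      using D by (auto simp: supp_def)
    let ?F = "{n. n \<in> {1..N} \<and> supp n = D}"
    let ?P = "D \<union> prime_factors q"
    have P1: "\<Prod>D \<ge> 1" using Dp by (rule prod_nat_ge_1)
    have dvd: "\<Prod>D dvd n" if "n \<in> ?F" for n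
      using that Dp finD by (intro prod_primes_dvd) (auto simp: supp_def)
    have inj: "inj_on (\<lambda>n. n div \<Prod>D) ?F" using dvd by (intro inj_onI) (metis dvd_div_mult_self)
    have "(\<Sum>n\<in>?F. 1 / real n) = (\<Sum>n\<in>?F. 1 / real (\<Prod>D) * (1 / real (n div \<Prod>D)))"
    proof (rule sum.cong)
      fix n assume "n \<in> ?F"
      then have "real n = real (\<Prod>D) * real (n div \<Prod>D)" using dvd by (metis dvd_mult_div_cancel of_nat_mult)
      then show "1 / real n = 1 / real (\<Prod>D) * (1 / real (n div \<Prod>D))" by simp
    qed simp
    also have "\<dots> = 1 / real (\<Prod>D) * (\<Sum>m\<in>(\<lambda>n. n div \<Prod>D) ` ?F. 1 / real m)"
      unfolding sum.reindex[OF inj] by (simp add: sum_distrib_left)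
    finally have split: "(\<Sum>n\<in>?F. 1 / real n) = 1 / real (\<Prod>D) * (\<Sum>m\<in>(\<lambda>n. n div \<Prod>D) ` ?F. 1 / real m)" .
    \<comment> \<open>The cofactor n div \<open>\<Prod>D\<close> has only primes from D or from q,
      so an Euler product over these primes dominates.\<close>
    have "(\<Sum>m\<in>(\<lambda>n. n div \<Prod>D) ` ?F. 1 / real m) \<le> (\<Prod>p\<in>?P. \<Sum>v\<le>N. 1 / real (p ^ v))"
    proof (rule sum_le_euler_product)
      show "coprime_multiplicative (\<lambda>n. 1 / real n)" by (simp add: coprime_multiplicative_def)
      show "(\<lambda>n. n div \<Prod>D) ` ?F \<subseteq> {1..N}"
      proof clarify
        fix n assume n: "n \<in> {1..N}" "D = supp n"
        then have "\<Prod>(supp n) dvd n" using dvd by auto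
        then show "n div \<Prod>(supp n) \<in> {1..N}" using n P1
          by (auto simp: Suc_le_eq div_greater_zero_iff dvd_imp_le intro: order_trans[OF div_le_dividend])
      qed
      fix m p assume m: "m \<in> (\<lambda>n. n div \<Prod>D) ` ?F" and p: "prime p" "p dvd m"
      then obtain n where n: "n \<in> ?F" "m = n div \<Prod>D" by auto
      then have "p dvd n" using p dvd by (metis dvd_div_mult_self dvd_mult2)
      then show "p \<in> ?P" using n p by (auto simp: supp_def prime_factors_dvd)
    qed (use finD Dp in auto)
    also have "\<dots> \<le> (\<Prod>p\<in>?P. real p / (real p - 1))"
      using Dp by (intro prod_mono conjI sum_nonneg geometric_sum_inverse_prime_le) auto
    also have "\<dots> = (\<Prod>p\<in>D. real p / (real p - 1)) * (real q / real (totient q))"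
      using finD Dq by (subst prod.union_disjoint) (auto simp: euler)
    finally have "(\<Sum>n\<in>?F. 1 / real n)
      \<le> 1 / real (\<Prod>D) * ((\<Prod>p\<in>D. real p / (real p - 1)) * (real q / real (totient q)))"
      unfolding split by (intro mult_left_mono divide_nonneg_nonneg of_nat_0_le_iff zero_le_one)
    also have "1 / real (\<Prod>D) * ((\<Prod>p\<in>D. real p / (real p - 1)) * (real q / real (totient q)))
      = (\<Prod>p\<in>D. 1 / (real p - 1)) * (real q / real (totient q))"
    proof -
      have "(\<Prod>p\<in>D. real p / (real p - 1)) = real (\<Prod>D) * (\<Prod>p\<in>D. 1 / (real p - 1))"
        by (simp add: prod_dividef)
      moreover have "real (\<Prod>D) > 0" using P1 by linarith
      ultimately show ?thesis by simp
    qed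
    finally show ?thesis .
  qed
  have sub: "supp ` {1..N} \<subseteq> sieve_sets R q"
  proof clarify
    fix n assume n: "n \<in> {1..N}"
    have "\<Prod>(supp n) dvd n" using n by (intro prod_primes_dvd) (auto simp: supp_def)
    then have "\<Prod>(supp n) \<le> n" using n by (intro dvd_imp_le) auto
    moreover have "p \<le> n" if "p \<in> supp n" for p using that n by (auto simp: supp_def intro: dvd_imp_le)
    moreover have "prime p \<and> \<not> p dvd q" if "p \<in> supp n" for p
      using that q by (auto simp: supp_def prime_factors_dvd)
    moreover have "real n \<le> R" using n NR by simp
    ultimately show "supp n \<in> sieve_sets R q"
      unfolding sieve_sets_def primes_upto_real_def
      by (auto simp del: of_nat_prod intro: order_trans[of _ "real n"])
  qed
  have "ln R \<le> ln (real N + 1)" using R NR by (intro ln_mono) auto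
  also have "\<dots> \<le> harm N" by (rule ln_le_harm)
  also have "harm N = (\<Sum>n\<in>{1..N}. 1 / real n)" by (simp add: harm_def inverse_eq_divide)
  also have "\<dots> = (\<Sum>D\<in>supp ` {1..N}. \<Sum>n | n \<in> {1..N} \<and> supp n = D. 1 / real n)"
    by (rule sum.image_gen) simp
  also have "\<dots> \<le> (\<Sum>D\<in>supp ` {1..N}. (\<Prod>p\<in>D. 1 / (real p - 1)) * (real q / real (totient q)))"
    by (intro sum_mono fib)
  also have "\<dots> \<le> (\<Sum>D\<in>sieve_sets R q. (\<Prod>p\<in>D. 1 / (real p - 1)) * (real q / real (totient q)))"
    using sub finite_sieve_sets
    by (intro sum_mono2 mult_nonneg_nonneg prod_nonneg)
       (auto simp: sieve_sets_def primes_upto_real_def dest!: subsetD prime_gt_1_nat)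
  also have "\<dots> = real q * sieve_mass R q / real (totient q)"
    by (simp only: sum_distrib_right[symmetric] sieve_mass_def[symmetric]) simp
  finally show ?thesis using q by (simp add: pos_le_divide_eq mult.commute)
qed

text \<open>The factor q / phi(q) gained in the mass turns Y/q into Y/phi(q), the correct size for a
  reduced class.\<close>

lemma sieve_rough_residue_class:
  assumes R: "R > 1" and q: "q \<ge> 1"
  shows "real (card {n \<in> {1..Y}. [n = b] (mod q) \<and> (\<forall>p. prime p \<and> real p \<le> R \<longrightarrow> \<not> p dvd n)})
     \<le> real Y / (real (totient q) * ln R) + R ^ 4"
proof -
  have "real (totient q) * ln R \<le> real q * sieve_mass R q" using R q by (intro sieve_mass_ge) auto
  then have "real Y / (real q * sieve_mass R q) \<le> real Y / (real (totient q) * ln R)"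
    using R q by (intro divide_left_mono mult_pos_pos) (auto simp: sieve_mass_pos)
  then show ?thesis using selberg_sieve[of R q Y b] R q by simp
qed

section \<open>Weyl sums over residue families\<close>

definition add_char :: "nat \<Rightarrow> nat \<Rightarrow> complex" where
  "add_char q a = cis (2 * pi * real a / real q)"

lemma norm_add_char [simp]: "cmod (add_char q a) = 1"
  by (simp add: add_char_def)

lemma add_char_0 [simp]: "add_char q 0 = 1"
  by (simp add: add_char_def)

lemma add_char_add: "add_char q (a + b) = add_char q a * add_char q b"
  by (simp add: add_char_def cis_mult add_divide_distrib distrib_left)

lemma add_char_mult_left:
  assumes "u \<ge> 1" shows "add_char (u * v) (u * a) = add_char v a"
  using assms by (simp add: add_char_def mult.assoc)

lemma add_char_period: "q \<ge> 1 \<Longrightarrow> add_char q (q * k) = 1"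
proof -
  assume "q \<ge> 1"
  then have "add_char q (q * k) = cis (2 * pi * real k)" by (simp add: add_char_def mult.assoc)
  also have "\<dots> = 1" by (intro cis_multiple_2pi) auto
  finally show ?thesis .
qed

lemma add_char_mod:
  assumes "q \<ge> 1" shows "add_char q (a mod q) = add_char q a"
proof -
  have "add_char q a = add_char q (q * (a div q)) * add_char q (a mod q)"
    by (simp flip: add_char_add)
  then show ?thesis using add_char_period[OF assms] by simp
qed

lemma add_char_cong:
  assumes "q \<ge> 1" "[a = b] (mod q)" shows "add_char q a = add_char q b"
  using assms add_char_mod unfolding cong_def by metis

lemma add_char_power: "add_char q (h * a) = add_char q a ^ h"
  by (induction h) (simp_all add: add_char_add)

lemma add_char_inj:
  assumes "q \<ge> 1" "a < q" "b < q" "add_char q a = add_char q b"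
  shows "a = b"
proof -
  have "inj_on (\<lambda>k. cis (2 * pi * real k / real q)) {..<q}"
    using Complex.bij_betw_roots_unity[of q] assms(1) bij_betw_imp_inj_on by auto
  then show ?thesis using assms by (auto simp: add_char_def inj_on_def)
qed

lemma add_char_orthogonality:
  assumes q: "q \<ge> 1"
  shows "(\<Sum>h<q. add_char q (h * a) * cnj (add_char q (h * b))) = (if [a = b] (mod q) then of_nat q else 0)"
proof -
  define z where "z = add_char q a * cnj (add_char q b)"
  have cnj1: "add_char q x * cnj (add_char q x) = 1" for x
    by (simp add: complex_norm_square[symmetric])
  have "(\<Sum>h<q. add_char q (h * a) * cnj (add_char q (h * b))) = (\<Sum>h<q. z ^ h)"
    by (simp add: add_char_power z_def power_mult_distrib)
  also have "\<dots> = (if [a = b] (mod q) then of_nat q else 0)"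
  proof (cases "[a = b] (mod q)")
    case True
    then have "add_char q a = add_char q b" using q add_char_cong by blast
    then show ?thesis using True cnj1 by (simp add: z_def)
  next
    case False
    have "z \<noteq> 1"
    proof
      assume "z = 1"
      then have "add_char q a * (cnj (add_char q b) * add_char q b) = add_char q b"
        by (simp add: z_def flip: mult.assoc)
      then have "add_char q a = add_char q b" using cnj1 by (simp add: mult.commute)
      then have "add_char q (a mod q) = add_char q (b mod q)" using q add_char_mod by simp
      then have "a mod q = b mod q" using q by (intro add_char_inj) auto
      then show False using False by (simp add: cong_def)
    qed
    moreover have "z ^ q = 1"
      using add_char_period[OF q, of a] add_char_period[OF q, of b]
      by (simp add: z_def power_mult_distrib flip: add_char_power complex_cnj_power)
    ultimately show ?thesis using False by (simp add: sum_gp_strict)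
  qed
  finally show ?thesis .
qed

section \<open>Chinese remainder theorem for the residue sets\<close>

lemma crt_set_eq_multiplicity:
  assumes "q \<ge> 1"
  shows "crt_set A q = {a. a < q \<and> (\<forall>p. prime p \<and> p dvd q \<longrightarrow> a mod p ^ multiplicity p q \<in> A (p ^ multiplicity p q))}"
proof -
  have "(v \<ge> 1 \<and> p ^ v dvd q \<and> \<not> p ^ (v + 1) dvd q) \<longleftrightarrow> (p dvd q \<and> v = multiplicity p q)"
    if "prime p" for p v
  proof -
    have "p ^ k dvd q \<longleftrightarrow> k \<le> multiplicity p q" for k
      using assms \<open>prime p\<close> by (intro power_dvd_iff_le_multiplicity) (auto dest: prime_gt_1_nat)
    from this[of v] this[of "v + 1"] this[of 1] show ?thesis by auto
  qed
  then show ?thesis unfolding crt_set_def by (intro Collect_cong conj_cong refl) (metis (no_types))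
qed

lemma crt_set_mult_iff:
  assumes uv: "u \<ge> 1" "v \<ge> 1" "coprime u v"
  shows "a \<in> crt_set A (u * v) \<longleftrightarrow> a < u * v \<and> a mod u \<in> crt_set A u \<and> a mod v \<in> crt_set A v"
proof -
  have local: "a mod p ^ multiplicity p (u * v) \<in> A (p ^ multiplicity p (u * v)) \<longleftrightarrow>
      (a mod u) mod p ^ multiplicity p u \<in> A (p ^ multiplicity p u)"
    if "prime p" "p dvd u" "coprime u v" "u \<ge> 1" "v \<ge> 1" for p u v
  proof -
    have "\<not> p dvd v" using that by (meson coprime_common_divisor_nat not_prime_1 coprime_def not_prime_unit)
    then have "multiplicity p (u * v) = multiplicity p u"
      using that by (subst prime_elem_multiplicity_mult_distrib) (auto simp: not_dvd_imp_multiplicity_0)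
    then show ?thesis by (simp add: mod_mod_cancel multiplicity_dvd)
  qed
  have "(\<forall>p. prime p \<and> p dvd u * v \<longrightarrow> a mod p ^ multiplicity p (u * v) \<in> A (p ^ multiplicity p (u * v))) \<longleftrightarrow>
    (\<forall>p. prime p \<and> p dvd u \<longrightarrow> (a mod u) mod p ^ multiplicity p u \<in> A (p ^ multiplicity p u)) \<and>
    (\<forall>p. prime p \<and> p dvd v \<longrightarrow> (a mod v) mod p ^ multiplicity p v \<in> A (p ^ multiplicity p v))"
    using local[of _ u v] local[of _ v u] uv
    by (auto simp: prime_dvd_mult_iff coprime_commute mult.commute[of v u])
  then show ?thesis using uv by (auto simp: crt_set_eq_multiplicity)
qed

lemma bij_betw_crt_set:
  assumes uv: "u \<ge> 1" "v \<ge> 1" "coprime u v"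
  shows "bij_betw (\<lambda>a. (a mod u, a mod v)) (crt_set A (u * v)) (crt_set A u \<times> crt_set A v)"
proof (rule bij_betw_imageI)
  show "inj_on (\<lambda>a. (a mod u, a mod v)) (crt_set A (u * v))"
  proof (rule inj_onI)
    fix a b assume ab: "a \<in> crt_set A (u * v)" "b \<in> crt_set A (u * v)" "(a mod u, a mod v) = (b mod u, b mod v)"
    then have "[a = b] (mod u * v)" using uv(3) by (intro coprime_cong_mult_nat) (auto simp: cong_def)
    then show "a = b" using ab by (auto simp: cong_def crt_set_def)
  qed
  show "(\<lambda>a. (a mod u, a mod v)) ` crt_set A (u * v) = crt_set A u \<times> crt_set A v"
  proof (rule equalityI; rule subsetI)
    fix y assume "y \<in> crt_set A u \<times> crt_set A v"
    then obtain b c where y: "y = (b, c)" "b \<in> crt_set A u" "c \<in> crt_set A v" by auto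
    obtain a where a: "a < u * v" "[a = b] (mod u)" "[a = c] (mod v)"
      using binary_chinese_remainder_unique_nat[of u v b c] uv by auto
    then have "a mod u = b" "a mod v = c" using y by (auto simp: cong_def crt_set_def)
    then show "y \<in> (\<lambda>a. (a mod u, a mod v)) ` crt_set A (u * v)"
      using a y crt_set_mult_iff[OF uv] by (intro image_eqI[of _ _ a]) auto
  qed (use crt_set_mult_iff[OF uv] in auto)
qed

lemma rho_mult:
  assumes "u \<ge> 1" "v \<ge> 1" "coprime u v"
  shows "rho A (u * v) = rho A u * rho A v"
  using bij_betw_same_card[OF bij_betw_crt_set[OF assms]] by (simp add: rho_def card_cartesian_product)

text \<open>If \<open>rho A q = 0\<close>, division by zero gives the value 0. Moduli outside
  \<open>Q_set A\<close> therefore drop out by themselves when sums are extended to all products u *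
  n or to all primes.\<close>

definition weyl_sum :: "(nat \<Rightarrow> nat set) \<Rightarrow> nat \<Rightarrow> nat \<Rightarrow> complex" where
  "weyl_sum A h q = (\<Sum>a\<in>crt_set A q. add_char q (h * a)) / of_nat (rho A q)"

lemma norm_weyl_sum_le: "cmod (weyl_sum A h q) \<le> 1"
proof (cases "rho A q = 0")
  case False
  have "cmod (\<Sum>a\<in>crt_set A q. add_char q (h * a)) \<le> (\<Sum>a\<in>crt_set A q. 1)"
    by (rule order_trans[OF norm_sum]) simp
  then show ?thesis using False by (simp add: weyl_sum_def norm_divide rho_def)
qed (simp add: weyl_sum_def)

lemma weyl_sum_eq_0: "rho A q = 0 \<Longrightarrow> weyl_sum A h q = 0"
  by (simp add: weyl_sum_def)

lemma weyl_sum_cong: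
  assumes "q \<ge> 1" "[h = k] (mod q)"
  shows "weyl_sum A h q = weyl_sum A k q"
proof -
  have "add_char q (h * a) = add_char q (k * a)" for a
    using assms by (intro add_char_cong cong_scalar_right) auto
  then show ?thesis by (simp add: weyl_sum_def)
qed

text \<open>Modulo 1, a/(uv) equals a v'/u + a u'/v, because v v' + u u' is congruent to 1 modulo
  uv. Multiplicativity holds only up to these twists of the frequency.\<close>

lemma weyl_sum_mult:
  assumes uv: "u \<ge> 1" "v \<ge> 1" "coprime u v" and inv: "[v * v' = 1] (mod u)" "[u * u' = 1] (mod v)"
  shows "weyl_sum A h (u * v) = weyl_sum A (h * v') u * weyl_sum A (h * u') v"
proof -
  have one: "[v * v' + u * u' = 1] (mod (u * v))"
  proof (rule coprime_cong_mult_nat[OF _ _ uv(3)])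
    show "[v * v' + u * u' = 1] (mod u)" using inv(1) by (simp add: cong_def)
    show "[v * v' + u * u' = 1] (mod v)" using inv(2) by (simp add: cong_def)
  qed
  have split: "add_char (u * v) (h * a) = add_char u (h * v' * (a mod u)) * add_char v (h * u' * (a mod v))" for a
  proof -
    have "[(v * v' + u * u') * (h * a) = 1 * (h * a)] (mod (u * v))"
      using one by (rule cong_scalar_right)
    then have "add_char (u * v) (h * a) = add_char (u * v) ((v * v' + u * u') * (h * a))"
      using uv by (intro add_char_cong) (auto simp: cong_sym)
    also have "(v * v' + u * u') * (h * a) = v * (h * v' * a) + u * (h * u' * a)" by (simp add: algebra_simps)
    also have "add_char (u * v) \<dots> = add_char u (h * v' * a) * add_char v (h * u' * a)"
      using add_char_mult_left[OF uv(1), of v] add_char_mult_left[OF uv(2), of u]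
      by (simp add: add_char_add mult.commute[of u v])
    also have "add_char u (h * v' * a) = add_char u (h * v' * (a mod u))"
      using uv by (intro add_char_cong) (auto simp: cong_def mod_mult_right_eq)
    also have "add_char v (h * u' * a) = add_char v (h * u' * (a mod v))"
      using uv by (intro add_char_cong) (auto simp: cong_def mod_mult_right_eq)
    finally show ?thesis .
  qed
  have "(\<Sum>a\<in>crt_set A (u * v). add_char (u * v) (h * a))
    = (\<Sum>(b, c)\<in>crt_set A u \<times> crt_set A v. add_char u (h * v' * b) * add_char v (h * u' * c))"
    unfolding sum.reindex_bij_betw[OF bij_betw_crt_set[OF uv], symmetric] by (simp add: split)
  also have "\<dots> = (\<Sum>b\<in>crt_set A u. add_char u (h * v' * b)) * (\<Sum>c\<in>crt_set A v. add_char v (h * u' * c))"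
    by (simp add: sum_product sum.cartesian_product)
  finally show ?thesis by (simp add: weyl_sum_def rho_mult[OF uv])
qed

lemma coprime_inverse_exists:
  fixes u v :: nat
  assumes "coprime u v" shows "\<exists>v'. [v * v' = 1] (mod u)"
proof -
  have "coprime v u" using assms by (simp add: coprime_commute)
  then show ?thesis using cong_solve_coprime_nat[of v u] by simp
qed

lemma norm_weyl_sum_mult_le:
  assumes uv: "u \<ge> 1" "v \<ge> 1" "coprime u v" and inv: "[v * v' = 1] (mod u)"
  shows "cmod (weyl_sum A h (u * v)) \<le> cmod (weyl_sum A (h * v') u)"
proof -
  obtain u' where u': "[u * u' = 1] (mod v)"
    using coprime_inverse_exists[of v u] uv by (auto simp: coprime_commute)
  show ?thesis unfolding weyl_sum_mult[OF uv inv u'] norm_mult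
    using norm_weyl_sum_le by (intro mult_left_le) auto
qed

section \<open>Means of Weyl sums over units\<close>

definition weyl_mean :: "(nat \<Rightarrow> nat set) \<Rightarrow> nat \<Rightarrow> nat \<Rightarrow> real" where
  "weyl_mean A h q = (\<Sum>c\<in>totatives q. cmod (weyl_sum A (h * c) q)) / real (totient q)"

lemma weyl_mean_nonneg: "weyl_mean A h q \<ge> 0"
  by (simp add: weyl_mean_def sum_nonneg)

lemma weyl_mean_le_1: "weyl_mean A h q \<le> 1"
proof -
  have "(\<Sum>c\<in>totatives q. cmod (weyl_sum A (h * c) q)) \<le> (\<Sum>c\<in>totatives q. 1)"
    by (intro sum_mono norm_weyl_sum_le)
  then show ?thesis by (auto simp: weyl_mean_def totient_def divide_le_eq)
qed

lemma weyl_mean_eq_0: "rho A q = 0 \<Longrightarrow> weyl_mean A h q = 0"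
  by (simp add: weyl_mean_def weyl_sum_eq_0)

lemma sum_totatives_mult:
  fixes F :: "nat \<Rightarrow> real"
  assumes u: "u \<ge> 1" and t: "coprime t u" and F: "\<And>a b. [a = b] (mod u) \<Longrightarrow> F a = F b"
  shows "(\<Sum>c\<in>totatives u. F (c * t)) = (\<Sum>c\<in>totatives u. F c)"
\<comment> \<open>Modulus 1 is degenerate: \<open>totatives 1\<close> is {1}, while reduction modulo
  1 yields 0.\<close>
proof (cases "u = 1")
  case True
  then show ?thesis using F[of t 1] by simp
next
  case False
  then have u1: "u > 1" using u by simp
  have into: "(\<lambda>c. c * t mod u) ` totatives u \<subseteq> totatives u"
  proof (rule image_subsetI)
    fix c assume c: "c \<in> totatives u"
    have "coprime (c * t mod u) u" using c t by (simp add: in_totatives_iff)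
    moreover from this have "c * t mod u \<noteq> 0" using u1 by (metis coprime_0_left_iff is_unit_gcd gcd_0_left nat_dvd_1_iff_1 less_numeral_extra(4))
    ultimately show "c * t mod u \<in> totatives u" using u1 by (simp add: in_totatives_iff less_imp_le)
  qed
  have inj: "inj_on (\<lambda>c. c * t mod u) (totatives u)"
  proof (rule inj_onI)
    fix a b assume ab: "a \<in> totatives u" "b \<in> totatives u" "a * t mod u = b * t mod u"
    then have "[a = b] (mod u)" using t cong_mult_rcancel_nat[of t u a b] by (simp add: cong_def)
    then show "a = b" using ab u1 totatives_less by (simp add: cong_def)
  qed
  have "(\<lambda>c. c * t mod u) ` totatives u = totatives u" by (rule endo_inj_surj[OF _ into inj]) simp
  then have "(\<Sum>c\<in>totatives u. F c) = (\<Sum>c\<in>totatives u. F (c * t mod u))"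
    using sum.reindex[OF inj, of F] by simp
  also have "\<dots> = (\<Sum>c\<in>totatives u. F (c * t))" by (intro sum.cong F) (auto simp: cong_def)
  finally show ?thesis by simp
qed

lemma sum_norm_weyl_sum_totatives_mult:
  assumes u: "u \<ge> 1" and t: "coprime t u"
  shows "(\<Sum>c\<in>totatives u. cmod (weyl_sum A (h * (c * t)) u) ^ k) = (\<Sum>c\<in>totatives u. cmod (weyl_sum A (h * c) u) ^ k)"
proof (rule sum_totatives_mult[OF u t])
  fix a b assume "[a = b] (mod u)"
  then have "[h * a = h * b] (mod u)" by (rule cong_scalar_left)
  then show "cmod (weyl_sum A (h * a) u) ^ k = cmod (weyl_sum A (h * b) u) ^ k"
    using weyl_sum_cong[OF u] by simp
qed

text \<open>Averaging over units removes the twists by u' and v', since multiplication by a unit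
  permutes the units. What was twisted multiplicative becomes multiplicative, and Euler products
  apply.\<close>

lemma weyl_mean_mult:
  assumes uv: "u \<ge> 1" "v \<ge> 1" "coprime u v"
  shows "weyl_mean A h (u * v) = weyl_mean A h u * weyl_mean A h v"
proof -
  obtain u' v' where inv: "[v * v' = 1] (mod u)" "[u * u' = 1] (mod v)"
    using coprime_inverse_exists uv by (metis coprime_commute)
  have cop: "coprime v' u" "coprime u' v"
    using inv by (metis cong_imp_coprime cong_sym coprime_1_left coprime_mult_left_iff)+
  let ?f = "\<lambda>c. cmod (weyl_sum A (h * (c * v')) u)" and ?g = "\<lambda>c. cmod (weyl_sum A (h * (c * u')) v)"
  have f_mod: "?f (c mod u) = ?f c" "?g (c mod v) = ?g c" for c
  proof -
    have "[h * (c mod u * v') = h * (c * v')] (mod u)" by (intro cong_scalar_left cong_scalar_right) (simp add: cong_def)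
    then show "?f (c mod u) = ?f c" using uv weyl_sum_cong by metis
    have "[h * (c mod v * u') = h * (c * u')] (mod v)" by (intro cong_scalar_left cong_scalar_right) (simp add: cong_def)
    then show "?g (c mod v) = ?g c" using uv weyl_sum_cong by metis
  qed
  have fg: "cmod (weyl_sum A (h * c) (u * v)) = ?f c * ?g c" for c
    using weyl_sum_mult[OF uv inv, of A "h * c"] by (simp add: norm_mult mult.assoc)
  have "(\<Sum>c\<in>totatives (u * v). ?f c * ?g c) = (\<Sum>c\<in>totatives u. ?f c) * (\<Sum>c\<in>totatives v. ?g c)"
  \<comment> \<open>For modulus 1, reduction does not map into the totatives, so the bijection holds
    only for both moduli above 1.\<close>
  proof (cases "u = 1 \<or> v = 1")
    case True
    then show ?thesis
    proof
      assume u: "u = 1"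
      have "?f c = ?f 1" for c using f_mod(1)[of c] f_mod(1)[of 1] u by simp
      then show ?thesis using u by (simp flip: sum_distrib_left)
    next
      assume v: "v = 1"
      have "?g c = ?g 1" for c using f_mod(2)[of c] f_mod(2)[of 1] v by simp
      then show ?thesis using v by (simp flip: sum_distrib_right)
    qed
  next
    case False
    then have bij: "bij_betw (\<lambda>x. (x mod u, x mod v)) (totatives (u * v)) (totatives u \<times> totatives v)"
      using uv by (intro bij_betw_totatives) auto
    have "(\<Sum>c\<in>totatives (u * v). ?f c * ?g c) = (\<Sum>c\<in>totatives (u * v). ?f (c mod u) * ?g (c mod v))"
      by (simp only: f_mod)
    also have "\<dots> = (\<Sum>(b, c)\<in>totatives u \<times> totatives v. ?f b * ?g c)"
      unfolding sum.reindex_bij_betw[OF bij, symmetric] by simp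
    also have "\<dots> = (\<Sum>c\<in>totatives u. ?f c) * (\<Sum>c\<in>totatives v. ?g c)"
      by (simp add: sum_product sum.cartesian_product)
    finally show ?thesis .
  qed
  then have "(\<Sum>c\<in>totatives (u * v). cmod (weyl_sum A (h * c) (u * v)))
    = (\<Sum>c\<in>totatives u. cmod (weyl_sum A (h * c) u)) * (\<Sum>c\<in>totatives v. cmod (weyl_sum A (h * c) v))"
    using sum_norm_weyl_sum_totatives_mult[OF uv(1) cop(1), of A h 1]
      sum_norm_weyl_sum_totatives_mult[OF uv(2) cop(2), of A h 1] by (simp add: fg)
  then show ?thesis using totient_mult_coprime[OF uv(3)] by (simp add: weyl_mean_def)
qed

lemma coprime_multiplicative_weyl_mean: "coprime_multiplicative (weyl_mean A h)"
  unfolding coprime_multiplicative_def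
proof (intro conjI allI impI)
  show "weyl_mean A h 1 = 1"
    by (simp add: weyl_mean_def weyl_sum_def rho_def crt_set_1[simplified])
qed (simp add: weyl_mean_mult)

text \<open>Parseval on Z/q: elements of \<open>crt_set A q\<close> are representatives below q, so
  congruent ones are equal and only the diagonal survives.\<close>

lemma sum_norm_weyl_sum_sq:
  assumes q: "q \<ge> 1" and r: "rho A q \<ge> 1"
  shows "(\<Sum>c<q. cmod (weyl_sum A c q) ^ 2) = real q / real (rho A q)"
proof -
  let ?S = "crt_set A q"
  have lt: "a < q" if "a \<in> ?S" for a using that by (simp add: crt_set_def)
  have "complex_of_real (\<Sum>c<q. cmod (\<Sum>a\<in>?S. add_char q (c * a)) ^ 2)
    = (\<Sum>c<q. \<Sum>a\<in>?S. \<Sum>b\<in>?S. add_char q (c * a) * cnj (add_char q (c * b)))"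
    by (simp add: complex_norm_square sum_product del: of_real_power)
  also have "\<dots> = (\<Sum>a\<in>?S. \<Sum>b\<in>?S. \<Sum>c<q. add_char q (c * a) * cnj (add_char q (c * b)))"
    by (subst sum.swap, rule sum.cong[OF refl], rule sum.swap)
  also have "\<dots> = (\<Sum>a\<in>?S. \<Sum>b\<in>?S. if a = b then of_nat q else 0)"
    using lt by (intro sum.cong refl) (simp add: add_char_orthogonality[OF q] cong_def)
  also have "\<dots> = of_nat (rho A q * q)"
    by (simp add: finite_crt_set rho_def)
  finally have "(\<Sum>c<q. cmod (\<Sum>a\<in>?S. add_char q (c * a)) ^ 2) = real (rho A q * q)"
    by (metis of_real_eq_iff of_real_of_nat_eq)
  then have "(\<Sum>c<q. cmod (weyl_sum A c q) ^ 2) = real (rho A q * q) / real (rho A q) ^ 2"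
    by (simp add: weyl_sum_def norm_divide power_divide flip: sum_divide_distrib)
  then show ?thesis using r by (simp add: power2_eq_square)
qed

text \<open>Multiplication by h permutes the units. Parseval without the frequency 0, where the sum
  is 1, leaves p / rho - 1 <= (p - 1) / 2 for p - 1 units. Cauchy-Schwarz then gives the mean 1 /
  sqrt 2, rounded up to 3/4 through 1/2 <= 9/16.\<close>

lemma weyl_mean_prime_le:
  assumes p: "prime p" "\<not> p dvd h" and r: "rho A p \<ge> 2"
  shows "weyl_mean A h p \<le> 3 / 4"
proof -
  have p2: "p \<ge> 2" and p1: "p \<ge> 1" using prime_ge_2_nat[OF p(1)] by auto
  have r0: "real (rho A p) \<ge> 2" using r by simp
  have "coprime h p" using p by (metis coprime_commute prime_imp_coprime)
  then have "(\<Sum>c\<in>totatives p. cmod (weyl_sum A (h * c) p) ^ 2) = (\<Sum>c\<in>totatives p. cmod (weyl_sum A c p) ^ 2)"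
    using sum_norm_weyl_sum_totatives_mult[OF p1, of h A 1 2] by (simp add: mult.commute)
  also have "\<dots> = (\<Sum>c<p. cmod (weyl_sum A c p) ^ 2) - 1"
  proof -
    have "{..<p} = insert 0 (totatives p)" using p1 by (auto simp: totatives_prime[OF p(1)])
    moreover have "weyl_sum A 0 p = 1" using r by (simp add: weyl_sum_def rho_def)
    ultimately show ?thesis by simp
  qed
  also have "\<dots> = real p / real (rho A p) - 1" using sum_norm_weyl_sum_sq[OF p1, of A] r by simp
  also have "\<dots> \<le> real p / 2 - 1" using r0 by (intro diff_right_mono divide_left_mono) auto
  also have "\<dots> \<le> (real p - 1) / 2" by (simp add: field_simps)
  finally have sq: "(\<Sum>c\<in>totatives p. cmod (weyl_sum A (h * c) p) ^ 2) \<le> (real p - 1) / 2" .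
  have tot: "real (card (totatives p)) = real p - 1"
    using totient_prime[OF p(1)] p1 by (simp add: totient_def of_nat_diff)
  have "(\<Sum>c\<in>totatives p. cmod (weyl_sum A (h * c) p)) ^ 2
      \<le> (\<Sum>c\<in>totatives p. 1\<^sup>2) * (\<Sum>c\<in>totatives p. cmod (weyl_sum A (h * c) p) ^ 2)"
    using Cauchy_Schwarz_ineq_sum[of "\<lambda>_. 1" "\<lambda>c. cmod (weyl_sum A (h * c) p)" "totatives p"] by simp
  also have "\<dots> \<le> (real p - 1) * ((real p - 1) / 2)" using sq tot p2 by (simp add: mult_left_mono)
  also have "\<dots> = 1 / 2 * (real p - 1) ^ 2" by (simp add: power2_eq_square)
  also have "\<dots> \<le> 9 / 16 * (real p - 1) ^ 2" by (intro mult_right_mono) auto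
  also have "\<dots> = (3 / 4 * (real p - 1)) ^ 2" by (simp add: power2_eq_square algebra_simps)
  finally have "(\<Sum>c\<in>totatives p. cmod (weyl_sum A (h * c) p)) \<le> 3 / 4 * (real p - 1)"
    by (rule power2_le_imp_le) (use p2 in simp)
  moreover have "real (totient p) = real p - 1" using tot by (simp add: totient_def)
  ultimately show ?thesis unfolding weyl_mean_def using p2 by (simp add: divide_le_eq)
qed

section \<open>A discrete Erdos--Turan inequality\<close>

definition char_sum :: "nat \<Rightarrow> nat \<Rightarrow> nat \<Rightarrow> complex" where
  "char_sum q L h = (\<Sum>j<L. add_char q (h * j))"

lemma norm_char_sum_le: "cmod (char_sum q L h) \<le> real L"
proof -
  have "cmod (char_sum q L h) \<le> (\<Sum>j<L. 1)" unfolding char_sum_def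
    by (rule order_trans[OF norm_sum]) simp
  then show ?thesis by simp
qed

lemma add_char_reflect:
  assumes "h \<le> q" "q \<ge> 1"
  shows "add_char q ((q - h) * a) = cnj (add_char q (h * a))"
proof -
  have "(q - h) * a + h * a = q * a" using assms by (simp flip: add_mult_distrib)
  then have "add_char q ((q - h) * a) * add_char q (h * a) = 1"
    using add_char_period[OF assms(2), of a] by (simp flip: add_char_add)
  moreover have "cnj (add_char q (h * a)) * add_char q (h * a) = 1"
    using complex_norm_square[of "add_char q (h * a)"] by (simp add: mult.commute)
  moreover have "add_char q (h * a) \<noteq> 0" by (metis norm_add_char norm_zero zero_neq_one)
  ultimately show ?thesis by (metis mult_right_cancel)
qed

lemma norm_char_sum_reflect:
  assumes "h \<le> q" "q \<ge> 1" shows "cmod (char_sum q L (q - h)) = cmod (char_sum q L h)"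
proof -
  have "char_sum q L (q - h) = cnj (char_sum q L h)"
    unfolding char_sum_def by (simp add: add_char_reflect[OF assms])
  then show ?thesis by simp
qed

lemma norm_weyl_sum_reflect:
  assumes "h \<le> q" "q \<ge> 1" shows "cmod (weyl_sum A (q - h) q) = cmod (weyl_sum A h q)"
proof -
  have "weyl_sum A (q - h) q = cnj (weyl_sum A h q)"
    unfolding weyl_sum_def by (simp add: add_char_reflect[OF assms])
  then show ?thesis by simp
qed

lemma sin_ge_half:
  fixes y :: real assumes "0 \<le> y" "y \<le> pi / 2" shows "sin y \<ge> y / 2"
proof -
  have "pi < 3.2" using pi_approx by simp
  then have y: "y \<le> 1.6" using assms by simp
  have "\<bar>sin y - (\<Sum>m<3. sin_coeff m * y ^ m)\<bar> \<le> inverse (fact 3) * \<bar>y\<bar> ^ 3"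
    by (rule Maclaurin_sin_bound)
  moreover have "(\<Sum>m<3. sin_coeff m * y ^ m) = y"
    by (simp add: eval_nat_numeral sin_coeff_def)
  moreover have "inverse (fact 3) * \<bar>y\<bar> ^ 3 \<le> y / 2"
  proof -
    \<comment> \<open>1.6 * 1.6 = 2.56 is below 3, so the Taylor remainder y^3 / 6 is at most y /
      2.\<close>
    have "y * y \<le> 1.6 * 1.6" using y assms by (intro mult_mono) auto
    then have "y * (y * y) \<le> y * 3" using assms by (intro mult_left_mono) auto
    then show ?thesis using assms by (simp add: eval_nat_numeral fact_numeral)
  qed
  ultimately show ?thesis by linarith
qed

lemma norm_1_minus_cis:
  assumes "0 \<le> y" "y \<le> pi / 2" shows "cmod (1 - cis (2 * y)) \<ge> y"
proof -
  have "cmod (1 - cis (2 * y)) ^ 2 = (1 - cos (2 * y)) ^ 2 + sin (2 * y) ^ 2"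
    by (simp add: cmod_power2)
  also have "\<dots> = 1 - 2 * cos (2 * y) + (sin (2 * y) ^ 2 + cos (2 * y) ^ 2)"
    by (simp only: power2_diff) simp
  also have "\<dots> = (2 * sin y) ^ 2"
    unfolding sin_cos_squared_add by (simp add: cos_double_sin power_mult_distrib)
  finally have "cmod (1 - cis (2 * y)) ^ 2 = (2 * sin y) ^ 2" .
  moreover have "2 * sin y \<ge> y" using sin_ge_half[OF assms] by simp
  ultimately show ?thesis using assms power2_le_imp_le[of y "cmod (1 - cis (2 * y))"]
    by (metis norm_ge_zero order_trans power_mono)
qed

text \<open>Geometric sum: the numerator is at most 2, and |1 - z| is at least pi h / q >= 2 h / q.
  The condition 2 * h <= q keeps the angle in the range of the sine bound; the other frequencies
  follow by reflection h -> q - h.\<close>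

lemma norm_char_sum_le_inverse:
  assumes h: "1 \<le> h" "2 * h \<le> q"
  shows "cmod (char_sum q L h) \<le> real q / real h"
proof -
  define z where "z = add_char q h"
  define y where "y = pi * real h / real q"
  have q: "real q > 0" "real h > 0" using h by auto
  have "real (2 * h) \<le> real q" using h(2) by (simp only: of_nat_le_iff)
  then have "y \<le> pi / 2" "0 \<le> y" using q by (auto simp: y_def field_simps)
  then have "y \<le> cmod (1 - cis (2 * y))" by (intro norm_1_minus_cis)
  moreover have "cis (2 * y) = z" by (simp add: z_def add_char_def y_def mult.assoc)
  moreover have "2 * real h / real q \<le> y" unfolding y_def
    using pi_ge_two q by (intro divide_right_mono mult_right_mono) auto
  ultimately have z1: "2 * real h / real q \<le> cmod (1 - z)" by auto
  have "char_sum q L h = (\<Sum>j<L. z ^ j)"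
    by (simp add: char_sum_def z_def mult.commute[of h] flip: add_char_power)
  then have "(1 - z) * char_sum q L h = 1 - z ^ L" by (simp add: one_diff_power_eq)
  then have "cmod (1 - z) * cmod (char_sum q L h) = cmod (1 - z ^ L)" by (metis norm_mult)
  also have "\<dots> \<le> cmod 1 + cmod (z ^ L)" by (rule norm_triangle_ineq4)
  also have "\<dots> = 2" by (simp add: norm_power z_def)
  finally have "cmod (1 - z) * cmod (char_sum q L h) \<le> 2" .
  moreover have "2 * real h / real q * cmod (char_sum q L h) \<le> cmod (1 - z) * cmod (char_sum q L h)"
    using z1 by (intro mult_right_mono) auto
  ultimately have "2 * real h / real q * cmod (char_sum q L h) \<le> 2" by linarith
  then show ?thesis using q by (simp add: field_simps)
qed

text \<open>A window of K consecutive integers read modulo q. Using integers instead of residues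
  spares a case split when the arc wraps around 0; a residue counts once even if the window meets it
  repeatedly.\<close>

definition interval_hits :: "(nat \<Rightarrow> nat set) \<Rightarrow> nat \<Rightarrow> nat \<Rightarrow> nat \<Rightarrow> nat set" where
  "interval_hits A q u K = {a \<in> crt_set A q. \<exists>n\<in>{u..<u + K}. [n = a] (mod q)}"

text \<open>The indicator of the interval is dominated by the trapezoid obtained by convolving an
  interval of length \<open>K + M - 1\<close> with the uniform measure on an interval of length \<open>M\<close>; the
  Fourier coefficients of the trapezoid are products of two geometric sums.\<close>

lemma interval_hits_le_char_sums:
  assumes q: "q \<ge> 1" and r: "rho A q \<ge> 1" and M: "M \<ge> 1" "M \<le> u"
  shows "real (card (interval_hits A q u K)) / real (rho A q)
    \<le> (real K + real M) / real q
      + (\<Sum>h\<in>{1..<q}. cmod (weyl_sum A h q) * cmod (char_sum q (K + M - 1) h) * cmod (char_sum q M h)) / (real q * real M)"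
proof -
  \<comment> \<open>The long interval starts M - 1 before the window, so each n in the window equals
    b + i + j for every j < M with a suitable i < L. The hypothesis M <= u keeps the subtraction
    exact.\<close>
  define b where "b = u + 1 - M"
  define L where "L = K + M - 1"
  let ?S = "crt_set A q" and ?H = "interval_hits A q u K"
  let ?F = "\<lambda>h. cmod (weyl_sum A h q) * cmod (char_sum q L h) * cmod (char_sum q M h)"
  have r0: "real (rho A q) > 0" using r by simp
  have finS: "finite ?S" by (rule finite_crt_set)
  have "real M * of_bool (a \<in> ?H) \<le> (\<Sum>j<M. \<Sum>i<L. of_bool ([b + i + j = a] (mod q)))" for a
  proof (cases "a \<in> ?H")
    case True
    then obtain n where n: "u \<le> n" "n < u + K" "[n = a] (mod q)" by (auto simp: interval_hits_def)
    have "(1::real) \<le> (\<Sum>i<L. of_bool ([b + i + j = a] (mod q)))" if "j < M" for j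
    proof -
      define i where "i = n - j - b"
      have "i < L" "b + i + j = n" using n that M by (auto simp: i_def b_def L_def)
      then have "(1::real) = of_bool ([b + i + j = a] (mod q))" using n by simp
      also have "\<dots> \<le> (\<Sum>i<L. of_bool ([b + i + j = a] (mod q)))"
        using \<open>i < L\<close> by (intro member_le_sum) auto
      finally show ?thesis .
    qed
    then have "(\<Sum>j<M. 1::real) \<le> (\<Sum>j<M. \<Sum>i<L. of_bool ([b + i + j = a] (mod q)))"
      by (intro sum_mono) auto
    then show ?thesis using True by simp
  qed (simp add: sum_nonneg)
  then have "(\<Sum>a\<in>?S. real M * of_bool (a \<in> ?H)) \<le> (\<Sum>a\<in>?S. \<Sum>j<M. \<Sum>i<L. of_bool ([b + i + j = a] (mod q)))"
    by (intro sum_mono) auto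
  moreover have "(\<Sum>a\<in>?S. real M * of_bool (a \<in> ?H)) = real M * real (card ?H)"
  proof -
    have "(\<Sum>a\<in>?S. of_bool (a \<in> ?H)) = real (card (?S \<inter> {a. a \<in> ?H}))"
      using finS by (subst sum_of_bool_eq) auto
    also have "?S \<inter> {a. a \<in> ?H} = ?H" by (auto simp: interval_hits_def)
    finally show ?thesis by (simp flip: sum_distrib_left)
  qed
  moreover define T where "T = (\<Sum>a\<in>?S. \<Sum>j<M. \<Sum>i<L. of_bool ([b + i + j = a] (mod q)) :: real)"
  ultimately have le1: "real M * real (card ?H) \<le> T" by linarith
  have ind: "of_bool ([b + i + j = a] (mod q)) = (\<Sum>h<q. add_char q (h * a) * cnj (add_char q (h * (b + i + j)))) / of_nat q"
    for i j a using q by (auto simp: add_char_orthogonality[OF q] cong_sym_eq)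
  have "complex_of_real T = (\<Sum>a\<in>?S. \<Sum>j<M. \<Sum>i<L. of_bool ([b + i + j = a] (mod q)))"
    by (simp add: T_def)
  also have "\<dots> = (\<Sum>a\<in>?S. \<Sum>j<M. \<Sum>i<L. \<Sum>h<q. add_char q (h * a) * cnj (add_char q (h * (b + i + j)))) / of_nat q"
    unfolding ind by (simp only: sum_divide_distrib)
  also have "(\<Sum>a\<in>?S. \<Sum>j<M. \<Sum>i<L. \<Sum>h<q. add_char q (h * a) * cnj (add_char q (h * (b + i + j))))
    = (\<Sum>a\<in>?S. \<Sum>j<M. \<Sum>h<q. \<Sum>i<L. add_char q (h * a) * cnj (add_char q (h * (b + i + j))))"
    by (intro sum.cong refl sum.swap)
  also have "\<dots> = (\<Sum>a\<in>?S. \<Sum>h<q. \<Sum>j<M. \<Sum>i<L. add_char q (h * a) * cnj (add_char q (h * (b + i + j))))"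
    by (intro sum.cong refl sum.swap)
  also have "\<dots> = (\<Sum>h<q. \<Sum>a\<in>?S. \<Sum>j<M. \<Sum>i<L. add_char q (h * a) * cnj (add_char q (h * (b + i + j))))"
    by (rule sum.swap)
  also have "\<dots> = (\<Sum>h<q. (of_nat (rho A q) * weyl_sum A h q) * cnj (add_char q (h * b)) * cnj (char_sum q L h) * cnj (char_sum q M h))"
  proof (intro sum.cong refl)
    fix h
    have "(\<Sum>a\<in>?S. \<Sum>j<M. \<Sum>i<L. add_char q (h * a) * cnj (add_char q (h * (b + i + j))))
      = (\<Sum>a\<in>?S. \<Sum>j<M. \<Sum>i<L. add_char q (h * a) * (cnj (add_char q (h * b)) * (cnj (add_char q (h * j)) * cnj (add_char q (h * i)))))"
      by (intro sum.cong refl) (simp add: distrib_left add_char_add mult_ac)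
    also have "\<dots> = (\<Sum>a\<in>?S. add_char q (h * a)) * (cnj (add_char q (h * b)) * ((\<Sum>j<M. cnj (add_char q (h * j))) * (\<Sum>i<L. cnj (add_char q (h * i)))))"
      by (simp only: sum_distrib_left[symmetric] sum_distrib_right[symmetric])
    also have "(\<Sum>a\<in>?S. add_char q (h * a)) = of_nat (rho A q) * weyl_sum A h q"
      using r by (simp add: weyl_sum_def)
    finally show "(\<Sum>a\<in>?S. \<Sum>j<M. \<Sum>i<L. add_char q (h * a) * cnj (add_char q (h * (b + i + j))))
       = (of_nat (rho A q) * weyl_sum A h q) * cnj (add_char q (h * b)) * cnj (char_sum q L h) * cnj (char_sum q M h)"
      by (simp add: char_sum_def mult_ac)
  qed
  finally have "cmod (complex_of_real T) \<le> (\<Sum>h<q. real (rho A q) * ?F h) / real q"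
    by (auto simp: norm_divide norm_mult mult.assoc intro!: divide_right_mono order_trans[OF norm_sum] sum_mono)
  then have "T \<le> real (rho A q) * (\<Sum>h<q. ?F h) / real q"
    by (simp flip: sum_distrib_left)
  also have "(\<Sum>h<q. ?F h) = ?F 0 + (\<Sum>h\<in>{1..<q}. ?F h)"
  proof -
    have "{..<q} = insert 0 {1..<q}" using q by auto
    then show ?thesis by simp
  qed
  also have "?F 0 = real L * real M" using r by (simp add: weyl_sum_def rho_def char_sum_def)
  finally have "real M * real (card ?H) \<le> real (rho A q) * (real L * real M + (\<Sum>h\<in>{1..<q}. ?F h)) / real q"
    using le1 by linarith
  then have "real (card ?H) / real (rho A q) \<le> (real L * real M + (\<Sum>h\<in>{1..<q}. ?F h)) / (real q * real M)"
    using r0 M q by (simp add: field_simps)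
  also have "\<dots> = real L / real q + (\<Sum>h\<in>{1..<q}. ?F h) / (real q * real M)"
    using M by (simp add: add_divide_distrib)
  also have "\<dots> \<le> (real K + real M) / real q + (\<Sum>h\<in>{1..<q}. ?F h) / (real q * real M)"
    by (intro add_right_mono divide_right_mono) (auto simp: L_def)
  finally show ?thesis by (simp add: L_def)
qed

lemma sum_inverse_squares_tail:
  assumes "H \<ge> 1" shows "(\<Sum>h\<in>{H<..n}. 1 / real h ^ 2) \<le> 1 / real H"
proof (cases "H \<le> n")
  case True
  then have "(\<Sum>h\<in>{H<..n}. 1 / real h ^ 2) \<le> 1 / real H - 1 / real n"
  proof (induction n rule: dec_induct)
    case (step n)
    have n: "real n > 0" using step assms by simp
    have "{H<..Suc n} = insert (Suc n) {H<..n}" using step by auto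
    then have "(\<Sum>h\<in>{H<..Suc n}. 1 / real h ^ 2) \<le> 1 / real (Suc n) ^ 2 + (1 / real H - 1 / real n)"
      using step.IH by simp
    moreover have "1 / real (Suc n) ^ 2 \<le> 1 / (real n * real (Suc n))"
      using n unfolding power2_eq_square by (intro divide_left_mono mult_right_mono) auto
    moreover have "1 / (real n * real (Suc n)) = 1 / real n - 1 / real (Suc n)"
      using n by (simp add: field_simps)
    ultimately show ?case by linarith
  qed simp
  moreover have "0 \<le> 1 / real n" by simp
  ultimately show ?thesis by linarith
qed simp

text \<open>Reflection h -> q - h folds the sum to h <= q / 2. Up to H the short kernel is bounded
  by M and the long one by q / h. Beyond H both kernels are bounded by q / h and the Weyl sum by 1;
  the resulting decay 1 / h^2 is the gain from smoothing the interval.\<close>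

lemma sum_char_sums_le:
  assumes q: "q \<ge> 1" and M: "M \<ge> 1" and H: "H \<ge> 1"
  shows "(\<Sum>h\<in>{1..<q}. cmod (weyl_sum A h q) * cmod (char_sum q L h) * cmod (char_sum q M h))
    \<le> real q * real M * (2 * (\<Sum>h\<in>{1..H}. cmod (weyl_sum A h q) / real h) + 2 * real q / (real M * real H))"
proof -
  let ?F = "\<lambda>h. cmod (weyl_sum A h q) * cmod (char_sum q L h) * cmod (char_sum q M h)"
  let ?I = "{1..q div 2}"
  have F0: "?F h \<ge> 0" for h by simp
  have "{1..<q} \<subseteq> ?I \<union> (\<lambda>h. q - h) ` ?I"
  proof
    fix h assume h: "h \<in> {1..<q}"
    show "h \<in> ?I \<union> (\<lambda>h. q - h) ` ?I"
    proof (cases "h \<le> q div 2")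
      case False
      then have "q - h \<in> ?I" "h = q - (q - h)" using h by auto
      then show ?thesis by blast
    qed (use h in auto)
  qed
  then have "(\<Sum>h\<in>{1..<q}. ?F h) \<le> (\<Sum>h\<in>?I \<union> (\<lambda>h. q - h) ` ?I. ?F h)"
    by (intro sum_mono2) auto
  also have "\<dots> \<le> (\<Sum>h\<in>?I. ?F h) + (\<Sum>h\<in>(\<lambda>h. q - h) ` ?I. ?F h)"
    by (subst sum.union_inter[symmetric]) (auto intro: sum_nonneg)
  also have "(\<Sum>h\<in>(\<lambda>h. q - h) ` ?I. ?F h) = (\<Sum>h\<in>?I. ?F (q - h))"
    by (subst sum.reindex) (auto simp: inj_on_def)
  also have "\<dots> = (\<Sum>h\<in>?I. ?F h)"
    using q by (intro sum.cong) (auto simp: norm_weyl_sum_reflect norm_char_sum_reflect)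
  finally have "(\<Sum>h\<in>{1..<q}. ?F h) \<le> 2 * (\<Sum>h\<in>?I. ?F h)" by simp
  also have "(\<Sum>h\<in>?I. ?F h) \<le> (\<Sum>h\<in>?I. (if h \<le> H then real q * real M * (cmod (weyl_sum A h q) / real h) else 0)
      + (if H < h then real q ^ 2 * (1 / real h ^ 2) else 0))"
  proof (rule sum_mono)
    fix h assume h: "h \<in> ?I"
    have D: "cmod (char_sum q K h) \<le> real q / real h" for K
      using h by (intro norm_char_sum_le_inverse) auto
    show "?F h \<le> (if h \<le> H then real q * real M * (cmod (weyl_sum A h q) / real h) else 0)
      + (if H < h then real q ^ 2 * (1 / real h ^ 2) else 0)"
    proof (cases "h \<le> H")
      case True
      have "?F h \<le> cmod (weyl_sum A h q) * (real q / real h) * real M"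
        using D by (intro mult_mono norm_char_sum_le) auto
      then show ?thesis using True by (simp add: mult_ac)
    next
      case False
      have "?F h \<le> 1 * (real q / real h) * (real q / real h)"
        using D by (intro mult_mono norm_weyl_sum_le) auto
      then show ?thesis using False by (simp add: power2_eq_square)
    qed
  qed
  also have "\<dots> = (\<Sum>h | h \<in> ?I \<and> h \<le> H. real q * real M * (cmod (weyl_sum A h q) / real h))
      + (\<Sum>h | h \<in> ?I \<and> H < h. real q ^ 2 * (1 / real h ^ 2))"
    by (simp only: sum.distrib sum.inter_filter[symmetric] finite_atLeastAtMost)
  also have "(\<Sum>h | h \<in> ?I \<and> h \<le> H. real q * real M * (cmod (weyl_sum A h q) / real h))
      \<le> (\<Sum>h\<in>{1..H}. real q * real M * (cmod (weyl_sum A h q) / real h))"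
    by (intro sum_mono2) auto
  also have "(\<Sum>h | h \<in> ?I \<and> H < h. real q ^ 2 * (1 / real h ^ 2)) \<le> (\<Sum>h\<in>{H<..q div 2}. real q ^ 2 * (1 / real h ^ 2))"
    by (intro sum_mono2) auto
  also have "\<dots> \<le> real q ^ 2 * (1 / real H)"
    unfolding sum_distrib_left[symmetric] by (intro mult_left_mono sum_inverse_squares_tail H) auto
  finally have "(\<Sum>h\<in>{1..<q}. ?F h) \<le> 2 * (real q * real M * (\<Sum>h\<in>{1..H}. cmod (weyl_sum A h q) / real h) + real q ^ 2 * (1 / real H))"
    by (simp only: sum_distrib_left)
  also have "\<dots> = real q * real M * (2 * (\<Sum>h\<in>{1..H}. cmod (weyl_sum A h q) / real h) + 2 * real q / (real M * real H))"
    using M H by (simp add: field_simps power2_eq_square)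
  finally show ?thesis .
qed

lemma interval_hits_upper:
  assumes q: "q \<ge> N" and N: "N \<ge> 1" and r: "rho A q \<ge> 1" and u: "u \<ge> q"
  shows "real (card (interval_hits A q u K)) / real (rho A q)
    \<le> real K / real q + 4 / real N + 2 * (\<Sum>h\<in>{1..N ^ 2}. cmod (weyl_sum A h q) / real h)"
proof -
  \<comment> \<open>M is q / N rounded up. With H = N^2 the two losses balance: widening costs M / q
    <= 2 / N, and the tail of high frequencies costs 2q / (M N^2) <= 2 / N.\<close>
  define M where "M = (q + N - 1) div N"
  have q1: "q \<ge> 1" using q N by simp
  have "M * N \<le> q + N - 1" unfolding M_def by simp
  then have "M * N \<le> q + N" by linarith
  then have "real (M * N) \<le> real (q + N)" by (simp only: of_nat_le_iff)
  then have MN: "real M * real N \<le> real q + real N" by simp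
  have "q + N - 1 < M * N + N"
    unfolding M_def using N by (metis One_nat_def Suc_le_lessD add.commute div_mult_mod_eq mod_less_divisor nat_add_left_cancel_less)
  then have "q \<le> M * N" by linarith
  then have qM: "real q \<le> real M * real N" by (metis of_nat_le_iff of_nat_mult)
  have M1: "M \<ge> 1" using \<open>q \<le> M * N\<close> q1 by (cases M) auto
  have Mq: "M \<le> q"
  proof -
    have "M \<le> (q * N) div N" unfolding M_def
    proof (rule div_le_mono)
      obtain a b where "q = Suc a" "N = Suc b" using q1 N by (metis One_nat_def Suc_le_D)
      then show "q + N - 1 \<le> q * N" by simp
    qed
    then show ?thesis using N by simp
  qed
  let ?S = "2 * (\<Sum>h\<in>{1..N ^ 2}. cmod (weyl_sum A h q) / real h)"
  have "real (card (interval_hits A q u K)) / real (rho A q)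
    \<le> (real K + real M) / real q
      + (\<Sum>h\<in>{1..<q}. cmod (weyl_sum A h q) * cmod (char_sum q (K + M - 1) h) * cmod (char_sum q M h)) / (real q * real M)"
    using q1 r M1 Mq u by (intro interval_hits_le_char_sums) auto
  also have "(\<Sum>h\<in>{1..<q}. cmod (weyl_sum A h q) * cmod (char_sum q (K + M - 1) h) * cmod (char_sum q M h)) / (real q * real M)
    \<le> ?S + 2 * real q / (real M * real (N ^ 2))"
    using sum_char_sums_le[OF q1 M1, of "N ^ 2" A "K + M - 1"] N q1 M1
    by (simp add: divide_le_eq mult.commute)
  also have "2 * real q / (real M * real (N ^ 2)) \<le> 2 * (real M * real N) / (real M * real (N ^ 2))"
    using qM by (intro divide_right_mono) auto
  also have "\<dots> = 2 / real N" using M1 N by (simp add: power2_eq_square)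
  also have "(real K + real M) / real q \<le> real K / real q + 2 / real N"
  proof -
    have "real M * real N \<le> 2 * real q" using MN q by simp
    then have "real M / real q \<le> 2 / real N" using N q1 by (simp add: field_simps)
    then show ?thesis by (simp add: add_divide_distrib)
  qed
  finally show ?thesis by (simp add: algebra_simps)
qed

lemma exists_cong_in_window:
  fixes q u a :: nat
  assumes "q \<ge> 1" shows "\<exists>n. u \<le> n \<and> n < u + q \<and> [n = a] (mod q)"
proof (intro exI conjI)
  define n where "n = u + (a + q - u mod q) mod q"
  have "u mod q < q" using assms by simp
  have "[n = u mod q + (a + q - u mod q)] (mod q)" by (simp add: n_def cong_def mod_simps)
  also have "u mod q + (a + q - u mod q) = a + q" using \<open>u mod q < q\<close> by simp
  also have "[a + q = a] (mod q)" by (simp add: cong_def)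
  finally show "[n = a] (mod q)" .
  show "u \<le> n" "n < u + q" using assms by (auto simp: n_def)
qed

text \<open>A majorant suffices: the windows from u to u + K and from u + K to u + q together meet
  every residue class, so the upper bound for the complement is a lower bound for the
  window.\<close>

lemma interval_hits_discrepancy:
  assumes q: "q \<ge> N" and N: "N \<ge> 1" and r: "rho A q \<ge> 1" and u: "u \<ge> q" and K: "K \<le> q"
  shows "\<bar>real (card (interval_hits A q u K)) / real (rho A q) - real K / real q\<bar>
    \<le> 4 / real N + 2 * (\<Sum>h\<in>{1..N ^ 2}. cmod (weyl_sum A h q) / real h)"
proof -
  let ?B = "4 / real N + 2 * (\<Sum>h\<in>{1..N ^ 2}. cmod (weyl_sum A h q) / real h)"
  let ?H = "interval_hits A q u K" and ?H' = "interval_hits A q (u + K) (q - K)"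
  have r0: "real (rho A q) > 0" using r by simp
  have fin: "finite ?H" "finite ?H'" unfolding interval_hits_def using finite_crt_set by auto
  have "crt_set A q \<subseteq> ?H \<union> ?H'"
  proof
    fix a assume a: "a \<in> crt_set A q"
    obtain n where "u \<le> n" "n < u + q" "[n = a] (mod q)"
      using exists_cong_in_window[of q u a] q N by auto
    then show "a \<in> ?H \<union> ?H'"
      using a K unfolding interval_hits_def by (cases "n < u + K") auto
  qed
  then have "rho A q \<le> card (?H \<union> ?H')" unfolding rho_def using fin by (intro card_mono) auto
  also have "\<dots> \<le> card ?H + card ?H'" by (rule card_Un_le)
  finally have "real (rho A q) \<le> real (card ?H) + real (card ?H')" by linarith
  then have "1 \<le> real (card ?H) / real (rho A q) + real (card ?H') / real (rho A q)"
    using r0 by (simp add: divide_simps)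
  moreover have "real (card ?H') / real (rho A q) \<le> real (q - K) / real q + ?B"
    using interval_hits_upper[of N q A "u + K" "q - K"] q N r u by simp
  moreover have "real (q - K) / real q = 1 - real K / real q"
    using K q N by (simp add: of_nat_diff diff_divide_distrib)
  moreover have "real (card ?H) / real (rho A q) \<le> real K / real q + ?B"
    using interval_hits_upper[OF q N r u, of K] by simp
  ultimately show ?thesis unfolding abs_le_iff by linarith
qed

section \<open>From intervals of R/Z to windows of integers\<close>

lemma frac_image_shift: "frac ` {s + of_int k..t + of_int k} = frac ` {s..t::real}"
proof -
  have eq: "{s + of_int k..t + of_int k} = (\<lambda>x. x + of_int k) ` {s..t}"
    by (simp add: image_add_atLeastAtMost')
  have "frac (x + of_int k) = frac x" for x :: real by (simp add: frac_def)
  then show ?thesis unfolding eq image_image by simp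
qed

lemma frac_div_in_image_iff:
  assumes q: "q \<ge> 1" and s: "s \<ge> 0"
  shows "frac (real a / real q) \<in> frac ` {s..t} \<longleftrightarrow> (\<exists>n. [n = a] (mod q) \<and> s * real q \<le> real n \<and> real n \<le> t * real q)"
proof
  assume "frac (real a / real q) \<in> frac ` {s..t}"
  then obtain x where x: "s \<le> x" "x \<le> t" "frac (real a / real q) = frac x" by auto
  define k where "k = \<lfloor>x\<rfloor> - \<lfloor>real a / real q\<rfloor>"
  have xk: "x = real a / real q + of_int k" using x(3) by (simp add: k_def frac_def)
  define n where "n = nat (int a + k * int q)"
  have xq: "x * real q = of_int (int a + k * int q)" using q by (simp add: xk field_simps)
  moreover have "x * real q \<ge> 0" using x s by simp
  ultimately have pos: "int a + k * int q \<ge> 0" by linarith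
  then have n: "int n = int a + k * int q" by (simp add: n_def)
  then have "[int n = int a] (mod int q)" by (simp add: cong_def)
  then have "[n = a] (mod q)" by (simp add: cong_int_iff)
  moreover have "real n = x * real q" using n xq by (metis of_int_of_nat_eq)
  ultimately show "\<exists>n. [n = a] (mod q) \<and> s * real q \<le> real n \<and> real n \<le> t * real q"
    using x by (intro exI[of _ n]) (auto intro: mult_right_mono)
next
  assume "\<exists>n. [n = a] (mod q) \<and> s * real q \<le> real n \<and> real n \<le> t * real q"
  then obtain n where n: "[n = a] (mod q)" "s * real q \<le> real n" "real n \<le> t * real q" by blast
  have q0: "real q > 0" using q by simp
  have "int q dvd int n - int a" using n(1) by (simp add: cong_iff_dvd_diff flip: cong_int_iff)
  then obtain k where "int n - int a = int q * k" by (elim dvdE)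
  then have "int n = int a + int q * k" by linarith
  then have "real_of_int (int n) = real_of_int (int a + int q * k)" by (simp only:)
  then have "real n / real q = real a / real q + of_int k" using q0 by (simp add: field_simps)
  then have "frac (real n / real q) = frac (real a / real q)" by (simp add: frac_def)
  moreover have "real n / real q \<in> {s..t}" using n q0 by (simp add: field_simps)
  ultimately show "frac (real a / real q) \<in> frac ` {s..t}" by (metis imageI)
qed

lemma prob_Delta_interval:
  assumes q: "q \<in> Q_set A" and s: "s \<ge> 0" "s \<le> t"
  defines "u \<equiv> nat \<lceil>s * real q\<rceil>" and "K \<equiv> nat (\<lfloor>t * real q\<rfloor> + 1 - \<lceil>s * real q\<rceil>)"
  shows "measure_pmf.prob (Delta A q) (frac ` {s..t}) = real (card (interval_hits A q u K)) / real (rho A q)"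
proof -
  have q1: "q \<ge> 1" using q by (simp add: Q_set_def)
  have "s * real q \<ge> 0" using s by simp
  then have u: "int u = \<lceil>s * real q\<rceil>" unfolding u_def by linarith
  \<comment> \<open>For ordered endpoints the ceiling of s q exceeds the floor of t q by at most 1,
    so \<open>nat\<close> truncates nothing; K = 0 is an interval without lattice points.\<close>
  have "s * real q \<le> t * real q" using s by (intro mult_right_mono) auto
  then have K: "int K = \<lfloor>t * real q\<rfloor> + 1 - \<lceil>s * real q\<rceil>" unfolding K_def by (simp, linarith)
  have "n \<in> {u..<u + K} \<longleftrightarrow> s * real q \<le> real n \<and> real n \<le> t * real q" for n
  proof -
    have "n \<in> {u..<u + K} \<longleftrightarrow> \<lceil>s * real q\<rceil> \<le> int n \<and> int n \<le> \<lfloor>t * real q\<rfloor>"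
      using u K by (auto simp: of_nat_le_iff[of u n, where 'a = int, symmetric])
    then show ?thesis by (simp add: ceiling_le_iff le_floor_iff)
  qed
  then have iff: "frac (real a / real q) \<in> frac ` {s..t} \<longleftrightarrow> (\<exists>n\<in>{u..<u + K}. [n = a] (mod q))" for a
    unfolding frac_div_in_image_iff[OF q1 s(1)] by blast
  have "(\<Sum>a\<in>crt_set A q. indicator (frac ` {s..t}) (frac (real a / real q)))
     = (\<Sum>a\<in>crt_set A q. of_bool (\<exists>n\<in>{u..<u + K}. [n = a] (mod q)) :: real)"
    by (intro sum.cong) (auto simp: indicator_def iff)
  also have "\<dots> = real (card (crt_set A q \<inter> {a. \<exists>n\<in>{u..<u + K}. [n = a] (mod q)}))"
    using finite_crt_set by (subst sum_of_bool_eq) auto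
  also have "crt_set A q \<inter> {a. \<exists>n\<in>{u..<u + K}. [n = a] (mod q)} = interval_hits A q u K"
    by (auto simp: interval_hits_def)
  finally show ?thesis using measure_Delta[OF q] by simp
qed

lemma disc_le:
  assumes "\<And>s t. s \<le> t \<Longrightarrow> t \<le> s + 1 \<Longrightarrow> \<bar>measure_pmf.prob \<mu> (frac ` {s..t}) - (t - s)\<bar> \<le> B"
  shows "disc \<mu> \<le> B"
  unfolding disc_def
proof (rule cSup_least)
  show "{\<bar>measure_pmf.prob \<mu> (frac ` {s..t}) - (t - s)\<bar> |s t. s \<le> t \<and> t \<le> s + 1} \<noteq> {}"
    by (auto intro!: exI[of _ 0])
qed (use assms in auto)

lemma disc_le_1: "disc \<mu> \<le> 1"
proof (rule disc_le)
  fix s t :: real assume "s \<le> t" "t \<le> s + 1"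
  moreover have "measure_pmf.prob \<mu> (frac ` {s..t}) \<le> 1" "measure_pmf.prob \<mu> (frac ` {s..t}) \<ge> 0" by auto
  ultimately show "\<bar>measure_pmf.prob \<mu> (frac ` {s..t}) - (t - s)\<bar> \<le> 1" by linarith
qed

lemma erdos_turan:
  assumes q: "q \<in> Q_set A" and N: "N \<ge> 1" "q \<ge> N"
  shows "disc (Delta A q) \<le> 5 / real N + 2 * (\<Sum>h\<in>{1..N ^ 2}. cmod (weyl_sum A h q) / real h)"
proof (rule disc_le)
  fix s0 t0 :: real assume st0: "s0 \<le> t0" "t0 \<le> s0 + 1"
  let ?B = "2 * (\<Sum>h\<in>{1..N ^ 2}. cmod (weyl_sum A h q) / real h)"
  have B0: "?B \<ge> 0" by (simp add: sum_nonneg)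
  have r: "rho A q \<ge> 1" and q1: "q \<ge> 1" using q by (auto simp: Q_set_def)
  \<comment> \<open>The integer translation puts s in [1, 2), whence u >= q. The smoothing length M
    <= q then fits to the left of the window.\<close>
  define k where "k = 1 - \<lfloor>s0\<rfloor>"
  define s t where "s = s0 + of_int k" and "t = t0 + of_int k"
  have s1: "s \<ge> 1" unfolding s_def k_def by linarith
  have st: "s \<le> t" "t \<le> s + 1" "t0 - s0 = t - s" using st0 by (auto simp: s_def t_def)
  define u K where "u = nat \<lceil>s * real q\<rceil>" and "K = nat (\<lfloor>t * real q\<rfloor> + 1 - \<lceil>s * real q\<rceil>)"
  have prob: "measure_pmf.prob (Delta A q) (frac ` {s0..t0}) = real (card (interval_hits A q u K)) / real (rho A q)"
    using prob_Delta_interval[OF q, of s t] s1 st frac_image_shift[of s0 k t0]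
    by (simp add: u_def K_def s_def t_def)
  have "real q \<le> s * real q" using s1 by (simp add: mult_le_cancel_right1)
  then have uq: "u \<ge> q" unfolding u_def by linarith
  have stq: "s * real q \<le> t * real q" "t * real q \<le> s * real q + real q"
    using st mult_right_mono[of t "s + 1" "real q"] by (auto simp: mult_right_mono algebra_simps)
  have "real K = of_int (\<lfloor>t * real q\<rfloor> + 1 - \<lceil>s * real q\<rceil>)"
    unfolding K_def using stq by (simp, linarith)
  then have Kq: "real K \<le> (t * real q - s * real q) + 1" "real K \<ge> (t * real q - s * real q) - 1" by linarith+
  have q0: "real q > 0" using q1 by simp
  have diff: "\<bar>real K / real q - (t - s)\<bar> \<le> 1 / real q"
  proof -
    have "\<bar>real K - (t - s) * real q\<bar> \<le> 1" using Kq by (auto simp: algebra_simps abs_le_iff)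
    then have "\<bar>real K - (t - s) * real q\<bar> / real q \<le> 1 / real q" using q0 by (intro divide_right_mono) auto
    moreover have "\<bar>real K - (t - s) * real q\<bar> / real q = \<bar>(real K - (t - s) * real q) / real q\<bar>" using q0 by simp
    moreover have "(real K - (t - s) * real q) / real q = real K / real q - (t - s)"
      using q0 by (simp add: diff_divide_distrib)
    ultimately show ?thesis by simp
  qed
  have qN: "1 / real q \<le> 1 / real N" using N q1 by (intro divide_left_mono) auto
  show "\<bar>measure_pmf.prob (Delta A q) (frac ` {s0..t0}) - (t0 - s0)\<bar> \<le> 5 / real N + ?B"
  proof (cases "K \<le> q")
    case True
    have "\<bar>real (card (interval_hits A q u K)) / real (rho A q) - real K / real q\<bar> \<le> 4 / real N + ?B"
      using N r uq True by (intro interval_hits_discrepancy) auto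
    then show ?thesis using diff qN unfolding prob st(3) by linarith
  next
    \<comment> \<open>More than q lattice points fit only in an interval of length 1, that is, the
      whole circle, where mass and length are both 1.\<close>
    case False
    then have "real K \<ge> real q + 1" by linarith
    then have "(t - s) * real q \<ge> real q" using Kq by (simp add: algebra_simps)
    then have "t - s \<ge> 1" using q0 by simp
    then have ts: "t - s = 1" using st by simp
    have "measure_pmf.prob (Delta A q) (frac ` {s0..t0}) = 1"
    proof -
      have "interval_hits A q u K \<subseteq> crt_set A q" by (auto simp: interval_hits_def)
      moreover have "crt_set A q \<subseteq> interval_hits A q u K"
      proof
        fix a assume a: "a \<in> crt_set A q"
        obtain n where "u \<le> n" "n < u + q" "[n = a] (mod q)"
          using exists_cong_in_window[of q u a] q1 by auto
        then show "a \<in> interval_hits A q u K" using a False unfolding interval_hits_def by auto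
      qed
      ultimately have "interval_hits A q u K = crt_set A q" by auto
      then show ?thesis unfolding prob using r by (simp add: rho_def)
    qed
    then show ?thesis using st(3) ts B0 by simp
  qed
qed

section \<open>A lower bound for the number of moduli\<close>

lemma exp_minus_one_le:
  fixes t :: real shows "exp t - 1 \<le> t * exp t"
proof -
  have "1 - t \<le> exp (- t)" using exp_ge_add_one_self[of "- t"] by simp
  then have "(1 - t) * exp t \<le> exp (- t) * exp t" by (intro mult_right_mono) auto
  then show ?thesis by (simp add: algebra_simps flip: exp_add)
qed

text \<open>The cost of Rankin's shift at one prime, made linear in beta * ln p. Divided by p and
  summed over primes up to w, it stays bounded as long as beta * ln w does.\<close>

lemma prime_powr_minus_one_le:
  assumes "p \<ge> 1" "real p \<le> w" "\<beta> \<ge> 0" "\<beta> * ln w \<le> B"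
  shows "real p powr \<beta> - 1 \<le> exp B * \<beta> * ln (real p)"
proof -
  define t where "t = \<beta> * ln (real p)"
  have "ln (real p) \<le> ln w" using assms by simp
  then have tB: "t \<le> B" unfolding t_def using assms(3,4) mult_left_mono by (meson order_trans)
  have t0: "t \<ge> 0" using assms by (simp add: t_def)
  have "real p powr \<beta> - 1 = exp t - 1" using assms by (simp add: powr_def t_def)
  also have "\<dots> \<le> t * exp t" by (rule exp_minus_one_le)
  also have "\<dots> \<le> t * exp B" using tB t0 by (intro mult_left_mono) auto
  finally show ?thesis by (simp add: t_def mult_ac)
qed

lemma coprime_multiplicative_powr:
  assumes "coprime_multiplicative f"
  shows "coprime_multiplicative (\<lambda>n. f n * real n powr s)"
  using assms by (simp add: coprime_multiplicative_def powr_mult mult_ac)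

lemma coprime_multiplicative_const: "coprime_multiplicative (\<lambda>_. 1)"
  by (simp add: coprime_multiplicative_def)

text \<open>Rankin's trick: integers \<open>m > w ^ 10\<close> contribute at most a fixed fraction of the Euler product over
  primes up to \<open>w\<close>.\<close>

lemma sum_squarefree_smooth_ge:
  assumes w: "w > 1" and P: "P \<subseteq> primes_upto_real w"
  shows "(\<Sum>m | m \<in> smooth_set P 1 \<and> real m \<le> w ^ 10. 1 / real m) \<ge> 1 / 2 * (\<Prod>p\<in>P. 1 + 1 / real p)"
proof -
  \<comment> \<open>This shift gains exp 10 on the tail m > w^10. It costs exp(3 * beta * 2 ln w) =
    exp 6, with 3 a bound for e, and the balance exp(-4) is below 1/2.\<close>
  define \<beta> where "\<beta> = 1 / ln w"
  have lw: "ln w > 0" using w by simp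
  have b0: "\<beta> > 0" using lw by (simp add: \<beta>_def)
  have finP: "finite P" using P finite_primes_upto_real finite_subset by blast
  have pr: "prime p" "real p \<le> w" if "p \<in> P" for p using that P by (auto simp: primes_upto_real_def)
  have p0: "p \<ge> 1" if "p \<in> P" for p using pr(1)[OF that] prime_ge_1_nat by blast
  let ?S = "smooth_set P 1"
  have finS: "finite ?S" using finite_smooth_set[OF coprime_multiplicative_const finP pr(1)] .
  have multf: "coprime_multiplicative (\<lambda>n. 1 * real n powr s)" for s :: real
    by (intro coprime_multiplicative_powr coprime_multiplicative_const)
  have m0: "m > 0" if "m \<in> ?S" for m using that by (simp add: smooth_set_def)
  have sumS: "(\<Sum>m\<in>?S. real m powr s) = (\<Prod>p\<in>P. 1 + real p powr s)" for s :: real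
    using sum_smooth_set[OF multf[of s] finP pr(1), where V = 1] by simp
  have total: "(\<Sum>m\<in>?S. 1 / real m) = (\<Prod>p\<in>P. 1 + 1 / real p)"
  proof -
    have "(\<Sum>m\<in>?S. 1 / real m) = (\<Sum>m\<in>?S. real m powr (- 1))"
      using m0 by (intro sum.cong) (auto simp: powr_minus_divide)
    also have "\<dots> = (\<Prod>p\<in>P. 1 + 1 / real p)"
      unfolding sumS using p0 by (intro prod.cong) (auto simp: powr_minus_divide)
    finally show ?thesis .
  qed
  have w10: "(w ^ 10) powr \<beta> = exp 10"
  proof -
    have "(w ^ 10) powr \<beta> = exp (\<beta> * ln (w ^ 10))" using w by (simp add: powr_def)
    also have "\<beta> * ln (w ^ 10) = 10" using w lw by (simp add: \<beta>_def ln_realpow)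
    finally show ?thesis .
  qed
  have "(\<Sum>m | m \<in> ?S \<and> \<not> real m \<le> w ^ 10. 1 / real m) \<le> (\<Sum>m | m \<in> ?S \<and> \<not> real m \<le> w ^ 10. exp (- 10) * real m powr (\<beta> - 1))"
  proof (rule sum_mono)
    fix m assume m: "m \<in> {m. m \<in> ?S \<and> \<not> real m \<le> w ^ 10}"
    then have "(w ^ 10) powr \<beta> \<le> real m powr \<beta>" using b0 w by (intro powr_mono2) auto
    then have "1 \<le> exp (- 10) * real m powr \<beta>"
      unfolding w10 by (simp add: exp_minus field_simps)
    then have "1 / real m \<le> exp (- 10) * real m powr \<beta> / real m" by (intro divide_right_mono) auto
    also have "\<dots> = exp (- 10) * real m powr (\<beta> - 1)" using m m0 by (simp add: powr_diff)
    finally show "1 / real m \<le> exp (- 10) * real m powr (\<beta> - 1)" .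
  qed
  also have "\<dots> \<le> (\<Sum>m\<in>?S. exp (- 10) * real m powr (\<beta> - 1))"
    using finS by (intro sum_mono2) auto
  also have "\<dots> = exp (- 10) * (\<Prod>p\<in>P. 1 + real p powr (\<beta> - 1))" by (simp only: sum_distrib_left[symmetric] sumS)
  also have "(\<Prod>p\<in>P. 1 + real p powr (\<beta> - 1)) \<le> (\<Prod>p\<in>P. (1 + 1 / real p) * exp (3 * \<beta> * (ln (real p) / real p)))"
  proof (rule prod_mono, intro conjI)
    fix p assume p: "p \<in> P"
    have "real p powr \<beta> - 1 \<le> exp 1 * \<beta> * ln (real p)"
      using p pr p0 b0 lw by (intro prime_powr_minus_one_le[of p w]) (auto simp: \<beta>_def)
    also have "\<dots> \<le> 3 * \<beta> * ln (real p)" using exp_le p0[OF p] b0 by (intro mult_right_mono) auto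
    finally have "(real p powr \<beta> - 1) / real p \<le> 3 * \<beta> * ln (real p) / real p" by (intro divide_right_mono) auto
    moreover define t where "t = 3 * \<beta> * (ln (real p) / real p)"
    ultimately have le: "(real p powr \<beta> - 1) / real p \<le> t" by simp
    have t0: "t \<ge> 0" using p0[OF p] b0 by (simp add: t_def)
    have "1 + real p powr (\<beta> - 1) = 1 + 1 / real p + (real p powr \<beta> - 1) / real p"
      using p0[OF p] by (simp add: powr_diff diff_divide_distrib)
    also have "\<dots> \<le> (1 + 1 / real p) * (1 + t)"
    proof -
      have "t / real p \<ge> 0" using t0 by simp
      then show ?thesis using le by (simp add: distrib_left distrib_right)
    qed
    also have "\<dots> \<le> (1 + 1 / real p) * exp t" by (intro mult_left_mono exp_ge_add_one_self) auto
    finally show "1 + real p powr (\<beta> - 1) \<le> (1 + 1 / real p) * exp (3 * \<beta> * (ln (real p) / real p))"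
      by (simp add: t_def)
  qed simp
  also have "\<dots> = (\<Prod>p\<in>P. 1 + 1 / real p) * exp (3 * \<beta> * (\<Sum>p\<in>P. ln (real p) / real p))"
    using finP by (simp add: prod.distrib exp_sum[symmetric] sum_distrib_left)
  also have "\<dots> \<le> (\<Prod>p\<in>P. 1 + 1 / real p) * exp 6"
  proof -
    have "(\<Sum>p\<in>P. ln (real p) / real p) \<le> (\<Sum>p\<in>primes_upto_real w. ln (real p) / real p)"
      using P finite_primes_upto_real prime_ge_1_nat
      by (intro sum_mono2) (auto simp: primes_upto_real_def intro!: divide_nonneg_nonneg ln_ge_zero)
    also have "\<dots> \<le> 2 * ln w" using w by (intro sum_ln_prime_div_le) auto
    finally have "3 * \<beta> * (\<Sum>p\<in>P. ln (real p) / real p) \<le> 3 * \<beta> * (2 * ln w)"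
      using b0 by (intro mult_left_mono) auto
    also have "\<dots> = 6" using lw by (simp add: \<beta>_def)
    finally show ?thesis by (intro mult_left_mono prod_nonneg) auto
  qed
  finally have "(\<Sum>m | m \<in> ?S \<and> \<not> real m \<le> w ^ 10. 1 / real m) \<le> exp (- 10) * ((\<Prod>p\<in>P. 1 + 1 / real p) * exp 6)"
    by simp
  also have "\<dots> = exp (- 4) * (\<Prod>p\<in>P. 1 + 1 / real p)"
    by (simp flip: exp_add mult.assoc)
  also have "\<dots> \<le> 1 / 2 * (\<Prod>p\<in>P. 1 + 1 / real p)"
  proof (intro mult_right_mono prod_nonneg)
    have "2 \<le> exp (4::real)" using exp_ge_add_one_self[of "4::real"] by linarith
    then show "exp (- 4) \<le> 1 / (2::real)" by (simp add: exp_minus field_simps)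
  qed auto
  finally have tail: "(\<Sum>m | m \<in> ?S \<and> \<not> real m \<le> w ^ 10. 1 / real m) \<le> 1 / 2 * (\<Prod>p\<in>P. 1 + 1 / real p)" .
  have "(\<Sum>m\<in>?S. 1 / real m) = (\<Sum>m | m \<in> ?S \<and> real m \<le> w ^ 10. 1 / real m) + (\<Sum>m | m \<in> ?S \<and> \<not> real m \<le> w ^ 10. 1 / real m)"
    using finS by (subst sum.union_disjoint[symmetric]) (auto intro!: sum.cong)
  then show ?thesis using tail total by simp
qed

text \<open>From ln(1 + t) >= t - t^2; the constant in exp 2 bounds the sum of 1 / n^2 over n >=
  1.\<close>

lemma exp_sum_inverse_le_prod:
  assumes "finite P" "0 \<notin> P"
  shows "exp (\<Sum>p\<in>P. 1 / real p) \<le> exp 2 * (\<Prod>p\<in>P. 1 + 1 / real p)"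
proof -
  have p0: "p \<ge> 1" if "p \<in> P" for p using assms that by (metis One_nat_def Suc_leI gr0I)
  have "exp (\<Sum>p\<in>P. 1 / real p) = (\<Prod>p\<in>P. exp (1 / real p))" using assms by (simp add: exp_sum)
  also have "\<dots> \<le> (\<Prod>p\<in>P. (1 + 1 / real p) * exp (1 / real p ^ 2))"
  proof (rule prod_mono, intro conjI)
    fix p assume p: "p \<in> P"
    have "1 / real p - (1 / real p) ^ 2 \<le> ln (1 + 1 / real p)"
      using p0[OF p] by (intro ln_one_plus_pos_lower_bound) auto
    then have "exp (1 / real p) \<le> exp (ln (1 + 1 / real p) + 1 / real p ^ 2)" by (simp add: power_one_over)
    also have "\<dots> = (1 + 1 / real p) * exp (1 / real p ^ 2)"
      using p0[OF p] by (simp add: exp_add add_pos_nonneg)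
    finally show "exp (1 / real p) \<le> (1 + 1 / real p) * exp (1 / real p ^ 2)" .
  qed simp
  also have "\<dots> = (\<Prod>p\<in>P. 1 + 1 / real p) * exp (\<Sum>p\<in>P. 1 / real p ^ 2)"
    using assms by (simp add: prod.distrib exp_sum)
  also have "\<dots> \<le> (\<Prod>p\<in>P. 1 + 1 / real p) * exp 2"
  proof -
    define n where "n = Max (insert 1 P)"
    have "(\<Sum>p\<in>P. 1 / real p ^ 2) \<le> (\<Sum>p\<in>{1..n}. 1 / real p ^ 2)"
      using assms p0 by (intro sum_mono2) (auto simp: n_def)
    also have "{1..n} = insert 1 {1<..n}" using assms by (auto simp: n_def)
    also have "(\<Sum>p\<in>\<dots>. 1 / real p ^ 2) = 1 + (\<Sum>p\<in>{1<..n}. 1 / real p ^ 2)" by simp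
    also have "\<dots> \<le> 2" using sum_inverse_squares_tail[of 1 n] by simp
    finally have "(\<Sum>p\<in>P. 1 / real p ^ 2) \<le> 2" .
    then show ?thesis by (intro mult_left_mono prod_nonneg) auto
  qed
  finally show ?thesis by (simp add: mult.commute)
qed

lemma rho_1: "rho A 1 = 1"
  by (simp add: rho_def crt_set_1[simplified])

text \<open>Nothing forces \<open>A (p ^ v)\<close> to be nonempty for v >= 2, so membership in
  \<open>Q_set A\<close> is certified for squarefree m only.\<close>

lemma rho_squarefree_smooth:
  assumes "finite P" "\<And>p. p \<in> P \<Longrightarrow> prime p \<and> rho A p \<ge> 1" "m \<in> smooth_set P 1"
  shows "rho A m \<ge> 1"
  using assms
proof (induction P arbitrary: m rule: finite_induct)
  case empty
  then show ?case using rho_1 by (simp add: smooth_set_empty)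
next
  case (insert p P)
  have p: "prime p" "p \<notin> P" "rho A p \<ge> 1" using insert by auto
  obtain n v where n: "n \<in> smooth_set P 1" "v \<le> 1" "m = n * p ^ v"
  proof -
    have "m \<in> (\<lambda>(n, v). n * p ^ v) ` (smooth_set P 1 \<times> {..1})"
      using bij_betw_imp_surj_on[OF smooth_set_insert[OF p(1,2), of 1]] insert.prems(2) by blast
    then show ?thesis using that by auto
  qed
  have "rho A n \<ge> 1" using insert n by auto
  moreover have "rho A (p ^ v) \<ge> 1" using n(2) p rho_1 by (cases v) auto
  moreover have "rho A m = rho A n * rho A (p ^ v)"
    unfolding n(3) using n(1) p smooth_set_coprime[OF n(1) p(1,2)] prime_gt_0_nat[OF p(1)]
    by (intro rho_mult) (auto simp: smooth_set_def Suc_le_eq)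
  ultimately show ?case by simp
qed

lemma finite_Q_upto: "finite (Q_upto A x)"
  unfolding Q_upto_def by (rule finite_nat_real_le)

text \<open>Weighting each \<open>q\<close> by \<open>ln q\<close> and writing \<open>q = m p\<close> brings in the lower bound for
  the primes with \<open>\<rho>(p) \<ge> 1\<close>, and with it the factor \<open>\<alpha>\<close>.\<close>

lemma card_Q_upto_ge_sum:
  assumes hyp: "\<And>y. y \<ge> x0 \<Longrightarrow> (\<Sum>p | prime p \<and> real p \<le> y \<and> rho A p \<ge> 1. ln (real p)) \<ge> \<alpha> * y"
    and x: "x > 1" "sqrt x \<ge> x0" "ln x \<le> \<alpha> * sqrt x" and \<alpha>: "\<alpha> > 0"
    and P: "finite P" "\<And>p. p \<in> P \<Longrightarrow> prime p \<and> rho A p \<ge> 1"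
  shows "real (card (Q_upto A x)) * ln x \<ge> \<alpha> * x / 2 * (\<Sum>m | m \<in> smooth_set P 1 \<and> real m \<le> sqrt x. 1 / real m)"
proof -
  \<comment> \<open>For m <= sqrt x the range x / m of the cofactor prime is at least sqrt x >= x0,
    where the hypothesis on primes applies.\<close>
  let ?M = "{m. m \<in> smooth_set P 1 \<and> real m \<le> sqrt x}"
  let ?R = "\<lambda>m. {p. prime p \<and> real p \<le> x / real m \<and> rho A p \<ge> 1 \<and> \<not> p dvd m}"
  have finM: "finite ?M" by (rule finite_nat_real_le)
  have finR: "finite (?R m)" for m
    by (rule finite_subset[OF _ finite_primes_upto_real[of "x / real m"]]) (auto simp: primes_upto_real_def)
  have m0: "m > 0" if "m \<in> ?M" for m using that by (simp add: smooth_set_def)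
  have sx: "sqrt x * sqrt x = x" "sqrt x > 0" using x by auto
  have inner: "\<alpha> * x / 2 * (1 / real m) \<le> (\<Sum>p\<in>?R m. ln (real p))" if m: "m \<in> ?M" for m
  proof -
    have m1: "real m > 0" "real m \<le> sqrt x" using m m0 by auto
    have "sqrt x * real m \<le> x" using sx m1 mult_left_mono[of "real m" "sqrt x" "sqrt x"] by simp
    then have xm: "sqrt x \<le> x / real m" using m1 by (simp add: pos_le_divide_eq)
    let ?T = "{p. prime p \<and> real p \<le> x / real m \<and> rho A p \<ge> 1}"
    have finT: "finite ?T"
      by (rule finite_subset[OF _ finite_primes_upto_real[of "x / real m"]]) (auto simp: primes_upto_real_def)
    have "\<alpha> * (x / real m) \<le> (\<Sum>p\<in>?T. ln (real p))" using xm x by (intro hyp) auto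
    also have "\<dots> = (\<Sum>p\<in>?R m. ln (real p)) + (\<Sum>p | p \<in> ?T \<and> p dvd m. ln (real p))"
      using finT finite_subset[of "{p. p \<in> ?T \<and> p dvd m}" ?T] finite_subset[of "?R m" ?T]
      by (subst sum.union_disjoint[symmetric]) (auto intro!: sum.cong)
    \<comment> \<open>Primes dividing m are excluded so that m and p are coprime. They cost at most
      ln m <= ln x / 2, which half of alpha * x / m absorbs.\<close>
    also have "(\<Sum>p | p \<in> ?T \<and> p dvd m. ln (real p)) \<le> ln (real m)"
      using finT m0[OF m] by (intro sum_ln_prime_divisors_le) auto
    also have "ln (real m) \<le> ln (sqrt x)" using m1 by (intro ln_mono)
    also have "ln (sqrt x) = ln x / 2" using x by (simp add: ln_sqrt)
    finally have "\<alpha> * (x / real m) \<le> (\<Sum>p\<in>?R m. ln (real p)) + ln x / 2" by simp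
    moreover have "ln x \<le> \<alpha> * (x / real m)"
      using x(3) mult_left_mono[OF xm, of \<alpha>] \<alpha> by linarith
    ultimately show ?thesis by simp
  qed
  let ?B = "SIGMA m:?M. ?R m"
  \<comment> \<open>A modulus may arise from several pairs. Keeping p in the image restores
    injectivity, and over one q the weights ln p of its distinct primes still sum to at most ln
    q.\<close>
  let ?f = "\<lambda>(m, p). (m * p, p)"
  have inj: "inj_on ?f ?B" by (auto simp: inj_on_def dest: prime_gt_0_nat)
  have "\<alpha> * x / 2 * (\<Sum>m\<in>?M. 1 / real m) \<le> (\<Sum>m\<in>?M. \<Sum>p\<in>?R m. ln (real p))"
    unfolding sum_distrib_left by (intro sum_mono inner)
  also have "\<dots> = (\<Sum>(m, p)\<in>?B. ln (real p))" using finM finR by (subst sum.Sigma) auto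
  also have "\<dots> = (\<Sum>(q, p)\<in>?f ` ?B. ln (real p))"
    by (subst sum.reindex[OF inj]) (simp add: case_prod_beta comp_def)
  also have "\<dots> \<le> (\<Sum>(q, p)\<in>(SIGMA q:Q_upto A x. prime_factors q). ln (real p))"
  proof (rule sum_mono2)
    show "finite (SIGMA q:Q_upto A x. prime_factors q)" using finite_Q_upto by auto
    show "?f ` ?B \<subseteq> (SIGMA q:Q_upto A x. prime_factors q)"
    proof clarify
      fix m p assume m: "m \<in> smooth_set P 1" "real m \<le> sqrt x"
        and p: "prime p" "real p \<le> x / real m" "rho A p \<ge> 1" "\<not> p dvd m"
      have m0: "m > 0" and p0: "p > 0" using m p prime_gt_0_nat by (auto simp: smooth_set_def)
      have "rho A (m * p) = rho A m * rho A p"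
        using m0 p0 prime_imp_coprime[OF p(1,4)] by (intro rho_mult) (auto simp: coprime_commute)
      then have "rho A (m * p) \<ge> 1" using rho_squarefree_smooth[OF P m(1)] p by simp
      moreover have "real (m * p) \<le> x" using p(2) m0 by (simp add: pos_le_divide_eq mult.commute)
      ultimately show "m * p \<in> Q_upto A x \<and> p \<in> prime_factors (m * p)"
        using m0 p0 p(1) by (auto simp: Q_upto_def Q_set_def prime_factors_dvd Suc_le_eq)
    qed
  qed (auto simp: case_prod_beta dest!: in_prime_factors_imp_prime prime_ge_1_nat)
  also have "\<dots> = (\<Sum>q\<in>Q_upto A x. \<Sum>p\<in>prime_factors q. ln (real p))"
    using finite_Q_upto by (subst sum.Sigma) auto
  also have "\<dots> \<le> (\<Sum>q\<in>Q_upto A x. ln x)"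
  proof (rule sum_mono)
    fix q assume q: "q \<in> Q_upto A x"
    then have q0: "q > 0" "real q \<le> x" by (auto simp: Q_upto_def Q_set_def)
    have "(\<Sum>p\<in>prime_factors q. ln (real p)) \<le> ln (real q)"
      using q0 by (intro sum_ln_prime_divisors_le) auto
    also have "\<dots> \<le> ln x" using q0 by simp
    finally show "(\<Sum>p\<in>prime_factors q. ln (real p)) \<le> ln x" .
  qed
  finally show ?thesis by simp
qed

definition family_primes :: "(nat \<Rightarrow> nat set) \<Rightarrow> nat \<Rightarrow> real \<Rightarrow> nat set" where
  "family_primes A k x = {p. prime p \<and> real p \<le> x \<and> rho A p \<ge> k}"

lemma family_primes_subset: "family_primes A k x \<subseteq> primes_upto_real x"
  by (auto simp: family_primes_def primes_upto_real_def)

lemma finite_family_primes: "finite (family_primes A k x)"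
  using family_primes_subset finite_primes_upto_real by (rule finite_subset)

text \<open>With w = x^(1/20) the Rankin cut w^10 is exactly sqrt x. The primes in (w, x] add at
  most 2 * 20 = 40 to the sum of reciprocals, and passing from the exponential to the product adds
  2: hence the constant 42.\<close>

lemma card_Q_upto_ge:
  assumes hyp: "\<And>y. y \<ge> x0 \<Longrightarrow> (\<Sum>p | prime p \<and> real p \<le> y \<and> rho A p \<ge> 1. ln (real p)) \<ge> \<alpha> * y"
    and x: "x > 1" "sqrt x \<ge> x0" "ln x \<le> \<alpha> * sqrt x" and \<alpha>: "\<alpha> > 0"
  shows "real (card (Q_upto A x)) \<ge> \<alpha> * exp (- 42) / 4 * (x / ln x) * exp (\<Sum>p\<in>family_primes A 1 x. 1 / real p)"
proof -
  define w where "w = x powr (1 / 20)"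
  have w: "w > 1" using x by (simp add: w_def)
  have w10: "w ^ 10 = sqrt x"
  proof -
    have "w ^ 10 = x powr (1 / 20 * real 10)" unfolding w_def using x by (subst powr_powr[symmetric]) (simp add: powr_realpow)
    then show ?thesis using x by (simp add: powr_half_sqrt)
  qed
  let ?P = "family_primes A 1 w"
  have finP: "finite ?P" by (rule finite_family_primes)
  have "family_primes A 1 x = ?P \<union> {p \<in> family_primes A 1 x. w < real p}"
  proof -
    have "w \<le> x" using x powr_mono[of "1 / 20" 1 x] by (simp add: w_def)
    then show ?thesis by (auto simp: family_primes_def)
  qed
  moreover have "sum g (?P \<union> {p \<in> family_primes A 1 x. w < real p}) = sum g ?P + sum g {p \<in> family_primes A 1 x. w < real p}"
    for g :: "nat \<Rightarrow> real"
    using finP finite_family_primes[of A 1 x] finite_subset[of "{p \<in> family_primes A 1 x. w < real p}" "family_primes A 1 x"]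
    by (intro sum.union_disjoint) (auto simp: family_primes_def)
  ultimately have "(\<Sum>p\<in>family_primes A 1 x. 1 / real p) \<le> (\<Sum>p\<in>?P. 1 / real p) + (\<Sum>p | p \<in> family_primes A 1 x \<and> w < real p. 1 / real p)"
    by (metis order_refl)
  also have "(\<Sum>p | p \<in> family_primes A 1 x \<and> w < real p. 1 / real p) \<le> 2 * ln x / ln w"
    using w x family_primes_subset by (intro sum_inverse_primes_interval) auto
  also have "2 * ln x / ln w = 40" using x by (simp add: w_def ln_powr)
  finally have "exp (\<Sum>p\<in>family_primes A 1 x. 1 / real p) \<le> exp 40 * exp (\<Sum>p\<in>?P. 1 / real p)"
    by (simp flip: exp_add)
  also have "\<dots> \<le> exp 40 * (exp 2 * (\<Prod>p\<in>?P. 1 + 1 / real p))"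
    using finP by (intro mult_left_mono exp_sum_inverse_le_prod) (auto simp: family_primes_def)
  also have "\<dots> \<le> exp 40 * (exp 2 * (2 * (\<Sum>m | m \<in> smooth_set ?P 1 \<and> real m \<le> w ^ 10. 1 / real m)))"
    using sum_squarefree_smooth_ge[OF w family_primes_subset, of A 1] by (intro mult_left_mono) auto
  also have "\<dots> = 2 * exp 42 * (\<Sum>m | m \<in> smooth_set ?P 1 \<and> real m \<le> sqrt x. 1 / real m)"
    by (simp add: w10 flip: exp_add mult.assoc)
  finally have E: "exp (\<Sum>p\<in>family_primes A 1 x. 1 / real p) \<le> 2 * exp 42 * (\<Sum>m | m \<in> smooth_set ?P 1 \<and> real m \<le> sqrt x. 1 / real m)" .
  have lx: "ln x > 0" using x by simp
  have "\<alpha> * exp (- 42) / 4 * x * exp (\<Sum>p\<in>family_primes A 1 x. 1 / real p)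
    \<le> \<alpha> * exp (- 42) / 4 * x * (2 * exp 42 * (\<Sum>m | m \<in> smooth_set ?P 1 \<and> real m \<le> sqrt x. 1 / real m))"
    using \<alpha> x by (intro mult_left_mono E) auto
  also have "\<dots> = \<alpha> * x / 2 * (\<Sum>m | m \<in> smooth_set ?P 1 \<and> real m \<le> sqrt x. 1 / real m)"
    by (simp add: exp_minus field_simps)
  also have "\<dots> \<le> real (card (Q_upto A x)) * ln x"
    by (rule card_Q_upto_ge_sum[OF hyp x \<alpha> finP]) (auto simp: family_primes_def)
  finally show ?thesis using lx by (simp add: field_simps)
qed

section \<open>Rankin's trick for multiplicative functions with values in [0, 1]\<close>

definition rankin_const :: real where
  "rankin_const = 3 * (\<Sum>n. real n powr (- 3 / 2))"

lemma sum_powr_three_halves_le: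
  assumes "finite P" shows "3 * (\<Sum>p\<in>P. real p powr (- 3 / 2)) \<le> rankin_const"
proof -
  have "summable (\<lambda>n. real n powr (- 3 / 2))" by (simp add: summable_real_powr_iff)
  then have "(\<Sum>p\<in>P. real p powr (- 3 / 2)) \<le> (\<Sum>n. real n powr (- 3 / 2))"
    using assms by (intro sum_le_suminf) auto
  then show ?thesis by (simp add: rankin_const_def)
qed

text \<open>Only the value at the prime itself is kept. For v >= 2 the bounds f <= 1 and beta <= 1/4
  give terms at most r^v with r = p^(-3/4), and their sum is at most 3 r^2 = 3 p^(-3/2). These add
  up over all primes to at most \<open>rankin_const\<close>.\<close>

lemma rankin_local_factor_le:
  fixes f :: "nat \<Rightarrow> real"
  assumes f: "f 1 = 1" "\<And>n. 0 \<le> f n" "\<And>n. f n \<le> 1" and p: "prime p" "real p \<le> w"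
    and \<beta>: "0 \<le> \<beta>" "\<beta> \<le> 1 / 4" "\<beta> * ln w \<le> B"
  shows "(\<Sum>v\<le>V. f (p ^ v) * real (p ^ v) powr (\<beta> - 1))
    \<le> exp (f p / real p + exp B * \<beta> * (ln (real p) / real p) + 3 * real p powr (- 3 / 2))"
proof -
  let ?g = "\<lambda>v. f (p ^ v) * real (p ^ v) powr (\<beta> - 1)"
  have p2: "real p \<ge> 2" and p1: "p \<ge> 1" using prime_ge_2_nat[OF p(1)] by auto
  have g0: "?g v \<ge> 0" for v using f by simp
  define r where "r = real p powr (- 3 / 4)"
  have r0: "r > 0" using p2 by (simp add: r_def)
  \<comment> \<open>The fourth power reduces this to 1/8 <= 16/81; then 1 / (1 - r) <= 3.\<close>
  have r1: "r \<le> 2 / 3"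
  proof -
    have "r ^ 4 = real p powr (- 3)" using p2 by (simp add: r_def powr_powr flip: powr_realpow)
    also have "\<dots> \<le> 2 powr (- 3)" using p2 by (intro powr_mono2') auto
    also have "\<dots> = 1 / 8" by (simp add: powr_minus_divide)
    also have "\<dots> \<le> (2 / 3) ^ 4" by (simp add: power_divide)
    finally show ?thesis using r0 power_mono_iff[of r "2 / 3" 4] by simp
  qed
  have gv: "?g v \<le> r ^ v" for v
  proof -
    have "real (p ^ v) powr (\<beta> - 1) \<le> real (p ^ v) powr (- 3 / 4)"
      using \<beta> p1 by (intro powr_mono) auto
    also have "\<dots> = r ^ v" using p2 by (simp add: r_def powr_powr mult.commute flip: powr_realpow)
    finally have "?g v \<le> 1 * r ^ v" using f g0 by (intro mult_mono) auto
    then show ?thesis by simp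
  qed
  have "(\<Sum>v\<in>{2..V}. ?g v) \<le> (\<Sum>v\<in>{2..V}. r ^ v)" by (intro sum_mono gv)
  also have "\<dots> \<le> 3 * r ^ 2"
  proof (cases "V \<ge> 2")
    case True
    have "(1 - r) * (\<Sum>v\<in>{2..V}. r ^ v) = r ^ 2 - r ^ Suc V" using True by (rule sum_gp_multiplied)
    also have "\<dots> \<le> r ^ 2" using r0 by simp
    finally have "(1 - r) * (\<Sum>v\<in>{2..V}. r ^ v) \<le> r ^ 2" .
    moreover have "1 / 3 * (\<Sum>v\<in>{2..V}. r ^ v) \<le> (1 - r) * (\<Sum>v\<in>{2..V}. r ^ v)"
      using r0 r1 by (intro mult_right_mono sum_nonneg) auto
    ultimately show ?thesis by simp
  qed simp
  also have "r ^ 2 = real p powr (- 3 / 2)" using p2 by (simp add: r_def powr_powr flip: powr_realpow)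
  finally have hi: "(\<Sum>v\<in>{2..V}. ?g v) \<le> 3 * real p powr (- 3 / 2)" .
  have "(\<Sum>v\<le>V. ?g v) \<le> (\<Sum>v\<in>{0, 1} \<union> {2..V}. ?g v)"
    using g0 by (intro sum_mono2) auto
  also have "\<dots> = ?g 0 + ?g 1 + (\<Sum>v\<in>{2..V}. ?g v)" by (subst sum.union_disjoint) auto
  also have "?g 0 = 1" using f by simp
  also have "?g 1 \<le> f p / real p + exp B * \<beta> * (ln (real p) / real p)"
  proof -
    have "?g 1 = f p * (real p powr \<beta>) / real p" using p2 by (simp add: powr_diff)
    also have "\<dots> = f p / real p + f p * (real p powr \<beta> - 1) / real p"
      by (simp add: algebra_simps diff_divide_distrib)
    also have "f p * (real p powr \<beta> - 1) \<le> 1 * (exp B * \<beta> * ln (real p))"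
    proof (rule mult_mono)
      show "real p powr \<beta> - 1 \<le> exp B * \<beta> * ln (real p)"
        using p p1 \<beta> by (intro prime_powr_minus_one_le) auto
      show "0 \<le> real p powr \<beta> - 1" using p2 \<beta> by (simp add: ge_one_powr_ge_zero)
    qed (use f in auto)
    finally show ?thesis by (simp add: divide_right_mono)
  qed
  finally have "(\<Sum>v\<le>V. ?g v) \<le> 1 + (f p / real p + exp B * \<beta> * (ln (real p) / real p) + 3 * real p powr (- 3 / 2))"
    using hi by simp
  also have "\<dots> \<le> exp (f p / real p + exp B * \<beta> * (ln (real p) / real p) + 3 * real p powr (- 3 / 2))"
    by (rule exp_ge_add_one_self)
  finally show ?thesis .
qed

text \<open>The total cost of the shift, exp(2 * exp B * B), depends only on the bound B for beta *
  ln w. This uniformity in w permits a different shift for every \<open>k\<close>.\<close>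

lemma rankin_bound:
  fixes f :: "nat \<Rightarrow> real"
  assumes f: "coprime_multiplicative f" "\<And>n. 0 \<le> f n" "\<And>n. f n \<le> 1"
    and \<beta>: "0 \<le> \<beta>" "\<beta> \<le> 1 / 4" "\<beta> * ln w \<le> B" and w: "w \<ge> 1"
    and S: "finite S" "\<And>n. n \<in> S \<Longrightarrow> n > 0" "\<And>n p. n \<in> S \<Longrightarrow> prime p \<Longrightarrow> p dvd n \<Longrightarrow> real p \<le> w"
  shows "(\<Sum>n\<in>S. f n * real n powr (\<beta> - 1))
    \<le> exp ((\<Sum>p\<in>primes_upto_real w. f p / real p) + 2 * exp B * B + rankin_const)"
proof -
  let ?P = "primes_upto_real w" and ?g = "\<lambda>n. f n * real n powr (\<beta> - 1)"
  define V where "V = Max (insert 1 S)"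
  have f1: "f 1 = 1" using f(1) by (simp add: coprime_multiplicative_def)
  have "(\<Sum>n\<in>S. ?g n) \<le> (\<Prod>p\<in>?P. \<Sum>v\<le>V. ?g (p ^ v))"
  proof (rule sum_le_euler_product)
    show "coprime_multiplicative ?g" by (rule coprime_multiplicative_powr) fact
    show "S \<subseteq> {1..V}" using S by (auto simp: V_def Suc_le_eq)
  qed (use f S finite_primes_upto_real in \<open>auto simp: primes_upto_real_def\<close>)
  also have "\<dots> \<le> (\<Prod>p\<in>?P. exp (f p / real p + exp B * \<beta> * (ln (real p) / real p) + 3 * real p powr (- 3 / 2)))"
    using f f1 \<beta> by (intro prod_mono conjI sum_nonneg rankin_local_factor_le[of f _ w]) (auto simp: primes_upto_real_def)
  also have "\<dots> = exp (\<Sum>p\<in>?P. f p / real p + exp B * \<beta> * (ln (real p) / real p) + 3 * real p powr (- 3 / 2))"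
    using finite_primes_upto_real by (simp add: exp_sum)
  also have "\<dots> \<le> exp ((\<Sum>p\<in>?P. f p / real p) + 2 * exp B * B + rankin_const)"
  proof -
    have "exp B * \<beta> * (\<Sum>p\<in>?P. ln (real p) / real p) \<le> exp B * \<beta> * (2 * ln w)"
      using \<beta> w by (intro mult_left_mono sum_ln_prime_div_le) auto
    also have "\<dots> = 2 * exp B * (\<beta> * ln w)" by simp
    also have "\<dots> \<le> 2 * exp B * B" using \<beta> by (intro mult_left_mono) auto
    finally have "exp B * \<beta> * (\<Sum>p\<in>?P. ln (real p) / real p) \<le> 2 * exp B * B" .
    then show ?thesis
      using sum_powr_three_halves_le[OF finite_primes_upto_real, of w]
      by (simp only: sum.distrib sum_distrib_left[symmetric] exp_le_cancel_iff)
  qed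
  finally show ?thesis .
qed

section \<open>Splitting moduli into smooth and rough parts\<close>

lemma prime_dvd_prod_powers:
  fixes r :: nat
  assumes "finite P" "\<And>p. p \<in> P \<Longrightarrow> prime p" "prime r" "r dvd (\<Prod>p\<in>P. p ^ e p)"
  shows "r \<in> P"
proof -
  obtain p where p: "p \<in> P" "r dvd p ^ e p"
    using assms by (auto simp: prime_dvd_prod_iff)
  then have "r dvd p" using assms(3) prime_dvd_power by blast
  then show ?thesis using assms p primes_dvd_imp_eq by blast
qed

text \<open>Multiply the prime-power components of q in increasing order of the primes; p is the
  prime whose component first carries the product beyond y.\<close>

lemma smooth_rough_crossing:
  fixes q :: nat
  assumes y: "1 \<le> y" "y < real q"
  obtains u p v r where "q = u * (p ^ v * r)" "prime p" "v \<ge> 1" "real u \<le> y" "y < real (u * p ^ v)"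
    "\<And>l. prime l \<Longrightarrow> l dvd u \<Longrightarrow> l < p" "\<And>l. prime l \<Longrightarrow> l dvd r \<Longrightarrow> p < l"
proof -
  define s where "s = (\<lambda>t. \<Prod>p\<in>{p \<in> prime_factors q. p < t}. p ^ multiplicity p q)"
  have q0: "q > 0" using y by (cases q) auto
  have sq: "s (Suc q) = q"
  proof -
    have "{p \<in> prime_factors q. p < Suc q} = prime_factors q"
      using q0 by (auto simp: prime_factors_dvd less_Suc_eq_le intro: dvd_imp_le)
    then show ?thesis unfolding s_def using prime_factorization_nat[of q] q0 by simp
  qed
  \<comment> \<open>s t collects the components of primes below t. The least t beyond the threshold
    is a successor because s 0 = 1 <= y, and its predecessor is p.\<close>
  define t where "t = (LEAST t. y < real (s t))"
  have t: "y < real (s t)" unfolding t_def by (rule LeastI[of _ "Suc q"]) (use sq y in simp)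
  have least: "\<not> y < real (s t')" if "t' < t" for t' using that not_less_Least unfolding t_def by blast
  have "s 0 = 1" by (simp add: s_def)
  then have "t \<noteq> 0" using t y by (metis not_less of_nat_1)
  then obtain p where tp: "t = Suc p" using not0_implies_Suc by blast
  have sp: "real (s p) \<le> y" using least[of p] tp by simp
  have pf: "p \<in> prime_factors q"
  proof (rule ccontr)
    assume "p \<notin> prime_factors q"
    then have "{l \<in> prime_factors q. l < Suc p} = {l \<in> prime_factors q. l < p}"
      by (auto simp: less_Suc_eq)
    then have "s t = s p" by (simp add: s_def tp)
    then show False using t sp by simp
  qed
  define v where "v = multiplicity p q"
  define r where "r = (\<Prod>l\<in>{l \<in> prime_factors q. p < l}. l ^ multiplicity l q)"
  have "{l \<in> prime_factors q. l < Suc p} = insert p {l \<in> prime_factors q. l < p}"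
    using pf by auto
  then have st: "s t = s p * p ^ v" by (simp add: s_def tp v_def)
  have "q = (\<Prod>l\<in>prime_factors q. l ^ multiplicity l q)" using prime_factorization_nat[of q] q0 by simp
  also have "prime_factors q = {l \<in> prime_factors q. l < Suc p} \<union> {l \<in> prime_factors q. p < l}" by auto
  also have "(\<Prod>l\<in>\<dots>. l ^ multiplicity l q) = s t * r"
    unfolding s_def r_def tp by (rule prod.union_disjoint) auto
  finally have "q = s p * (p ^ v * r)" using st by simp
  moreover have "prime p" using pf by auto
  moreover have "v \<ge> 1" using pf q0 unfolding v_def
    by (auto simp: prime_factors_multiplicity)
  moreover have "l < p" if "prime l" "l dvd s p" for l
    using prime_dvd_prod_powers[of "{l \<in> prime_factors q. l < p}" l "\<lambda>l. multiplicity l q"] that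
    by (auto simp: s_def)
  moreover have "p < l" if "prime l" "l dvd r" for l
    using prime_dvd_prod_powers[of "{l \<in> prime_factors q. p < l}" l "\<lambda>l. multiplicity l q"] that
    by (auto simp: r_def)
  ultimately show ?thesis using that[of "s p" p v r] sp t st by metis
qed

text \<open>Each clause removes one obstruction: small q have no crossing at x^(1/3); a large square
  divisor would permit a crossing component p^v > x^(1/6) with v >= 2; a large divisor made of
  primes up to exp 24 would permit k > ln x / 24, where the shift 6k / ln x exceeds 1/4.\<close>

definition exceptional :: "real \<Rightarrow> nat set" where
  "exceptional x = {q. q \<ge> 1 \<and> real q \<le> x \<and> (real q \<le> x powr (1 / 3)
     \<or> (\<exists>m. m\<^sup>2 dvd q \<and> real m > x powr (1 / 18))
     \<or> (\<exists>u. u dvd q \<and> real u > x powr (1 / 6) \<and> (\<forall>p. prime p \<longrightarrow> p dvd u \<longrightarrow> real p \<le> exp 24)))}"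

text \<open>The value of \<open>rankin_bound\<close> for f = 1, w = exp 24 and beta = 1/4, so that B
  = 24 / 4 = 6.\<close>

definition smooth_const :: real where
  "smooth_const = exp ((\<Sum>p\<in>primes_upto_real (exp 24). 1 / real p) + 2 * exp 6 * 6 + rankin_const)"

lemma card_multiples_real_le:
  assumes "d \<ge> 1" "x \<ge> 0" shows "real (card {q. q \<ge> 1 \<and> real q \<le> x \<and> d dvd q}) \<le> x / real d"
proof -
  have "{q. q \<ge> 1 \<and> real q \<le> x \<and> d dvd q} = {q \<in> {1..nat \<lfloor>x\<rfloor>}. d dvd q}"
    using assms by (auto simp: le_nat_iff le_floor_iff)
  then have "card {q. q \<ge> 1 \<and> real q \<le> x \<and> d dvd q} = nat \<lfloor>x\<rfloor> div d"
    using card_multiples[of d "nat \<lfloor>x\<rfloor>"] assms by simp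
  then have "real (card {q. q \<ge> 1 \<and> real q \<le> x \<and> d dvd q}) \<le> real (nat \<lfloor>x\<rfloor>) / real d"
    by (simp add: of_nat_div_le_of_nat)
  also have "\<dots> \<le> x / real d" using assms by (intro divide_right_mono) auto
  finally show ?thesis .
qed

text \<open>The three clauses contribute x^(1/3), then x times the tail of 1 / m^2 beyond x^(1/18),
  of order x^(17/18), and by Rankin's trick x divided by (x^(1/6))^(1/4) = x^(1/24). The last one
  dominates.\<close>

lemma card_exceptional_le:
  assumes x: "x \<ge> 1"
  shows "real (card (exceptional x)) \<le> (3 + smooth_const) * x powr (23 / 24)"
proof -
  let ?E1 = "{q. q \<ge> 1 \<and> real q \<le> x powr (1 / 3)}"
  define M where "M = {m::nat. m \<ge> 1 \<and> x powr (1 / 18) < real m \<and> real m \<le> x}"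
  define U where "U = {u::nat. u \<ge> 1 \<and> (x powr (1 / 6) < real u \<and> (\<forall>p. prime p \<longrightarrow> p dvd u \<longrightarrow> real p \<le> exp 24)) \<and> real u \<le> x}"
  let ?mult = "\<lambda>d. {q. q \<ge> 1 \<and> real q \<le> x \<and> d dvd q}"
  have fin: "finite M" "finite U" "finite ?E1" unfolding M_def U_def
    by (rule finite_subset[OF _ finite_nat_real_le[of "\<lambda>_. True"]]; blast)+
  have finmult: "finite (?mult d)" for d
    by (rule finite_subset[OF _ finite_nat_real_le[of "\<lambda>_. True"]]) auto
  have sub: "exceptional x \<subseteq> ?E1 \<union> ((\<Union>m\<in>M. ?mult (m\<^sup>2)) \<union> (\<Union>u\<in>U. ?mult u))"
  proof
    fix q assume q: "q \<in> exceptional x"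
    then have q1: "q \<ge> 1" "real q \<le> x" by (auto simp: exceptional_def)
    consider "real q \<le> x powr (1 / 3)" | m where "m\<^sup>2 dvd q" "real m > x powr (1 / 18)"
      | u where "u dvd q" "real u > x powr (1 / 6)" "\<forall>p. prime p \<longrightarrow> p dvd u \<longrightarrow> real p \<le> exp 24"
      using q unfolding exceptional_def by blast
    then show "q \<in> ?E1 \<union> ((\<Union>m\<in>M. ?mult (m\<^sup>2)) \<union> (\<Union>u\<in>U. ?mult u))"
    proof cases
      case (2 m)
      have "real m > 0" using 2(2) by (meson le_less_trans powr_ge_zero)
      then have m1: "m \<ge> 1" by simp
      have "m \<le> m\<^sup>2" using m1 by (simp add: power2_eq_square)
      also have "\<dots> \<le> q" using 2(1) q1 by (intro dvd_imp_le) auto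
      finally have "real m \<le> x" using q1 by linarith
      then have "m \<in> M" using 2 m1 by (simp add: M_def)
      then show ?thesis using 2 q1 by blast
    next
      case (3 u)
      have "u \<le> q" using 3(1) q1 by (intro dvd_imp_le) auto
      then have "real u \<le> x" using q1 by linarith
      moreover have "u \<ge> 1" using 3(1) q1 by (cases u) auto
      ultimately have "u \<in> U" using 3 by (auto simp: U_def)
      then show ?thesis using 3 q1 by blast
    qed (use q1 in auto)
  qed
  have x0: "x > 0" using x by simp
  have "card (exceptional x) \<le> card (?E1 \<union> ((\<Union>m\<in>M. ?mult (m\<^sup>2)) \<union> (\<Union>u\<in>U. ?mult u)))"
    using fin finmult by (intro card_mono sub) auto
  also have "\<dots> \<le> card ?E1 + (card (\<Union>m\<in>M. ?mult (m\<^sup>2)) + card (\<Union>u\<in>U. ?mult u))"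
    by (intro order_trans[OF card_Un_le] add_left_mono card_Un_le)
  also have "\<dots> \<le> card ?E1 + ((\<Sum>m\<in>M. card (?mult (m\<^sup>2))) + (\<Sum>u\<in>U. card (?mult u)))"
    using fin by (intro add_mono card_UN_le) auto
  finally have "real (card (exceptional x)) \<le> real (card ?E1) + ((\<Sum>m\<in>M. real (card (?mult (m\<^sup>2)))) + (\<Sum>u\<in>U. real (card (?mult u))))"
    by (simp only: of_nat_sum[symmetric] of_nat_add[symmetric] of_nat_le_iff)
  also have "real (card ?E1) \<le> 1 * x powr (23 / 24)"
  proof -
    have "{q. q \<ge> 1 \<and> real q \<le> x powr (1 / 3)} = {q. q \<ge> 1 \<and> real q \<le> x powr (1 / 3) \<and> 1 dvd q}" by simp
    then have "real (card ?E1) \<le> x powr (1 / 3)"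
      using card_multiples_real_le[of 1 "x powr (1 / 3)"] by simp
    also have "\<dots> \<le> x powr (23 / 24)" using x by (intro powr_mono) auto
    finally show ?thesis by simp
  qed
  also have "(\<Sum>m\<in>M. real (card (?mult (m\<^sup>2)))) \<le> 2 * x powr (23 / 24)"
  proof -
    define H where "H = nat \<lfloor>x powr (1 / 18)\<rfloor>"
    have xp: "x powr (1 / 18) \<ge> 1" using x by (simp add: ge_one_powr_ge_zero)
    have "real H > x powr (1 / 18) - 1" using xp unfolding H_def by linarith
    moreover have H1: "H \<ge> 1" using xp unfolding H_def by (simp add: le_nat_iff)
    moreover have "real H \<ge> 1" using H1 by simp
    ultimately have H: "H \<ge> 1" "real H \<ge> x powr (1 / 18) / 2" by linarith+
    have "(\<Sum>m\<in>M. real (card (?mult (m\<^sup>2)))) \<le> (\<Sum>m\<in>M. x * (1 / real m ^ 2))"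
    proof (rule sum_mono)
      fix m assume "m \<in> M"
      then have "m\<^sup>2 \<ge> 1" by (simp add: M_def)
      then have "real (card (?mult (m\<^sup>2))) \<le> x / real (m\<^sup>2)" using x by (intro card_multiples_real_le) auto
      then show "real (card (?mult (m\<^sup>2))) \<le> x * (1 / real m ^ 2)" by simp
    qed
    also have "\<dots> \<le> (\<Sum>m\<in>{H<..nat \<lfloor>x\<rfloor>}. x * (1 / real m ^ 2))"
    proof (rule sum_mono2)
      show "M \<subseteq> {H<..nat \<lfloor>x\<rfloor>}"
        unfolding M_def H_def by (auto simp: le_nat_floor) linarith
    qed (use x in auto)
    also have "\<dots> \<le> x * (1 / real H)"
      unfolding sum_distrib_left[symmetric] using x H by (intro mult_left_mono sum_inverse_squares_tail) auto
    also have "\<dots> \<le> x * (1 / (x powr (1 / 18) / 2))"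
      using x H xp by (intro mult_left_mono divide_left_mono) auto
    also have "\<dots> = 2 * x powr (17 / 18)"
      using x0 powr_diff[of x 1 "1 / 18"] by simp
    also have "\<dots> \<le> 2 * x powr (23 / 24)" using x by (intro mult_left_mono powr_mono) auto
    finally show ?thesis .
  qed
  also have "(\<Sum>u\<in>U. real (card (?mult u))) \<le> smooth_const * x powr (23 / 24)"
  proof -
    have "(\<Sum>u\<in>U. real (card (?mult u))) \<le> (\<Sum>u\<in>U. x powr (23 / 24) * (1 * real u powr (1 / 4 - 1)))"
    proof (rule sum_mono)
      fix u assume u: "u \<in> U"
      then have u1: "u \<ge> 1" "x powr (1 / 6) < real u" by (auto simp: U_def)
      have "(x powr (1 / 6)) powr (1 / 4) \<le> real u powr (1 / 4)" using u1 by (intro powr_mono2) auto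
      then have le: "x powr (1 / 24) \<le> real u powr (1 / 4)" by (simp add: powr_powr)
      have "real (card (?mult u)) \<le> x / real u" using x u1 by (intro card_multiples_real_le) auto
      also have "x / real u = x powr (23 / 24) * x powr (1 / 24) / real u" using x0 by (simp flip: powr_add)
      also have "\<dots> \<le> x powr (23 / 24) * real u powr (1 / 4) / real u"
        using le by (intro divide_right_mono mult_left_mono) auto
      also have "\<dots> = x powr (23 / 24) * (1 * real u powr (1 / 4 - 1))" using u1 by (simp only: powr_diff) simp
      finally show "real (card (?mult u)) \<le> x powr (23 / 24) * (1 * real u powr (1 / 4 - 1))" .
    qed
    also have "\<dots> = x powr (23 / 24) * (\<Sum>u\<in>U. 1 * real u powr (1 / 4 - 1))" by (simp only: sum_distrib_left)
    also have "(\<Sum>u\<in>U. 1 * real u powr (1 / 4 - 1)) \<le> smooth_const" unfolding smooth_const_def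
      using fin by (intro rankin_bound coprime_multiplicative_const) (auto simp: U_def)
    finally show ?thesis by (simp add: mult.commute mult_right_mono)
  qed
  finally show ?thesis by (simp add: algebra_simps)
qed

text \<open>The index \<open>k\<close> locates the least prime \<open>p\<close> of the rough part: \<open>x powr (1 / (k + 1)) < p \<le> x powr (1 / k)\<close>.\<close>

definition smooth_parts :: "real \<Rightarrow> nat \<Rightarrow> nat set" where
  "smooth_parts x k = {u. u \<ge> 1 \<and> real u \<le> x powr (1 / 3) \<and> (k \<le> 5 \<or> real u > x powr (1 / 6))
     \<and> (\<forall>p. prime p \<longrightarrow> p dvd u \<longrightarrow> real p \<le> x powr (1 / real k))}"

definition rough_parts :: "real \<Rightarrow> nat \<Rightarrow> nat \<Rightarrow> nat set" where
  "rough_parts x k u = {n \<in> {1..nat \<lfloor>x / real u\<rfloor>}. coprime u n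
     \<and> (\<forall>p. prime p \<longrightarrow> real p \<le> x powr (1 / real (k + 1)) \<longrightarrow> \<not> p dvd n)}"

text \<open>Cut q at x^(1/3). If the crossing component p^v is at most x^(1/6), then u > x^(1/6)
  because u * p^v > x^(1/3). Otherwise the absence of large square divisors forces v = 1, so p >
  x^(1/6) and k <= 5. This is the alternative built into \<open>smooth_parts\<close>.\<close>

lemma nonexceptional_decomposition:
  assumes q: "q \<ge> 1" "real q \<le> x" "q \<notin> exceptional x" and x: "ln x \<ge> 144" "x > 0"
  shows "\<exists>k u n. 1 \<le> k \<and> real k \<le> ln x / 24 \<and> u \<in> smooth_parts x k \<and> n \<in> rough_parts x k u \<and> q = u * n"
proof -
  have x1: "x > 1" using x by (metis less_le_trans ln_gt_zero_iff zero_less_numeral)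
  have "1 \<le> x powr (1 / 3)" using x1 by (simp add: ge_one_powr_ge_zero)
  moreover have "x powr (1 / 3) < real q" using q by (auto simp: exceptional_def)
  ultimately obtain u p v r where
    upvr: "q = u * (p ^ v * r)" "prime p" "v \<ge> 1" "real u \<le> x powr (1 / 3)" "x powr (1 / 3) < real (u * p ^ v)"
    and small: "\<And>l. prime l \<Longrightarrow> l dvd u \<Longrightarrow> l < p" and large: "\<And>l. prime l \<Longrightarrow> l dvd r \<Longrightarrow> p < l"
    by (rule smooth_rough_crossing) blast
  have p1: "p > 1" using upvr(2) prime_gt_1_nat by blast
  define n where "n = p ^ v * r"
  have qun: "q = u * n" using upvr(1) by (simp add: n_def)
  have u1: "u \<ge> 1" and n1: "n \<ge> 1" using q(1) qun by (cases u; cases n; auto)+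
  have "p dvd q" unfolding upvr(1) using upvr(3) by (auto intro: dvd_mult dvd_mult2 dvd_power)
  then have "p \<le> q" using q(1) by (intro dvd_imp_le) auto
  then have px: "real p \<le> x" using q(2) by linarith
  have lp: "ln (real p) > 0" "ln (real p) \<le> ln x" using p1 px by auto
  define k where "k = nat \<lfloor>ln x / ln (real p)\<rfloor>"
  have "ln x / ln (real p) \<ge> 1" using lp by simp
  then have k1: "k \<ge> 1" and k: "real k \<le> ln x / ln (real p)" "ln x / ln (real p) < real k + 1"
    unfolding k_def by linarith+
  have k0: "real k > 0" using k1 by simp
  have lpk: "ln (real p) \<le> ln x / real k" "ln x / (real k + 1) < ln (real p)"
    using k lp k0 by (auto simp: field_simps)
  have pk: "real p \<le> x powr (1 / real k)"
  proof -
    have "real p = exp (ln (real p))" using p1 by simp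
    also have "\<dots> \<le> exp (ln x / real k)" using lpk by simp
    finally show ?thesis using x1 by (simp add: powr_def)
  qed
  have pk1: "x powr (1 / real (k + 1)) < real p"
  proof -
    have "x powr (1 / real (k + 1)) = exp (ln x / (real k + 1))" using x1 by (simp add: powr_def add.commute)
    also have "\<dots> < exp (ln (real p))" using lpk by simp
    finally show ?thesis using p1 by simp
  qed
  have n_large: "p \<le> l" if "prime l" "l dvd n" for l
  proof -
    have "l dvd p \<or> l dvd r" using that unfolding n_def by (metis prime_dvd_mult_iff prime_dvd_power)
    then show ?thesis using large[OF that(1)] primes_dvd_imp_eq[OF that(1) upvr(2)] by auto
  qed
  have cop: "coprime u n"
  proof (rule ccontr)
    assume "\<not> coprime u n"
    then have "gcd u n \<noteq> 1" using coprime_iff_gcd_eq_1 by blast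
    then obtain l where "prime l" "l dvd u" "l dvd n" using prime_factor_nat[of "gcd u n"] by auto
    then show False using small[of l] n_large[of l] by simp
  qed
  have big: "k \<le> 5 \<or> real u > x powr (1 / 6)"
  proof (cases "real (p ^ v) \<le> x powr (1 / 6)")
    case True
    have "x powr (1 / 6) * x powr (1 / 6) = x powr (1 / 3)" by (simp flip: powr_add)
    also have "\<dots> < real u * real (p ^ v)" using upvr(5) by simp
    also have "\<dots> \<le> real u * x powr (1 / 6)" using True by (intro mult_left_mono) auto
    finally show ?thesis using x1 by simp
  next
    case False
    have "v = 1"
    proof (rule ccontr)
      assume "v \<noteq> 1"
      then have v2: "v \<ge> 2" using upvr(3) by simp
      \<comment> \<open>For v >= 2 one has 2 * (v div 2) <= v <= 3 * (v div 2). So m^2 divides p^v,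
        while m^3 >= p^v > x^(1/6) makes m > x^(1/18).\<close>
      define m where "m = p ^ (v div 2)"
      have "m\<^sup>2 dvd p ^ v" unfolding m_def power_mult[symmetric] by (intro le_imp_power_dvd) simp
      then have "m\<^sup>2 dvd q" unfolding upvr(1) by (simp add: dvd_mult dvd_mult2)
      moreover have "real m > x powr (1 / 18)"
      proof (rule ccontr)
        assume "\<not> real m > x powr (1 / 18)"
        then have "real m ^ 3 \<le> (x powr (1 / 18)) ^ 3" by (intro power_mono) auto
        also have "\<dots> = x powr (1 / 6)" using x1 by (simp add: powr_powr flip: powr_realpow)
        finally have "real (m ^ 3) \<le> x powr (1 / 6)" by simp
        moreover have "p ^ v \<le> m ^ 3" unfolding m_def power_mult[symmetric]
          using p1 v2 by (intro power_increasing) auto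
        ultimately show False using False by (meson of_nat_le_iff order_trans)
      qed
      ultimately show False using q unfolding exceptional_def by blast
    qed
    then have "x powr (1 / 6) < real p" using False by simp
    then have "ln (x powr (1 / 6)) < ln (real p)" using x1 p1 by (intro ln_less_cancel_iff[THEN iffD2]) auto
    then have "ln x / ln (real p) < 6" using lp x1 by (simp add: ln_powr field_simps)
    then show ?thesis using k by linarith
  qed
  \<comment> \<open>Otherwise p < exp 24, hence all primes of u are below exp 24; since ln x >= 144
    = 6 * 24, also k > 6 and u > x^(1/6). Such a divisor u makes q exceptional.\<close>
  have kL: "real k \<le> ln x / 24"
  proof (rule ccontr)
    assume c: "\<not> real k \<le> ln x / 24"
    then have "ln x < 24 * real k" by simp
    then have "ln x / real k < 24" using k0 by (simp add: field_simps)
    then have "ln (real p) < 24" using lpk by linarith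
    then have pe: "real p < exp 24" using p1 by (metis exp_ln exp_less_cancel_iff less_imp_of_nat_less of_nat_0_less_iff order_less_trans zero_less_one)
    have "real k > 6" using c x by linarith
    then have "real u > x powr (1 / 6)" using big by auto
    moreover have "u dvd q" using qun by simp
    moreover have "real l \<le> exp 24" if "prime l" "l dvd u" for l
      using small[OF that] pe by linarith
    ultimately show False using q unfolding exceptional_def by blast
  qed
  have "u \<in> smooth_parts x k"
  proof -
    have "real l \<le> x powr (1 / real k)" if "prime l" "l dvd u" for l
      using small[OF that] pk by linarith
    then show ?thesis using u1 upvr(4) big by (simp add: smooth_parts_def)
  qed
  moreover have "n \<in> rough_parts x k u"
  proof -
    have "real u * real n \<le> x" using q(2) qun by simp
    then have "real n \<le> x / real u" using u1 by (simp add: pos_le_divide_eq mult.commute)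
    then have "n \<le> nat \<lfloor>x / real u\<rfloor>" by (rule le_nat_floor)
    moreover have "\<not> l dvd n" if "prime l" "real l \<le> x powr (1 / real (k + 1))" for l
    proof
      assume "l dvd n"
      then have "p \<le> l" using n_large that(1) by blast
      then show False using that(2) pk1 by linarith
    qed
    ultimately show ?thesis using n1 cop by (auto simp: rough_parts_def)
  qed
  ultimately show ?thesis using k1 kL qun by blast
qed

text \<open>Group the n by the inverse c of n modulo u. The sieve bounds every group by the same B,
  so the sum over n becomes phi(u) * B times the mean over units.\<close>

lemma sum_rough_parts_le:
  assumes x: "x > 1" "ln x \<le> x powr (1 / 10)" and k: "k \<ge> 1" and u: "u \<in> smooth_parts x k"
  shows "(\<Sum>n\<in>rough_parts x k u. cmod (weyl_sum A h (u * n)))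
     \<le> 21 * x * (real k + 1) / ln x * (weyl_mean A h u / real u)"
proof -
  have u1: "u \<ge> 1" "real u \<le> x powr (1 / 3)" using u by (auto simp: smooth_parts_def)
  have tu: "totient u \<ge> 1" using u1 by (simp add: Suc_le_eq)
  have lx: "ln x > 0" using x by simp
  \<comment> \<open>Sifting stops at the 20th root of the available level. This costs a factor 20 in
    the main term and ensures R^4 <= x^(1/10) for k >= 1; the remainder brings 20 to 21.\<close>
  define R where "R = x powr (1 / (20 * (real k + 1)))"
  define Y where "Y = nat \<lfloor>x / real u\<rfloor>"
  have R1: "R > 1" using x by (simp add: R_def)
  have R_le: "R \<le> x powr (1 / real (k + 1))"
    unfolding R_def using x by (intro powr_mono) (auto simp: field_simps)
  have lnR: "ln R = ln x / (20 * (real k + 1))" using x by (simp add: R_def ln_powr)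
  let ?N = "rough_parts x k u"
  let ?X = "\<lambda>b. {n \<in> {1..Y}. [n = b] (mod u) \<and> (\<forall>p. prime p \<and> real p \<le> R \<longrightarrow> \<not> p dvd n)}"
  define B where "B = 21 * x * (real k + 1) / (real u * real (totient u) * ln x)"
  have XB: "real (card (?X b)) \<le> B" for b
  proof -
    have "real (card (?X b)) \<le> real Y / (real (totient u) * ln R) + R ^ 4"
      using R1 u1 by (intro sieve_rough_residue_class) auto
    also have "real Y / (real (totient u) * ln R) \<le> (x / real u) / (real (totient u) * ln R)"
      using x R1 unfolding Y_def by (intro divide_right_mono) auto
    also have "\<dots> = 20 * (x * (real k + 1) / (real u * real (totient u) * ln x))"
      unfolding lnR by (simp add: field_simps)
    \<comment> \<open>Exponents: 1/10 from R^4, 2/3 from u * phi(u) by the cut at x^(1/3), 1/10 from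
      ln x; their sum 13/15 is below 1.\<close>
    also have "R ^ 4 \<le> x * (real k + 1) / (real u * real (totient u) * ln x)"
    proof -
      have "R ^ 4 = x powr (1 / (20 * (real k + 1)) * 4)"
        unfolding R_def using x by (subst powr_powr[symmetric]) (simp add: powr_realpow)
      also have "\<dots> \<le> x powr (1 / 10)" using x k by (intro powr_mono) (auto simp: field_simps)
      finally have R4: "R ^ 4 \<le> x powr (1 / 10)" .
      have "real (totient u) \<le> real u" using totient_le by simp
      then have "real u * real (totient u) \<le> x powr (1 / 3) * x powr (1 / 3)" using u1 by (intro mult_mono) auto
      also have "\<dots> = x powr (2 / 3)" by (simp flip: powr_add)
      finally have "real u * real (totient u) * ln x \<le> x powr (2 / 3) * x powr (1 / 10)"
        using x lx by (intro mult_mono) auto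
      then have "R ^ 4 * (real u * real (totient u) * ln x) \<le> x powr (1 / 10) * (x powr (2 / 3) * x powr (1 / 10))"
        by (rule mult_mono[OF R4]) (use lx in auto)
      also have "\<dots> = x powr (13 / 15)" by (simp flip: powr_add)
      also have "\<dots> \<le> x powr 1" using x by (intro powr_mono) auto
      also have "\<dots> \<le> x * (real k + 1)" using x by simp
      finally show ?thesis using u1 tu lx by (simp add: pos_le_divide_eq)
    qed
    finally have "real (card (?X b)) \<le> 20 * (x * (real k + 1) / (real u * real (totient u) * ln x))
        + x * (real k + 1) / (real u * real (totient u) * ln x)"
      by simp
    also have "\<dots> = 21 * (x * (real k + 1) / (real u * real (totient u) * ln x))"
    proof -
      have "20 * t + t = 21 * t" for t :: real by simp
      then show ?thesis by blast
    qed
    also have "\<dots> = B" by (simp add: B_def mult.assoc)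
    finally show ?thesis .
  qed
  have pt: "cmod (weyl_sum A h (u * n)) \<le> (\<Sum>c\<in>totatives u. cmod (weyl_sum A (h * c) u) * of_bool ([n * c = 1] (mod u)))"
    if n: "n \<in> ?N" for n
  proof -
    have n1: "n \<ge> 1" "coprime u n" using n by (auto simp: rough_parts_def)
    obtain c where c: "[n * c = 1] (mod u)" using coprime_inverse_exists[OF n1(2)] by blast
    \<comment> \<open>The inverse must be a member of \<open>totatives u\<close>, which for u = 1 is
      {1} and does not contain c mod 1 = 0.\<close>
    define c' where "c' = (if u = 1 then 1 else c mod u)"
    have c': "[n * c' = 1] (mod u)"
      using c by (auto simp: c'_def cong_def mod_mult_right_eq)
    have "coprime c' u" using c' by (metis cong_imp_coprime cong_sym coprime_1_left coprime_mult_left_iff)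
    moreover have "c' > 0" using \<open>coprime c' u\<close> u1 by (cases "c' = 0") (auto simp: c'_def split: if_splits)
    moreover have "c' \<le> u" using u1 by (auto simp: c'_def less_imp_le)
    ultimately have c't: "c' \<in> totatives u" by (simp add: in_totatives_iff)
    have "cmod (weyl_sum A h (u * n)) \<le> cmod (weyl_sum A (h * c') u)"
      using u1 n1 c' by (intro norm_weyl_sum_mult_le) auto
    also have "\<dots> = cmod (weyl_sum A (h * c') u) * of_bool ([n * c' = 1] (mod u))" using c' by simp
    also have "\<dots> \<le> (\<Sum>c\<in>totatives u. cmod (weyl_sum A (h * c) u) * of_bool ([n * c = 1] (mod u)))"
      using c't by (intro member_le_sum) auto
    finally show ?thesis .
  qed
  have finN: "finite ?N" by (simp add: rough_parts_def)
  have cnt: "(\<Sum>n\<in>?N. of_bool ([n * c = 1] (mod u))) \<le> B" if c: "c \<in> totatives u" for c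
  proof -
    obtain b where b: "[c * b = 1] (mod u)"
      using coprime_inverse_exists[of u c] c by (auto simp: in_totatives_iff coprime_commute)
    have "?N \<inter> {n. [n * c = 1] (mod u)} \<subseteq> ?X b"
    proof clarify
      fix n assume n: "n \<in> ?N" "[n * c = 1] (mod u)"
      have "[n * (c * b) = n * 1] (mod u)" using b by (rule cong_scalar_left)
      then have "[n = n * c * b] (mod u)" by (simp add: mult.assoc cong_sym)
      also have "[n * c * b = 1 * b] (mod u)" using n(2) by (rule cong_scalar_right)
      finally have "[n = b] (mod u)" by simp
      moreover have "\<not> p dvd n" if "prime p" "real p \<le> R" for p
        using n(1) that R_le unfolding rough_parts_def by auto
      ultimately show "n \<in> {1..Y} \<and> [n = b] (mod u) \<and> (\<forall>p. prime p \<and> real p \<le> R \<longrightarrow> \<not> p dvd n)"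
        using n(1) by (auto simp: rough_parts_def Y_def)
    qed
    then have "card (?N \<inter> {n. [n * c = 1] (mod u)}) \<le> card (?X b)" by (intro card_mono) auto
    then have "real (card (?N \<inter> {n. [n * c = 1] (mod u)})) \<le> B" using XB[of b] by linarith
    then show ?thesis using finN by (subst sum_of_bool_eq) auto
  qed
  have "(\<Sum>n\<in>?N. cmod (weyl_sum A h (u * n)))
    \<le> (\<Sum>n\<in>?N. \<Sum>c\<in>totatives u. cmod (weyl_sum A (h * c) u) * of_bool ([n * c = 1] (mod u)))"
    by (intro sum_mono pt)
  also have "\<dots> = (\<Sum>c\<in>totatives u. cmod (weyl_sum A (h * c) u) * (\<Sum>n\<in>?N. of_bool ([n * c = 1] (mod u))))"
    unfolding sum_distrib_left by (rule sum.swap)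
  also have "\<dots> \<le> (\<Sum>c\<in>totatives u. cmod (weyl_sum A (h * c) u) * B)"
    by (intro sum_mono mult_left_mono cnt) auto
  also have "\<dots> = (\<Sum>c\<in>totatives u. cmod (weyl_sum A (h * c) u)) * B" by (simp only: sum_distrib_right)
  also have "\<dots> = 21 * x * (real k + 1) / ln x * (weyl_mean A h u / real u)"
    using tu by (simp add: weyl_mean_def B_def mult_ac)
  finally show ?thesis .
qed

text \<open>The first 6 comes from the weight exp(6 - k), the others from
  \<open>rankin_bound\<close> with beta * ln z = 6.\<close>

definition decay_const :: real where
  "decay_const = exp (6 + 2 * exp 6 * 6 + rankin_const)"

text \<open>Rankin's shift gives exp(6 - k), and cutting the saving set D at z = x^(1/k) costs
  exp(k/2). The sum over \<open>family_primes A 1 x\<close> is merely enlarged to all primes up to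
  x, so that it matches the lower bound for the number of moduli.\<close>

lemma sum_smooth_parts_le:
  fixes A :: "nat \<Rightarrow> nat set" and h :: nat
  assumes x: "x > 1" and k: "k \<ge> 1" "real k \<le> ln x / 24"
  defines "D \<equiv> {p \<in> family_primes A 2 x. \<not> p dvd h}"
  shows "(\<Sum>u\<in>smooth_parts x k. weyl_mean A h u / real u)
     \<le> decay_const * exp (- real k / 2) * exp ((\<Sum>p\<in>family_primes A 1 x. 1 / real p) - (\<Sum>p\<in>D. 1 / real p) / 4)"
proof -
  let ?f = "weyl_mean A h"
  define \<beta> where "\<beta> = 6 * real k / ln x"
  define z where "z = x powr (1 / real k)"
  have lx: "ln x > 0" using x by simp
  have k0: "real k > 0" using k by simp
  have z1: "z > 1" using x k0 by (simp add: z_def)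
  have lnz: "ln z = ln x / real k" using x by (simp add: z_def ln_powr)
  have zx: "z \<le> x" unfolding z_def using x k powr_mono[of "1 / real k" 1 x] by simp
  have \<beta>: "\<beta> \<ge> 0" "\<beta> \<le> 1 / 4" "\<beta> * ln z \<le> 6"
    using k lx k0 by (auto simp: \<beta>_def lnz field_simps)
  have fin: "finite (smooth_parts x k)" unfolding smooth_parts_def
    by (rule finite_subset[OF _ finite_nat_real_le[of "\<lambda>_. True" "x powr (1 / 3)"]]) auto
  have "(\<Sum>u\<in>smooth_parts x k. ?f u / real u) \<le> (\<Sum>u\<in>smooth_parts x k. exp (6 - real k) * (?f u * real u powr (\<beta> - 1)))"
  proof (rule sum_mono)
    fix u assume u: "u \<in> smooth_parts x k"
    then have u1: "u \<ge> 1" "k \<le> 5 \<or> real u > x powr (1 / 6)" by (auto simp: smooth_parts_def)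
    \<comment> \<open>For k <= 5 there is no lower bound on u, but exp(6 - k) alone exceeds 1. For
      larger k, u > x^(1/6) gives u powr beta >= exp k.\<close>
    have "1 \<le> exp (6 - real k) * real u powr \<beta>"
    proof (cases "k \<le> 5")
      case True
      have "(1::real) * 1 \<le> exp (6 - real k) * real u powr \<beta>"
        using True u1 \<beta> by (intro mult_mono) (auto simp: ge_one_powr_ge_zero)
      then show ?thesis by simp
    next
      case False
      then have "(x powr (1 / 6)) powr \<beta> \<le> real u powr \<beta>" using u1 \<beta> by (intro powr_mono2) auto
      moreover have "(x powr (1 / 6)) powr \<beta> = exp (real k)"
        using x lx by (simp add: powr_powr) (simp add: powr_def \<beta>_def)
      ultimately have "exp (6 - real k) * exp (real k) \<le> exp (6 - real k) * real u powr \<beta>"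
        by (intro mult_left_mono) auto
      moreover have "exp (6 - real k) * exp (real k) = exp 6" by (simp flip: exp_add)
      moreover have "(1::real) \<le> exp 6" by simp
      ultimately show ?thesis by linarith
    qed
    then have "?f u / real u * 1 \<le> ?f u / real u * (exp (6 - real k) * real u powr \<beta>)"
      using weyl_mean_nonneg by (intro mult_left_mono) auto
    then show "?f u / real u \<le> exp (6 - real k) * (?f u * real u powr (\<beta> - 1))"
      using u1 by (simp add: powr_diff mult_ac)
  qed
  also have "\<dots> = exp (6 - real k) * (\<Sum>u\<in>smooth_parts x k. ?f u * real u powr (\<beta> - 1))"
    by (simp only: sum_distrib_left)
  also have "\<dots> \<le> exp (6 - real k) * exp ((\<Sum>p\<in>primes_upto_real z. ?f p / real p) + 2 * exp 6 * 6 + rankin_const)"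
  proof (intro mult_left_mono rankin_bound)
    fix n p assume "n \<in> smooth_parts x k" "prime p" "p dvd n"
    then show "real p \<le> z" by (simp add: smooth_parts_def z_def)
  qed (use \<beta> z1 fin in \<open>auto simp: coprime_multiplicative_weyl_mean weyl_mean_nonneg weyl_mean_le_1 smooth_parts_def\<close>)
  also have "(\<Sum>p\<in>primes_upto_real z. ?f p / real p)
     \<le> (\<Sum>p\<in>family_primes A 1 x. 1 / real p) - (\<Sum>p\<in>D. 1 / real p) / 4 + real k / 2"
  proof -
    have finD: "finite D" unfolding D_def using finite_family_primes by simp
    have "(\<Sum>p\<in>primes_upto_real z. ?f p / real p)
       \<le> (\<Sum>p\<in>primes_upto_real z. (if p \<in> family_primes A 1 x then 1 / real p else 0) - (if p \<in> D then 1 / real p / 4 else 0))"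
    proof (rule sum_mono)
      fix p assume p: "p \<in> primes_upto_real z"
      then have pp: "prime p" "real p \<le> x" using zx by (auto simp: primes_upto_real_def)
      consider "rho A p = 0" | "p \<in> D" "p \<in> family_primes A 1 x" | "p \<notin> D" "p \<in> family_primes A 1 x"
        using pp unfolding D_def family_primes_def by fastforce
      then show "?f p / real p \<le> (if p \<in> family_primes A 1 x then 1 / real p else 0) - (if p \<in> D then 1 / real p / 4 else 0)"
      proof cases
        case 1
        then show ?thesis by (simp add: weyl_mean_eq_0 D_def family_primes_def)
      next
        case 2
        then have "?f p \<le> 3 / 4" using pp(1) by (intro weyl_mean_prime_le) (auto simp: D_def family_primes_def)
        then have "?f p / real p \<le> (3 / 4) / real p" by (intro divide_right_mono) auto
        then show ?thesis using 2 by simp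
      next
        case 3
        have "?f p / real p \<le> 1 / real p" using weyl_mean_le_1 by (intro divide_right_mono) auto
        then show ?thesis using 3 by simp
      qed
    qed
    also have "\<dots> = (\<Sum>p | p \<in> primes_upto_real z \<and> p \<in> family_primes A 1 x. 1 / real p) - (\<Sum>p | p \<in> primes_upto_real z \<and> p \<in> D. 1 / real p / 4)"
      using finite_primes_upto_real by (simp only: sum_subtractf sum.inter_filter[symmetric])
    also have "(\<Sum>p | p \<in> primes_upto_real z \<and> p \<in> family_primes A 1 x. 1 / real p) \<le> (\<Sum>p\<in>family_primes A 1 x. 1 / real p)"
      using finite_family_primes by (intro sum_mono2) auto
    finally have up: "(\<Sum>p\<in>primes_upto_real z. ?f p / real p) \<le> (\<Sum>p\<in>family_primes A 1 x. 1 / real p)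
        - (\<Sum>p | p \<in> primes_upto_real z \<and> p \<in> D. 1 / real p / 4)"
      by simp
    \<comment> \<open>The primes of D in (z, x] have reciprocal sum at most 2 ln x / ln z = 2k; a
      quarter of it is the loss k / 2.\<close>
    have "(\<Sum>p | p \<in> primes_upto_real z \<and> p \<in> D. 1 / real p / 4) \<ge> ((\<Sum>p\<in>D. 1 / real p) - 2 * real k) / 4"
    proof -
      have "D = {p. p \<in> primes_upto_real z \<and> p \<in> D} \<union> {p \<in> D. z < real p}"
        by (auto simp: D_def family_primes_def primes_upto_real_def)
      then have "(\<Sum>p\<in>D. 1 / real p) = (\<Sum>p | p \<in> primes_upto_real z \<and> p \<in> D. 1 / real p) + (\<Sum>p | p \<in> D \<and> z < real p. 1 / real p)"
        using finD by (subst sum.union_disjoint[symmetric]) (auto simp: primes_upto_real_def)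
      also have "(\<Sum>p | p \<in> D \<and> z < real p. 1 / real p) \<le> 2 * ln x / ln z"
        using z1 x family_primes_subset by (intro sum_inverse_primes_interval) (auto simp: D_def)
      also have "2 * ln x / ln z = 2 * real k" using lx k0 by (simp add: lnz)
      finally show ?thesis unfolding sum_divide_distrib[symmetric] by simp
    qed
    then show ?thesis using up by simp
  qed
  finally have "(\<Sum>u\<in>smooth_parts x k. ?f u / real u) \<le> exp (6 - real k) *
      exp ((\<Sum>p\<in>family_primes A 1 x. 1 / real p) - (\<Sum>p\<in>D. 1 / real p) / 4 + real k / 2 + 2 * exp 6 * 6 + rankin_const)"
    by simp
  also have "\<dots> = decay_const * exp (- real k / 2) * exp ((\<Sum>p\<in>family_primes A 1 x. 1 / real p) - (\<Sum>p\<in>D. 1 / real p) / 4)"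
    by (simp add: decay_const_def flip: exp_add)
  finally show ?thesis .
qed

text \<open>k + 1 <= 4 exp(k/4) leaves 4 exp(-k/4), and exp(-1/4) <= 4/5 gives a geometric series
  with sum 4 * 5.\<close>

lemma sum_weighted_exp_le: "(\<Sum>k\<in>{1..K}. (real k + 1) * exp (- real k / 2)) \<le> 20"
proof -
  have "(\<Sum>k\<in>{1..K}. (real k + 1) * exp (- real k / 2)) \<le> (\<Sum>k\<in>{1..K}. 4 * (4 / 5) ^ k)"
  proof (rule sum_mono)
    fix k
    have "real k + 1 \<le> 4 * (1 + real k / 4)" by simp
    also have "\<dots> \<le> 4 * exp (real k / 4)" by (intro mult_left_mono exp_ge_add_one_self) auto
    finally have "(real k + 1) * exp (- real k / 2) \<le> 4 * exp (real k / 4) * exp (- real k / 2)"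
      by (intro mult_right_mono) auto
    also have "\<dots> = 4 * exp (- 1 / 4) ^ k" by (simp flip: exp_add exp_of_nat_mult)
    also have "exp (- 1 / 4 :: real) \<le> 4 / 5"
      using exp_ge_add_one_self[of "1 / 4 :: real"] by (simp add: exp_minus field_simps)
    then have "4 * exp (- 1 / 4) ^ k \<le> 4 * (4 / 5 :: real) ^ k" by (intro mult_left_mono power_mono) auto
    finally show "(real k + 1) * exp (- real k / 2) \<le> 4 * (4 / 5) ^ k" .
  qed
  also have "\<dots> \<le> (\<Sum>k<Suc K. 4 * (4 / 5) ^ k)" by (intro sum_mono2) auto
  also have "\<dots> = 4 * ((1 - (4 / 5) ^ Suc K) / (1 - 4 / 5))"
    unfolding sum_distrib_left[symmetric] by (subst sum_gp_strict) auto
  also have "\<dots> \<le> 20" by simp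
  finally show ?thesis .
qed

text \<open>For \<open>h = 0\<close> the set \<open>D\<close> is empty and the left-hand side counts the elements of \<open>S\<close> with
  \<open>\<rho>(q) \<ge> 1\<close>.\<close>

lemma sum_weyl_sums_le:
  fixes A :: "nat \<Rightarrow> nat set" and h :: nat
  assumes x: "ln x \<ge> 144" "ln x \<le> x powr (1 / 10)" "x > 0"
    and S: "\<And>q. q \<in> S \<Longrightarrow> q \<ge> 1 \<and> real q \<le> x \<and> q \<notin> exceptional x"
  defines "D \<equiv> {p \<in> family_primes A 2 x. \<not> p dvd h}"
  shows "(\<Sum>q\<in>S. cmod (weyl_sum A h q))
     \<le> 420 * decay_const * (x / ln x) * exp ((\<Sum>p\<in>family_primes A 1 x. 1 / real p) - (\<Sum>p\<in>D. 1 / real p) / 4)"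
proof -
  have x1: "x > 1" using x by (metis less_le_trans ln_gt_zero_iff zero_less_numeral)
  define K where "K = nat \<lfloor>ln x / 24\<rfloor>"
  have kK: "k \<le> K \<longleftrightarrow> real k \<le> ln x / 24" for k
  proof -
    have "k \<le> K \<longleftrightarrow> int k \<le> \<lfloor>ln x / 24\<rfloor>" using x1 unfolding K_def by (intro le_nat_iff) auto
    then show ?thesis by (simp only: le_floor_iff of_int_of_nat_eq)
  qed
  define I where "I = (SIGMA k:{1..K}. SIGMA u:smooth_parts x k. rough_parts x k u)"
  let ?f = "\<lambda>(k, u, n). u * n"
  define E where "E = exp ((\<Sum>p\<in>family_primes A 1 x. 1 / real p) - (\<Sum>p\<in>D. 1 / real p) / 4)"
  have finu: "finite (smooth_parts x k)" for k unfolding smooth_parts_def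
    by (rule finite_subset[OF _ finite_nat_real_le[of "\<lambda>_. True" "x powr (1 / 3)"]]) auto
  have finr: "finite (rough_parts x k u)" for k u by (simp add: rough_parts_def)
  have finI: "finite I" unfolding I_def using finu finr by auto
  \<comment> \<open>A covering is enough: repeated or additional products u * n only add nonnegative
    terms.\<close>
  have SI: "S \<subseteq> ?f ` I"
  proof
    fix q assume "q \<in> S"
    then obtain k u n where kun: "1 \<le> k" "real k \<le> ln x / 24" "u \<in> smooth_parts x k" "n \<in> rough_parts x k u" "q = u * n"
      using nonexceptional_decomposition[of q x] S x by blast
    then have "(k, u, n) \<in> I" by (simp add: I_def kK)
    then show "q \<in> ?f ` I" using kun(5) by force
  qed
  have "(\<Sum>q\<in>S. cmod (weyl_sum A h q)) \<le> (\<Sum>q\<in>?f ` I. cmod (weyl_sum A h q))"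
    using SI finI by (intro sum_mono2) auto
  also have "\<dots> \<le> (\<Sum>i\<in>I. cmod (weyl_sum A h (?f i)))"
    using sum_image_le[OF finI, of "\<lambda>q. cmod (weyl_sum A h q)" ?f] by (simp add: comp_def)
  also have "\<dots> = (\<Sum>k\<in>{1..K}. \<Sum>u\<in>smooth_parts x k. \<Sum>n\<in>rough_parts x k u. cmod (weyl_sum A h (u * n)))"
    unfolding I_def using finu finr by (simp add: sum.Sigma case_prod_beta)
  also have "\<dots> \<le> (\<Sum>k\<in>{1..K}. \<Sum>u\<in>smooth_parts x k. 21 * x * (real k + 1) / ln x * (weyl_mean A h u / real u))"
    using x x1 by (intro sum_mono sum_rough_parts_le) auto
  also have "\<dots> \<le> (\<Sum>k\<in>{1..K}. 21 * x * (real k + 1) / ln x * (decay_const * exp (- real k / 2) * E))"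
    unfolding sum_distrib_left[symmetric] E_def D_def
    using x1 kK by (intro sum_mono mult_left_mono sum_smooth_parts_le) auto
  also have "\<dots> = 21 * decay_const * (x / ln x) * E * (\<Sum>k\<in>{1..K}. (real k + 1) * exp (- real k / 2))"
    unfolding sum_distrib_left by (intro sum.cong) (auto simp: field_simps)
  also have "\<dots> \<le> 21 * decay_const * (x / ln x) * E * 20"
    using x1 by (intro mult_left_mono sum_weighted_exp_le) (auto simp: E_def decay_const_def)
  finally show ?thesis by (simp add: E_def)
qed

section \<open>The mean discrepancy\<close>

lemma harm_le_1_plus_ln:
  assumes "n \<ge> 1" shows "harm n \<le> 1 + ln (real n)"
proof -
  obtain m where m: "n = Suc m" using assms by (metis Suc_le_D One_nat_def)
  have "harm (Suc m) - ln (real (Suc m)) \<le> harm (Suc 0) - ln (real (Suc 0))"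
    using decseq_harm_diff_ln unfolding decseq_def by blast
  then show ?thesis by (simp add: m harm_def)
qed

lemma exp_quarter_le:
  fixes t :: real assumes "0 \<le> t" "t \<le> 1" shows "exp (t / 4) \<le> 1 + t"
proof -
  have "exp (t / 4) - 1 \<le> t / 4 * exp (t / 4)" by (rule exp_minus_one_le)
  also have "\<dots> \<le> t / 4 * exp 1" using assms by (intro mult_left_mono) auto
  also have "\<dots> \<le> t / 4 * 3" using assms exp_le by (intro mult_left_mono) auto
  also have "\<dots> \<le> t" using assms by simp
  finally show ?thesis by simp
qed

text \<open>Primes dividing h yield no saving. Their loss is at most the product of 1 + 1/p, whose
  expansion runs over squarefree divisors of h and hence stays below a harmonic sum.\<close>

lemma exp_sum_prime_divisors_le:
  assumes h: "h \<ge> 1" and P: "finite P" "\<And>p. p \<in> P \<Longrightarrow> prime p \<and> p dvd h"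
  shows "exp ((\<Sum>p\<in>P. 1 / real p) / 4) \<le> 1 + ln (real h)"
proof -
  have p1: "p \<ge> 1" if "p \<in> P" for p using P(2)[OF that] prime_ge_1_nat by blast
  have "exp ((\<Sum>p\<in>P. 1 / real p) / 4) = (\<Prod>p\<in>P. exp (1 / real p / 4))"
    using P(1) by (simp add: sum_divide_distrib exp_sum)
  also have "\<dots> \<le> (\<Prod>p\<in>P. 1 + 1 / real p)"
  proof (intro prod_mono conjI exp_quarter_le)
    fix p assume "p \<in> P"
    then have "1 \<le> real p" using p1[of p] by simp
    then show "1 / real p \<le> 1" by simp
  qed auto
  also have "\<dots> = (\<Prod>p\<in>P. \<Sum>v\<le>1. 1 / real (p ^ v))" by (simp add: add.commute)
  also have "\<dots> = (\<Sum>n\<in>smooth_set P 1. 1 / real n)"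
    using P by (intro sum_smooth_set[symmetric]) (auto simp: coprime_multiplicative_def)
  also have "\<dots> \<le> (\<Sum>n\<in>{1..h}. 1 / real n)"
  proof (rule sum_mono2)
    show "smooth_set P 1 \<subseteq> {1..h}"
    proof
      fix n assume n: "n \<in> smooth_set P 1"
      have "n dvd h"
      proof (rule multiplicity_le_imp_dvd)
        fix p :: nat assume p: "prime p"
        show "multiplicity p n \<le> multiplicity p h"
        proof (cases "p dvd n")
          case True
          then have "p dvd h" using n p P(2) by (auto simp: smooth_set_def)
          then have "multiplicity p h \<ge> 1" using h p
            by (simp add: Suc_le_eq prime_multiplicity_gt_zero_iff)
          moreover have "multiplicity p n \<le> 1" using n p unfolding smooth_set_def by blast
          ultimately show ?thesis by simp
        qed (simp add: not_dvd_imp_multiplicity_0)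
      qed (use n h in \<open>auto simp: smooth_set_def\<close>)
      then show "n \<in> {1..h}" using n h by (auto simp: smooth_set_def Suc_le_eq intro: dvd_imp_le)
    qed
  qed auto
  also have "\<dots> = harm h" by (simp add: harm_def inverse_eq_divide)
  also have "\<dots> \<le> 1 + ln (real h)" using h by (rule harm_le_1_plus_ln)
  finally show ?thesis .
qed

text \<open>All integers up to x^(1/100), then the interval bound with 2 * 100. The true order is ln
  (ln x); a small multiple of ln x is enough to make exp(S / 6) a small power of x.\<close>

lemma sum_inverse_primes_le:
  assumes x: "x > 1" and P: "P \<subseteq> primes_upto_real x"
  shows "(\<Sum>p\<in>P. 1 / real p) \<le> ln x / 100 + 201"
proof -
  define w where "w = x powr (1 / 100)"
  have w: "w > 1" "ln w = ln x / 100" using x by (auto simp: w_def ln_powr)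
  have finP: "finite P" using P finite_primes_upto_real finite_subset by blast
  let ?A = "{p \<in> P. real p < w}" and ?B = "{p \<in> P. w \<le> real p}"
  have "P = ?A \<union> ?B" by auto
  then have "(\<Sum>p\<in>P. 1 / real p) = (\<Sum>p\<in>?A. 1 / real p) + (\<Sum>p\<in>?B. 1 / real p)"
    using finP by (subst sum.union_disjoint[symmetric]) auto
  also have "(\<Sum>p\<in>?A. 1 / real p) \<le> 1 + ln w"
  proof -
    have N: "nat \<lfloor>w\<rfloor> \<ge> 1" using w by (simp add: le_nat_iff)
    have "(\<Sum>p\<in>?A. 1 / real p) \<le> (\<Sum>p\<in>{1..nat \<lfloor>w\<rfloor>}. 1 / real p)"
    proof (rule sum_mono2)
      show "?A \<subseteq> {1..nat \<lfloor>w\<rfloor>}"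
        using P prime_ge_1_nat by (auto simp: primes_upto_real_def le_nat_floor)
    qed auto
    also have "\<dots> = harm (nat \<lfloor>w\<rfloor>)" by (simp add: harm_def inverse_eq_divide)
    also have "\<dots> \<le> 1 + ln (real (nat \<lfloor>w\<rfloor>))" using N by (rule harm_le_1_plus_ln)
    also have "\<dots> \<le> 1 + ln w" using N w by (intro add_left_mono ln_mono) auto
    finally show ?thesis .
  qed
  also have "(\<Sum>p\<in>?B. 1 / real p) \<le> 2 * ln x / ln w"
    using w x P by (intro sum_inverse_primes_interval) auto
  also have "2 * ln x / ln w = 200" using x unfolding w(2) by simp
  finally show ?thesis using w by simp
qed

lemma sum_1_plus_ln_div_le:
  assumes "H \<ge> 1" shows "(\<Sum>h\<in>{1..H}. (1 + ln (real h)) / real h) \<le> (1 + ln (real H)) ^ 2"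
proof -
  have "(\<Sum>h\<in>{1..H}. (1 + ln (real h)) / real h) \<le> (\<Sum>h\<in>{1..H}. (1 + ln (real H)) * inverse (real h))"
    unfolding divide_inverse by (intro sum_mono mult_right_mono) auto
  also have "\<dots> = (1 + ln (real H)) * harm H" by (simp add: harm_def sum_distrib_left)
  also have "\<dots> \<le> (1 + ln (real H)) * (1 + ln (real H))"
    using assms by (intro mult_left_mono harm_le_1_plus_ln add_nonneg_nonneg) auto
  finally show ?thesis by (simp add: power2_eq_square)
qed

text \<open>The case h = 0 of the Weyl sum bound controls the number of moduli by Z, and h >= 1
  gives Z * exp(-S/4) up to a factor 1 + ln h. The constant is 133 = 5 + 2 * 64.\<close>

lemma sum_disc_nonexceptional_le:
  fixes A :: "nat \<Rightarrow> nat set" and x :: real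
  defines "S \<equiv> (\<Sum>p\<in>family_primes A 2 x. 1 / real p)"
  assumes x: "ln x \<ge> 144" "ln x \<le> x powr (1 / 10)" "x > 0"
    and N_le: "exp (S / 6) + 1 \<le> x powr (1 / 3)"
  shows "(\<Sum>q\<in>Q_upto A x - exceptional x. disc (Delta A q))
    \<le> 133 * (420 * decay_const) * (x / ln x) * exp (\<Sum>p\<in>family_primes A 1 x. 1 / real p) * exp (- S / 6)"
proof -
  let ?Q = "Q_upto A x - exceptional x"
  define Z where "Z = 420 * decay_const * (x / ln x) * exp (\<Sum>p\<in>family_primes A 1 x. 1 / real p)"
  have "x / ln x \<ge> 0" using x(1,3) by (intro divide_nonneg_nonneg) linarith+
  then have Z0: "Z \<ge> 0" unfolding Z_def by (intro mult_nonneg_nonneg) (auto simp: decay_const_def)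
  have S0: "S \<ge> 0" unfolding S_def by (simp add: sum_nonneg)
  \<comment> \<open>This makes the term 5 / N of size exp(-S/6), the target. \<open>N_le\<close>
    puts N below x^(1/3), hence below every nonexceptional q.\<close>
  define N where "N = nat \<lceil>exp (S / 6)\<rceil>"
  have N: "real N \<ge> exp (S / 6)" "real N \<le> exp (S / 6) + 1" unfolding N_def using exp_gt_zero[of "S / 6"] by linarith+
  have e1: "exp (S / 6) \<ge> 1" using S0 by simp
  then have "real N \<ge> 1" using N by linarith
  then have N1: "N \<ge> 1" by simp
  have qQ: "q \<ge> 1 \<and> real q \<le> x \<and> q \<notin> exceptional x" if "q \<in> ?Q" for q
    using that by (auto simp: Q_upto_def Q_set_def)
  have "real N < real q" if "q \<in> ?Q" for q
    using qQ[OF that] N N_le by (auto simp: exceptional_def)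
  then have et: "disc (Delta A q) \<le> 5 / real N + 2 * (\<Sum>h\<in>{1..N ^ 2}. cmod (weyl_sum A h q) / real h)" if "q \<in> ?Q" for q
    using that N1 by (intro erdos_turan) (auto simp: Q_upto_def less_imp_le)
  have T0: "real (card ?Q) \<le> Z"
  proof -
    have "real (card ?Q) = (\<Sum>q\<in>?Q. cmod (weyl_sum A 0 q))"
      by (simp add: weyl_sum_def rho_def[symmetric] Q_upto_def Q_set_def)
    also have "\<dots> \<le> Z"
      using sum_weyl_sums_le[OF x(1,2,3), of ?Q A 0] qQ by (simp add: Z_def)
    finally show ?thesis .
  qed
  have Th: "(\<Sum>q\<in>?Q. cmod (weyl_sum A h q)) \<le> Z * exp (- S / 4) * (1 + ln (real h))" if h: "h \<ge> 1" for h
  proof -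
    let ?D = "{p \<in> family_primes A 2 x. \<not> p dvd h}" and ?P = "{p \<in> family_primes A 2 x. p dvd h}"
    have split: "S = (\<Sum>p\<in>?D. 1 / real p) + (\<Sum>p\<in>?P. 1 / real p)"
      unfolding S_def using finite_family_primes[of A 2 x]
      by (subst sum.union_disjoint[symmetric]) (auto intro!: sum.cong)
    have "(\<Sum>q\<in>?Q. cmod (weyl_sum A h q))
      \<le> 420 * decay_const * (x / ln x) * exp ((\<Sum>p\<in>family_primes A 1 x. 1 / real p) - (\<Sum>p\<in>?D. 1 / real p) / 4)"
      using qQ by (intro sum_weyl_sums_le x) auto
    also have "(\<Sum>p\<in>family_primes A 1 x. 1 / real p) - (\<Sum>p\<in>?D. 1 / real p) / 4
       = (\<Sum>p\<in>family_primes A 1 x. 1 / real p) + (- S / 4 + (\<Sum>p\<in>?P. 1 / real p) / 4)"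
      using split by (simp add: field_simps)
    also have "420 * decay_const * (x / ln x) * exp \<dots> = Z * exp (- S / 4) * exp ((\<Sum>p\<in>?P. 1 / real p) / 4)"
      unfolding exp_add Z_def by simp
    also have "\<dots> \<le> Z * exp (- S / 4) * (1 + ln (real h))"
      using Z0 h finite_family_primes[of A 2 x]
      by (intro mult_left_mono exp_sum_prime_divisors_le) (auto simp: family_primes_def)
    finally show ?thesis .
  qed
  have "(\<Sum>q\<in>?Q. disc (Delta A q)) \<le> (\<Sum>q\<in>?Q. 5 / real N + 2 * (\<Sum>h\<in>{1..N ^ 2}. cmod (weyl_sum A h q) / real h))"
    by (intro sum_mono et)
  also have "\<dots> = real (card ?Q) * (5 / real N) + 2 * (\<Sum>q\<in>?Q. \<Sum>h\<in>{1..N ^ 2}. cmod (weyl_sum A h q) / real h)"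
    by (simp add: sum.distrib sum_distrib_left)
  also have "(\<Sum>q\<in>?Q. \<Sum>h\<in>{1..N ^ 2}. cmod (weyl_sum A h q) / real h)
     = (\<Sum>h\<in>{1..N ^ 2}. (\<Sum>q\<in>?Q. cmod (weyl_sum A h q)) / real h)"
    unfolding sum_divide_distrib by (rule sum.swap)
  also have "\<dots> \<le> (\<Sum>h\<in>{1..N ^ 2}. Z * exp (- S / 4) * (1 + ln (real h)) / real h)"
    by (intro sum_mono divide_right_mono Th) auto
  also have "\<dots> = Z * exp (- S / 4) * (\<Sum>h\<in>{1..N ^ 2}. (1 + ln (real h)) / real h)"
    by (simp add: sum_distrib_left)
  also have "\<dots> \<le> Z * exp (- S / 4) * (1 + ln (real (N ^ 2))) ^ 2"
    using Z0 N1 by (intro mult_left_mono sum_1_plus_ln_div_le) auto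
  \<comment> \<open>The frequencies up to N^2 cost (1 + 2 ln N)^2, quadratic in S and at most 64
    exp(S/12); the exponents combine as -1/4 + 1/12 = -1/6.\<close>
  also have "\<dots> \<le> Z * exp (- S / 4) * (8 * exp (S / 24)) ^ 2"
  proof (intro mult_left_mono power_mono)
    have "real N \<le> 2 * exp (S / 6)" "real N > 0" using N e1 by linarith+
    then have "ln (real N) \<le> ln (2 * exp (S / 6))" by (intro ln_mono)
    also have "\<dots> = ln 2 + S / 6" by (simp add: ln_mult)
    finally have "1 + ln (real (N ^ 2)) \<le> 3 + S / 3" using N1 ln_2_less_1 by (simp add: ln_realpow)
    also have "\<dots> \<le> 8 * (1 + S / 24)" using S0 by simp
    also have "\<dots> \<le> 8 * exp (S / 24)" by (intro mult_left_mono exp_ge_add_one_self) auto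
    finally show "1 + ln (real (N ^ 2)) \<le> 8 * exp (S / 24)" .
    show "0 \<le> 1 + ln (real (N ^ 2))" using N1 by (simp add: ln_realpow)
  qed (use Z0 in auto)
  also have "\<dots> = 64 * (Z * exp (- S / 6))"
  proof -
    have "exp (- S / 4) * exp (S / 24) ^ 2 = exp (- S / 6)"
      by (simp add: power2_eq_square flip: exp_add)
    then show ?thesis by (simp add: power_mult_distrib)
  qed
  also have "real (card ?Q) * (5 / real N) \<le> Z * (5 * exp (- S / 6))"
  proof (rule mult_mono)
    have "1 / real N \<le> 1 / exp (S / 6)" using N N1 by (intro divide_left_mono) auto
    then show "5 / real N \<le> 5 * exp (- S / 6)" by (simp add: exp_minus inverse_eq_divide)
  qed (use T0 Z0 in auto)
  finally have "(\<Sum>q\<in>?Q. disc (Delta A q)) \<le> 133 * (Z * exp (- S / 6))" by simp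
  then show ?thesis by (simp add: Z_def mult_ac)
qed

text \<open>Every condition involves only alpha and x0: the family-dependent sum S is replaced by
  its bound ln x / 100 + 201. The threshold can thus be fixed before the family
  \<open>A\<close>.\<close>

lemma eventually_large:
  fixes \<alpha> x0 :: real assumes "\<alpha> > 0"
  shows "\<exists>X. \<forall>x\<ge>X. ln x \<ge> 144 \<and> ln x \<le> x powr (1 / 10) \<and> x > 1 \<and> sqrt x \<ge> x0 \<and> ln x \<le> \<alpha> * sqrt x
    \<and> exp ((ln x / 100 + 201) / 6) + 1 \<le> x powr (1 / 3)
    \<and> x powr (23 / 24) \<le> exp (- (ln x / 100 + 201) / 6) * (x / ln x)"
proof -
  have "\<forall>\<^sub>F x::real in at_top. ln x \<ge> 144" by real_asymp
  moreover have "\<forall>\<^sub>F x::real in at_top. ln x \<le> x powr (1 / 10)" by real_asymp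
  moreover have "\<forall>\<^sub>F x::real in at_top. x > 1" by real_asymp
  moreover have "\<forall>\<^sub>F x::real in at_top. sqrt x \<ge> x0" by real_asymp
  moreover have "\<forall>\<^sub>F x::real in at_top. ln x \<le> \<alpha> * sqrt x" using assms by real_asymp
  moreover have "\<forall>\<^sub>F x::real in at_top. exp ((ln x / 100 + 201) / 6) + 1 \<le> x powr (1 / 3)" by real_asymp
  moreover have "\<forall>\<^sub>F x::real in at_top. x powr (23 / 24) \<le> exp (- (ln x / 100 + 201) / 6) * (x / ln x)" by real_asymp
  ultimately have "\<forall>\<^sub>F x::real in at_top. ln x \<ge> 144 \<and> ln x \<le> x powr (1 / 10) \<and> x > 1 \<and> sqrt x \<ge> x0 \<and> ln x \<le> \<alpha> * sqrt x
    \<and> exp ((ln x / 100 + 201) / 6) + 1 \<le> x powr (1 / 3)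
    \<and> x powr (23 / 24) \<le> exp (- (ln x / 100 + 201) / 6) * (x / ln x)"
    by eventually_elim blast
  then show ?thesis by (simp add: eventually_at_top_linorder)
qed

text \<open>The exceptional moduli are bounded by disc <= 1 and their number, which is still below
  exp(-S/6) * V. The parameter alpha enters only through the lower bound for the number of
  moduli.\<close>

lemma mean_disc_le:
  fixes A :: "nat \<Rightarrow> nat set" and x :: real
  defines "S \<equiv> (\<Sum>p\<in>family_primes A 2 x. 1 / real p)"
  assumes hyp: "\<And>y. y \<ge> x0 \<Longrightarrow> (\<Sum>p | prime p \<and> real p \<le> y \<and> rho A p \<ge> 1. ln (real p)) \<ge> \<alpha> * y"
    and \<alpha>: "\<alpha> > 0" and x: "ln x \<ge> 144" "ln x \<le> x powr (1 / 10)" "x > 1" "sqrt x \<ge> x0" "ln x \<le> \<alpha> * sqrt x"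
      "exp ((ln x / 100 + 201) / 6) + 1 \<le> x powr (1 / 3)"
      "x powr (23 / 24) \<le> exp (- (ln x / 100 + 201) / 6) * (x / ln x)"
  shows "(\<Sum>q\<in>Q_upto A x. disc (Delta A q)) / real (card (Q_upto A x))
    \<le> 4 * exp 42 * (133 * (420 * decay_const) + (3 + smooth_const)) / \<alpha> * exp (- S / 6)"
proof -
  let ?Q = "Q_upto A x" and ?X = "exceptional x"
  \<comment> \<open>V is the common scale of numerator and denominator and cancels in the
    quotient.\<close>
  define V where "V = x / ln x * exp (\<Sum>p\<in>family_primes A 1 x. 1 / real p)"
  have xl: "x / ln x > 0" using x by simp
  then have V0: "V > 0" unfolding V_def by (intro mult_pos_pos) auto
  have S: "S \<le> ln x / 100 + 201" unfolding S_def using x family_primes_subset by (intro sum_inverse_primes_le) auto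
  have finX: "finite ?X" unfolding exceptional_def
    by (rule finite_subset[OF _ finite_nat_real_le[of "\<lambda>_. True" x]]) auto
  have sc: "smooth_const \<ge> 0" by (simp add: smooth_const_def)
  have "(\<Sum>q\<in>?Q. disc (Delta A q)) = (\<Sum>q\<in>?Q - ?X. disc (Delta A q)) + (\<Sum>q\<in>?Q \<inter> ?X. disc (Delta A q))"
    using finite_Q_upto by (subst sum.union_disjoint[symmetric]) (auto intro!: sum.cong)
  also have "(\<Sum>q\<in>?Q - ?X. disc (Delta A q)) \<le> 133 * (420 * decay_const) * V * exp (- S / 6)"
  proof -
    have "exp (S / 6) \<le> exp ((ln x / 100 + 201) / 6)" using S by simp
    then have "exp (S / 6) + 1 \<le> x powr (1 / 3)" using x(6) by linarith
    then show ?thesis using sum_disc_nonexceptional_le[of x A] x unfolding S_def V_def by (simp add: mult.assoc)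
  qed
  also have "(\<Sum>q\<in>?Q \<inter> ?X. disc (Delta A q)) \<le> (3 + smooth_const) * V * exp (- S / 6)"
  proof -
    have "(\<Sum>q\<in>?Q \<inter> ?X. disc (Delta A q)) \<le> (\<Sum>q\<in>?Q \<inter> ?X. 1)" by (intro sum_mono disc_le_1)
    also have "\<dots> \<le> real (card ?X)" using finX by (simp add: card_mono)
    also have "\<dots> \<le> (3 + smooth_const) * x powr (23 / 24)" using x by (intro card_exceptional_le) auto
    also have "x powr (23 / 24) \<le> exp (- (ln x / 100 + 201) / 6) * (x / ln x)" by (rule x)
    also have "\<dots> \<le> exp (- S / 6) * V"
    proof (rule mult_mono)
      have "(1::real) \<le> exp (\<Sum>p\<in>family_primes A 1 x. 1 / real p)" by (simp add: sum_nonneg)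
      then show "x / ln x \<le> V" using mult_left_mono[of 1 _ "x / ln x"] xl by (simp add: V_def)
    qed (use S xl in auto)
    finally show ?thesis using sc by (simp add: mult_left_mono mult.assoc mult.commute[of V])
  qed
  finally have num: "(\<Sum>q\<in>?Q. disc (Delta A q)) \<le> (133 * (420 * decay_const) + (3 + smooth_const)) * V * exp (- S / 6)"
    by (simp add: distrib_right)
  define c where "c = \<alpha> * exp (- 42) / 4"
  have c0: "c > 0" using \<alpha> by (simp add: c_def)
  have den: "c * V \<le> real (card ?Q)"
    using card_Q_upto_ge[OF hyp x(3,4,5) \<alpha>] by (simp add: c_def V_def mult.assoc)
  have nn: "0 \<le> (133 * (420 * decay_const) + (3 + smooth_const)) * V * exp (- S / 6)"
    using sc V0 by (simp add: decay_const_def)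
  have "(\<Sum>q\<in>?Q. disc (Delta A q)) / real (card ?Q)
    \<le> (133 * (420 * decay_const) + (3 + smooth_const)) * V * exp (- S / 6) / real (card ?Q)"
    by (rule divide_right_mono[OF num]) simp
  also have "\<dots> \<le> (133 * (420 * decay_const) + (3 + smooth_const)) * V * exp (- S / 6) / (c * V)"
  proof (rule divide_left_mono[OF den nn])
    have "0 < c * V" using c0 V0 by simp
    then show "0 < real (card ?Q) * (c * V)" using den by (intro mult_pos_pos[of _ "c * V"]) linarith+
  qed
  also have "\<dots> = 4 * exp 42 * (133 * (420 * decay_const) + (3 + smooth_const)) / \<alpha> * exp (- S / 6)"
  proof -
    have "1 / c = 4 * exp 42 / \<alpha>" by (simp add: c_def exp_minus inverse_eq_divide)
    moreover have "K * V * e / (c * V) = K * e * (1 / c)" for K e :: real using V0 by simp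
    ultimately show ?thesis by simp
  qed
  finally show ?thesis .
qed

theorem theorem1p1:
  "\<exists>C::real. C > 0 \<and>
     (\<forall>(\<alpha>::real) (x0::real). \<alpha> > 0 \<and> x0 \<ge> 2 \<longrightarrow>
       (\<exists>X::real. \<forall>A :: nat \<Rightarrow> nat set. residue_family A \<longrightarrow>
         (\<forall>y::real. y \<ge> x0 \<longrightarrow>
            (\<Sum>p | prime p \<and> real p \<le> y \<and> rho A p \<ge> 1. ln (real p)) \<ge> \<alpha> * y) \<longrightarrow>
         (\<forall>x::real. x \<ge> X \<longrightarrow>
            (1 / real (card (Q_upto A x))) * (\<Sum>q\<in>Q_upto A x. disc (Delta A q))
              \<le> (C / \<alpha>) *
                exp (- (1 / 6) * (\<Sum>p | prime p \<and> real p \<le> x \<and> rho A p \<ge> 2. 1 / real p)))))"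
proof -
  define C where "C = 4 * exp 42 * (133 * (420 * decay_const) + (3 + smooth_const))"
  have "C > 0" by (simp add: C_def decay_const_def smooth_const_def add_pos_pos)
  moreover have "\<exists>X::real. \<forall>A :: nat \<Rightarrow> nat set. residue_family A \<longrightarrow>
         (\<forall>y::real. y \<ge> x0 \<longrightarrow>
            (\<Sum>p | prime p \<and> real p \<le> y \<and> rho A p \<ge> 1. ln (real p)) \<ge> \<alpha> * y) \<longrightarrow>
         (\<forall>x::real. x \<ge> X \<longrightarrow>
            (1 / real (card (Q_upto A x))) * (\<Sum>q\<in>Q_upto A x. disc (Delta A q))
              \<le> (C / \<alpha>) *
                exp (- (1 / 6) * (\<Sum>p | prime p \<and> real p \<le> x \<and> rho A p \<ge> 2. 1 / real p)))"
    if \<alpha>: "\<alpha> > 0" for \<alpha> x0 :: real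
  proof -
    obtain X where X: "\<And>x. x \<ge> X \<Longrightarrow> ln x \<ge> 144 \<and> ln x \<le> x powr (1 / 10) \<and> x > 1 \<and> sqrt x \<ge> x0 \<and> ln x \<le> \<alpha> * sqrt x
      \<and> exp ((ln x / 100 + 201) / 6) + 1 \<le> x powr (1 / 3)
      \<and> x powr (23 / 24) \<le> exp (- (ln x / 100 + 201) / 6) * (x / ln x)"
      using eventually_large[OF \<alpha>, of x0] by blast
    show ?thesis
    proof (intro exI[of _ X] allI impI)
      fix A :: "nat \<Rightarrow> nat set" and x :: real
      assume "\<forall>y\<ge>x0. (\<Sum>p | prime p \<and> real p \<le> y \<and> rho A p \<ge> 1. ln (real p)) \<ge> \<alpha> * y" and "x \<ge> X"
      then have "(\<Sum>q\<in>Q_upto A x. disc (Delta A q)) / real (card (Q_upto A x))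
        \<le> C / \<alpha> * exp (- (\<Sum>p\<in>family_primes A 2 x. 1 / real p) / 6)"
        unfolding C_def using X[of x] \<alpha> by (intro mean_disc_le) auto
      then show "(1 / real (card (Q_upto A x))) * (\<Sum>q\<in>Q_upto A x. disc (Delta A q))
              \<le> (C / \<alpha>) *
                exp (- (1 / 6) * (\<Sum>p | prime p \<and> real p \<le> x \<and> rho A p \<ge> 2. 1 / real p))"
        by (simp add: family_primes_def)
    qed
  qed
  ultimately show ?thesis by blast
qed

end
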